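(* Let $\alpha,\beta\in(0,1)$. Let $\Psi_\alpha=\max(\Phi^{(1)}_{\alpha/2},\Phi^{(2)}_{\alpha/2})$ be the test of $f=g$ built from the Haar basis of $\mathbb{L}^2([0,1])$ with parameters $\bar J\geq1$ and $\tilde J$, as described in the context. Assume that $\ln\ln n\ge1$, $2^{\bar J}\ge n^2$ and $\tilde J=+\infty$. Then, for any $\delta>0$, $\gamma>0$, $R,R',R''>0$, if $$\mathcal{B}_{\delta,\gamma,\infty}(R,R',R'')=\left\{(f,g)\ :\ (f-g)\in\mathcal{B}^\delta_{2,\infty}(R)\cap\mathcal{W}_\gamma(R'),\ \max(\|f\|_\infty,\|g\|_\infty)\le R''\right\},$$ the uniform separation rate $\rho(\Psi_\alpha,\mathcal{B}_{\delta,\gamma,\infty}(R,R',R''),\beta)$ is upper bounded by (i) $C(\delta,\gamma,R,R',R'',\alpha,\beta)\left(\frac{\ln\ln n}{n}\right)^{\frac{2\delta}{4\delta+1}}$ if $\delta\ge\gamma/2$, (ii) $C(\delta,\gamma,R,R',R'',\alpha,\beta)\left(\frac{\ln n}{n}\right)^{\frac{\gamma}{2\gamma+1}}$ if $\delta<\gamma/2$, where $C(\delta,\gamma,R,R',R'',\alpha,\beta)$ denotes a positive constant that may depend on the indicated parameters.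
   Context: Setting: $\mathbb{X}=[0,1]$, $\nu$ is the Lebesgue measure on $[0,1]$, $n$ is a positive number, $d\mu=n\,d\nu$. $N^1$ and $N^{-1}$ are independent Poisson processes on $\mathbb{X}$ with intensities $f$ and $g$ with respect to $\mu$; $\mathbb{P}_{f,g}$ is their joint distribution; $\|h\|_\infty=\sup|h|$, $\|h\|=(\int h^2d\nu)^{1/2}$. Standing assumption: $f,g$ are integrable and bounded. Uniform separation rate of a $\{0,1\}$-valued test $\Phi$ (rejecting $f=g$ when $\Phi=1$) over a class $\mathcal{S}$ of pairs $(f,g)$: $\rho(\Phi,\mathcal{S},\beta)=\inf\{\rho>0:\ \sup_{(f,g)\in\mathcal{S},\,\|f-g\|>\rho}\mathbb{P}_{f,g}(\Phi=0)\le\beta\}$. $N$ is the pooled process ($dN=dN^1+dN^{-1}$), with $N_n$ points $X_1,\ldots,X_{N_n}$; for $x\in N$, $\varepsilon^0_x=1$ if $x$ belongs to $N^1$ and $\varepsilon^0_x=-1$ if $x$ belongs to $N^{-1}$. $(\varepsilon_i)_{i\in\mathbb{N}}$ are i.i.d. Rademacher variables independent of $N$. For a symmetric kernel $K$, $\hat T_K=\sum_{x\ne x'\in N}K(x,x')\varepsilon^0_x\varepsilon^0_{x'}$ and $\hat T_K^{\varepsilon}=\sum_{i\ne i'\in\{1,\ldots,N_n\}}K(X_i,X_{i'})\varepsilon_i\varepsilon_{i'}$. Aggregated test of level $a\in(0,1)$ associated with a family of symmetric kernels $\{K_m,m\in\mathcal{M}\}$ and weights $w_m>0$ with $\sum_{m\in\mathcal{M}}e^{-w_m}\le1$: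 for $u\in(0,1)$, $q^{(N)}_{m,1-u}$ is the $(1-u)$ quantile of $\hat T_{K_m}^{\varepsilon}$ conditionally on $N$; $u_a^{(N)}=\sup\{u>0:\mathbb{P}(\sup_{m\in\mathcal{M}}(\hat T_{K_m}^{\varepsilon}-q^{(N)}_{m,1-ue^{-w_m}})>0\,|\,N)\le a\}$; the test is $\mathbf{1}_{\sup_{m\in\mathcal{M}}(\hat T_{K_m}-q^{(N)}_{m,1-u_a^{(N)}e^{-w_m}})>0}$. Haar basis: $\varphi_0=\mathbf{1}_{[0,1]}$, $\varphi_{(j,k)}(x)=2^{j/2}\psi(2^jx-k)$ for $j\in\mathbb{N}$ (including $0$), $k\in\{0,\ldots,2^j-1\}$, with $\psi=\mathbf{1}_{[0,1/2)}-\mathbf{1}_{[1/2,1)}$. Let $\Lambda_J=\{(j,k):j\in\{0,\ldots,J-1\},k\in\{0,\ldots,2^j-1\}\}$ (all pairs $(j,k)$ with $j\in\mathbb{N}$, $k\in\{0,\ldots,2^j-1\}$, if $J=+\infty$). $\Phi^{(1)}_a$: the aggregated test of level $a$ for the kernels $K_J$, $0\le J\le\bar J$, where $K_0(x,x')=\varphi_0(x)\varphi_0(x')$ and $K_J(x,x')=\sum_{\lambda\in\{0\}\cup\Lambda_J}\varphi_\lambda(x)\varphi_\lambda(x')$ for $J\ge1$, with weights $w_J=2(\ln(J+1)+\ln(\pi/\sqrt6))$. $\Phi^{(2)}_a$: the aggregated test of level $a$ for the kernels $K_\lambda(x,x')=\varphi_\lambda(x)\varphi_\lambda(x')$, $\lambda\in\{0\}\cup\Lambda_{\tilde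 J}$, with weights $w_0=\ln2$, $w_{(j,k)}=\ln(2^j)+2(\ln(j+1)+\ln(\pi/\sqrt3))$. Besov body: $\mathcal{B}^\delta_{2,\infty}(R)$ is the set of $s=\alpha_0\varphi_0+\sum_{j\in\mathbb{N}}\sum_{k=0}^{2^j-1}\alpha_{(j,k)}\varphi_{(j,k)}$ with $\alpha_0^2\le R^2$ and, for all $j\in\mathbb{N}$, $\sum_{k=0}^{2^j-1}\alpha_{(j,k)}^2\le R^22^{-2j\delta}$. Weak Besov body: $\mathcal{W}_\gamma(R')$ is the set of $s=\alpha_0\varphi_0+\sum_{j\in\mathbb{N}}\sum_{k=0}^{2^j-1}\alpha_{(j,k)}\varphi_{(j,k)}$ such that for all $t>0$, $\alpha_0^2\mathbf{1}_{\alpha_0^2\le t}+\sum_{j\in\mathbb{N}}\sum_{k=0}^{2^j-1}\alpha_{(j,k)}^2\mathbf{1}_{\alpha_{(j,k)}^2\le t}\le R'^2t^{\frac{2\gamma}{1+2\gamma}}$. *)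

theory Defs
  imports "HOL-Probability.Probability"
begin

section \<open>Poisson processes on the unit interval\<close>

definition nu :: "real measure" where
  "nu = restrict_space lborel {0..1}"

definition mu :: "real \<Rightarrow> real measure" where
  "mu n = scale_measure (ennreal n) nu"

text \<open>A realisation of a point process is a finite subset of [0,1]. Sets, rather than multisets,
  suffice since intensities are densities with respect to a diffuse measure, so that the processes
  have no multiple points almost surely.\<close>

definition conf :: "real set measure" where
  "conf = sigma {A. finite A \<and> A \<subseteq> {0..1}}
     {{A. finite A \<and> A \<subseteq> {0..1} \<and> card (A \<inter> B) = k} | B k. B \<in> sets borel}"

definition intensity :: "(real \<Rightarrow> real) \<Rightarrow> bool" where
  "intensity f \<longleftrightarrow> integrable nu f \<and> (\<forall>x\<in>{0..1}. 0 \<le> f x) \<and> bounded (f ` {0..1})"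

text \<open>Independence over countably many disjoint sets includes finitely many sets, since some of
  the sets may be empty.\<close>

definition poisson_process ::
  "'w measure \<Rightarrow> real \<Rightarrow> (real \<Rightarrow> real) \<Rightarrow> ('w \<Rightarrow> real set) \<Rightarrow> bool" where
  "poisson_process M n f N \<longleftrightarrow>
     N \<in> measurable M conf \<and>
     (\<forall>B k. B \<in> sets borel \<and> B \<subseteq> {0..1} \<longrightarrow>
        measure M {\<omega> \<in> space M. card (N \<omega> \<inter> B) = k} =
          (LINT x:B|mu n. f x) ^ k / fact k * exp (- (LINT x:B|mu n. f x))) \<and>
     (\<forall>F :: nat \<Rightarrow> real set.
        (\<forall>i. F i \<in> sets borel \<and> F i \<subseteq> {0..1}) \<and> disjoint_family F \<longrightarrow>
        prob_space.indep_vars M (\<lambda>_. count_space UNIV) (\<lambda>i \<omega>. card (N \<omega> \<inter> F i)) UNIV)"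

text \<open>\<open>P\<close> is the joint distribution of two independent Poisson processes with intensities
  \<open>f\<close>, \<open>g\<close> with respect to \<open>mu n\<close>; the processes are the coordinate maps. These conditions
  determine \<open>P\<close> uniquely.\<close>

definition joint_poisson_law ::
  "real \<Rightarrow> (real \<Rightarrow> real) \<Rightarrow> (real \<Rightarrow> real) \<Rightarrow> (real set \<times> real set) measure \<Rightarrow> bool" where
  "joint_poisson_law n f g P \<longleftrightarrow>
     prob_space P \<and> sets P = sets (conf \<Otimes>\<^sub>M conf) \<and>
     poisson_process P n f fst \<and> poisson_process P n g snd \<and>
     prob_space.indep_var P conf fst conf snd"

section \<open>Norms and uniform separation rate\<close>

definition L2norm :: "(real \<Rightarrow> real) \<Rightarrow> real" where
  "L2norm h = sqrt (LINT x|nu. (h x)\<^sup>2)"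

definition supnorm :: "(real \<Rightarrow> real) \<Rightarrow> real" where
  "supnorm h = (SUP x\<in>{0..1}. \<bar>h x\<bar>)"

type_synonym test = "real set \<times> real set \<Rightarrow> nat"

text \<open>Values in \<open>ennreal\<close>, so that the supremum over no alternative is 0 and the infimum over no
  radius is infinite.\<close>

definition separation_rate ::
  "((real \<Rightarrow> real) \<Rightarrow> (real \<Rightarrow> real) \<Rightarrow> (real set \<times> real set) measure) \<Rightarrow> test \<Rightarrow>
   ((real \<Rightarrow> real) \<times> (real \<Rightarrow> real)) set \<Rightarrow> real \<Rightarrow> ennreal" where
  "separation_rate P \<Phi> S \<beta> =
     (INF \<rho> \<in> {\<rho>::real. \<rho> > 0 \<and>
        (SUP (f, g) \<in> {(f, g). (f, g) \<in> S \<and> L2norm (\<lambda>x. f x - g x) > \<rho>}.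
           emeasure (P f g) {\<omega> \<in> space (P f g). \<Phi> \<omega> = 0}) \<le> ennreal \<beta>}. ennreal \<rho>)"

section \<open>Aggregated tests\<close>

type_synonym kernel = "real \<Rightarrow> real \<Rightarrow> real"

text \<open>In the pooled process \<open>A \<union> B\<close> the points of \<open>A\<close> carry the mark 1 and those of \<open>B\<close> the
  mark -1; almost surely \<open>A\<close> and \<open>B\<close> are disjoint.\<close>

definition mark :: "real set \<Rightarrow> real \<Rightarrow> real" where
  "mark A x = (if x \<in> A then 1 else - 1)"

definition T_hat :: "kernel \<Rightarrow> real set \<times> real set \<Rightarrow> real" where
  "T_hat K = (\<lambda>(A, B).
     \<Sum>(x, x') \<in> {(x, x'). x \<in> A \<union> B \<and> x' \<in> A \<union> B \<and> x \<noteq> x'}. K x x' * mark A x * mark A x')"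

text \<open>The points are numbered from 0, in increasing order; the conditional law of the bootstrapped
  statistic does not depend on the numbering.\<close>

definition point :: "real set \<Rightarrow> nat \<Rightarrow> real" where
  "point N i = sorted_list_of_set N ! i"

definition T_boot :: "kernel \<Rightarrow> real set \<Rightarrow> (nat \<Rightarrow> real) \<Rightarrow> real" where
  "T_boot K N e =
     (\<Sum>(i, i') \<in> {(i, i'). i < card N \<and> i' < card N \<and> i \<noteq> i'}.
        K (point N i) (point N i') * e i * e i')"

text \<open>As the Rademacher variables are independent of the pooled process, conditioning on that
  process amounts to freezing \<open>N\<close>; only the first \<open>card N\<close> variables then matter.\<close>

definition rademacher :: "nat \<Rightarrow> (nat \<Rightarrow> real) pmf" where
  "rademacher k = Pi_pmf {..<k} 0 (\<lambda>_. pmf_of_set {- 1, 1})"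

definition cond_prob :: "real set \<Rightarrow> (nat \<Rightarrow> real) set \<Rightarrow> real" where
  "cond_prob N E = measure_pmf.prob (rademacher (card N)) E"

text \<open>For \<open>0 < u < 1\<close> this is the usual \<open>(1 - u)\<close> quantile, the condition of positivity being then
  automatic. That condition matters only for \<open>u = 1\<close>, which can be reached when the supremum
  \<open>u_level\<close> below is not attained; there it gives the smallest possible value of the statistic,
  the limit of the quantiles of positive order, instead of minus infinity.\<close>

definition quantile :: "kernel \<Rightarrow> real set \<Rightarrow> real \<Rightarrow> real" where
  "quantile K N u =
     Inf {t. cond_prob N {e. T_boot K N e \<le> t} \<ge> 1 - u \<and> cond_prob N {e. T_boot K N e \<le> t} > 0}"

text \<open>Only those \<open>u\<close> are admitted for which all quantile orders involved lie in (0,1).\<close>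

definition u_level ::
  "'m set \<Rightarrow> ('m \<Rightarrow> kernel) \<Rightarrow> ('m \<Rightarrow> real) \<Rightarrow> real \<Rightarrow> real set \<Rightarrow> real" where
  "u_level I K w a N =
     Sup {u. u > 0 \<and> (\<forall>m\<in>I. u * exp (- w m) < 1) \<and>
        cond_prob N {e. (SUP m\<in>I.
           ereal (T_boot (K m) N e - quantile (K m) N (u * exp (- w m)))) > 0} \<le> a}"

definition aggregated_test ::
  "'m set \<Rightarrow> ('m \<Rightarrow> kernel) \<Rightarrow> ('m \<Rightarrow> real) \<Rightarrow> real \<Rightarrow> test" where
  "aggregated_test I K w a = (\<lambda>(A, B).
     let N = A \<union> B in
       of_bool ((SUP m\<in>I. ereal (T_hat (K m) (A, B)
          - quantile (K m) N (u_level I K w a N * exp (- w m)))) > 0))"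

section \<open>Haar basis\<close>

definition psi :: "real \<Rightarrow> real" where
  "psi x = indicator {0..<1/2} x - indicator {1/2..<1} x"

datatype haar_index = Root | Node nat nat

fun haar :: "haar_index \<Rightarrow> real \<Rightarrow> real" where
  "haar Root x = indicator {0..1} x"
| "haar (Node j k) x = 2 powr (real j / 2) * psi (2 ^ j * x - real k)"

definition Lam :: "enat \<Rightarrow> haar_index set" where
  "Lam J = {Node j k | j k. enat j < J \<and> k < 2 ^ j}"

text \<open>For \<open>J = 0\<close> the sum reduces to the index \<open>Root\<close>.\<close>

definition K_level :: "nat \<Rightarrow> kernel" where
  "K_level J x x' = (\<Sum>l \<in> {Root} \<union> Lam (enat J). haar l x * haar l x')"

definition w_level :: "nat \<Rightarrow> real" where
  "w_level J = 2 * (ln (real J + 1) + ln (pi / sqrt 6))"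

definition Phi1 :: "nat \<Rightarrow> real \<Rightarrow> test" where
  "Phi1 Jbar a = aggregated_test {0..Jbar} K_level w_level a"

definition K_single :: "haar_index \<Rightarrow> kernel" where
  "K_single l x x' = haar l x * haar l x'"

fun w_single :: "haar_index \<Rightarrow> real" where
  "w_single Root = ln 2"
| "w_single (Node j k) = ln (2 ^ j) + 2 * (ln (real j + 1) + ln (pi / sqrt 3))"

definition Phi2 :: "enat \<Rightarrow> real \<Rightarrow> test" where
  "Phi2 Jt a = aggregated_test ({Root} \<union> Lam Jt) K_single w_single a"

definition Psi_test :: "nat \<Rightarrow> enat \<Rightarrow> real \<Rightarrow> test" where
  "Psi_test Jbar Jt \<alpha> = (\<lambda>\<omega>. max (Phi1 Jbar (\<alpha> / 2) \<omega>) (Phi2 Jt (\<alpha> / 2) \<omega>))"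

section \<open>Besov and weak Besov bodies\<close>

text \<open>The series converges to \<open>s\<close> in \<open>L\<^sup>2\<close>([0,1]).\<close>

definition has_haar_expansion :: "(real \<Rightarrow> real) \<Rightarrow> (haar_index \<Rightarrow> real) \<Rightarrow> bool" where
  "has_haar_expansion s c \<longleftrightarrow>
     s \<in> borel_measurable nu \<and> integrable nu (\<lambda>x. (s x)\<^sup>2) \<and>
     (\<lambda>J. L2norm (\<lambda>x. s x -
        (c Root * haar Root x + (\<Sum>j<J. \<Sum>k<2 ^ j. c (Node j k) * haar (Node j k) x))))
       \<longlonglongrightarrow> 0"

definition besov :: "real \<Rightarrow> real \<Rightarrow> (real \<Rightarrow> real) set" where
  "besov \<delta> R = {s. \<exists>c. has_haar_expansion s c \<and> (c Root)\<^sup>2 \<le> R\<^sup>2 \<and>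
     (\<forall>j. (\<Sum>k<2 ^ j. (c (Node j k))\<^sup>2) \<le> R\<^sup>2 * 2 powr (- 2 * real j * \<delta>))}"

definition weak_besov :: "real \<Rightarrow> real \<Rightarrow> (real \<Rightarrow> real) set" where
  "weak_besov \<gamma> R' = {s. \<exists>c. has_haar_expansion s c \<and>
     (\<forall>t>0. ennreal ((c Root)\<^sup>2 * of_bool ((c Root)\<^sup>2 \<le> t)) +
        (\<Sum>j. \<Sum>k<2 ^ j. ennreal ((c (Node j k))\<^sup>2 * of_bool ((c (Node j k))\<^sup>2 \<le> t)))
      \<le> ennreal (R'\<^sup>2 * t powr (2 * \<gamma> / (1 + 2 * \<gamma>))))}"

definition besov_class ::
  "real \<Rightarrow> real \<Rightarrow> real \<Rightarrow> real \<Rightarrow> real \<Rightarrow> ((real \<Rightarrow> real) \<times> (real \<Rightarrow> real)) set" where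
  "besov_class \<delta> \<gamma> R R' R'' = {(f, g). intensity f \<and> intensity g \<and>
     (\<lambda>x. f x - g x) \<in> besov \<delta> R \<inter> weak_besov \<gamma> R' \<and> max (supnorm f) (supnorm g) \<le> R''}"

end

theory Submission
  imports Defs
begin

text \<open>The test accepts only if every kernel of both families accepts. For a given alternative it is
therefore enough to exhibit one kernel that rejects with probability at least \<open>1 - \<beta>\<close>, and the two
rates come from two choices of that kernel.

What a kernel has to beat is its bootstrap quantile. Given the points, the bootstrapped statistic
is a Rademacher chaos \<open>\<Sum>\<^bsub>x \<noteq> x'\<^esub> K(x,x') \<epsilon>\<^sub>x \<epsilon>\<^sub>x'\<close>, whose tails are exponential on the scale of
the square root of its energy \<open>\<Sum>\<^bsub>x \<noteq> x'\<^esub> K(x,x')\<^sup>2\<close> (\<open>exp_chaos_bound\<close>, \<open>chaos_tail\<close>). The quantile of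
order \<open>1 - u\<close> thus grows only like \<open>ln (1/u)\<close> times that scale, and this is what produces an iterated
logarithm out of the weights \<open>w\<^sub>J\<close>, which are of order \<open>ln J\<close>. Since \<open>\<Sum>\<^sub>m exp (- w\<^sub>m) \<le> 1\<close>, a union
bound shows that the calibrated level is at least the nominal level \<open>a\<close>, so that acceptance forces
\<open>T_hat \<le> 6 * sqrt energy * (w\<^sub>m + ln (1/a) + 1)\<close> for each kernel (\<open>aggregated_test_accepts\<close>).

The kernel \<open>K\<^sub>J\<close> is \<open>2 ^ J\<close> times the indicator that both points lie in the same dyadic interval
of length \<open>2 ^ - J\<close> (\<open>K_level_eq\<close>). The statistic and the energy are then polynomials in independent
Poisson counts, with explicit means and variances (\<open>block_stat_sum_variance\<close>). With \<open>h = f - g\<close>, the mean of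
the statistic is \<open>n\<^sup>2\<close> times the squared norm \<open>H\<close> of the projection of \<open>h\<close> on the step functions of
level \<open>J\<close>, and by Chebyshev's inequality the kernel rejects as soon as \<open>H\<close> exceeds a multiple of
\<open>2 powr (J/2) * (w\<^sub>J + ln (1/a) + 1) / n\<close> (\<open>level_power\<close>). The statistic of a single Haar function is the square of
a linear statistic, so that it detects a coefficient whose square exceeds a multiple of
\<open>(w\<^sub>m + ln (1/a) + 1) / n\<close> (\<open>coefficient_power\<close>).

For the first rate, a Besov function differs from its projection by at most a multiple of
\<open>2 powr (- J * \<delta>)\<close>; the level \<open>J\<close> balances this bias against the detection threshold. For the
second rate, only coefficients of levels up to a multiple of \<open>ln n\<close> matter, because the Besov
condition makes the other ones negligible. If none of them is detected, all are below a threshold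
of order \<open>ln n / n\<close>, and the weak Besov condition bounds the sum of their squares.\<close>

section \<open>Exponential moments of a Rademacher chaos of order two\<close>

lemma cosh_le_exp_half_square: "cosh (x::real) \<le> exp (x\<^sup>2 / 2)"
proof -
  have fact2: "(2::real) ^ n * fact n \<le> fact (2 * n)" for n
  proof (induction n)
    case (Suc n)
    have "(2::real) ^ Suc n * fact (Suc n) = (2 * real (Suc n)) * (2 ^ n * fact n)" by simp
    also have "\<dots> \<le> (2 * real (Suc n)) * fact (2 * n)"
      using Suc by (intro mult_left_mono) auto
    also have "\<dots> \<le> (2 * real (Suc n)) * (real (2 * n + 1) * fact (2 * n))"
      by (intro mult_left_mono) auto
    also have "\<dots> = fact (2 * Suc n)" by (simp add: algebra_simps)
    finally show ?case .
  qed simp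
  have A: "(\<lambda>n. x ^ (2 * n) /\<^sub>R fact (2 * n)) sums cosh x"
  proof -
    have "(\<lambda>n. if even n then x ^ n /\<^sub>R fact n else 0) sums cosh x" by (rule cosh_converges)
    then have "(\<lambda>n. (\<lambda>n. if even n then x ^ n /\<^sub>R fact n else 0) (2 * n)) sums cosh x"
      by (subst sums_mono_reindex) (auto simp: strict_mono_def elim!: evenE)
    then show ?thesis by simp
  qed
  have B: "(\<lambda>n. (x\<^sup>2 / 2) ^ n /\<^sub>R fact n) sums exp (x\<^sup>2 / 2)" by (rule exp_converges)
  show ?thesis
  proof (rule sums_le[OF _ A B])
    fix n
    have "x ^ (2 * n) / fact (2 * n) \<le> x ^ (2 * n) / (2 ^ n * fact n)"
      using fact2[of n] by (intro divide_left_mono) auto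
    then show "x ^ (2 * n) /\<^sub>R fact (2 * n) \<le> (x\<^sup>2 / 2) ^ n /\<^sub>R fact n"
      by (simp add: field_simps power_mult power_divide flip: power_mult)
  qed
qed

lemma finite_set_pmf_rademacher: "finite (set_pmf (rademacher k))"
proof -
  have "set_pmf (rademacher k) = PiE_dflt {..<k} 0 (\<lambda>_. {-1, 1})"
    unfolding rademacher_def by (subst set_Pi_pmf) (auto simp: PiE_dflt_def)
  then show ?thesis by (auto intro!: finite_PiE_dflt)
qed

lemma expectation_rademacher_Suc:
  fixes F :: "(nat \<Rightarrow> real) \<Rightarrow> real"
  shows "measure_pmf.expectation (rademacher (Suc k)) F =
    measure_pmf.expectation (rademacher k) (\<lambda>e. (F (e(k := 1)) + F (e(k := -1))) / 2)"
proof -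
  have "rademacher (Suc k) =
     do {y \<leftarrow> pmf_of_set {-1, 1}; f \<leftarrow> rademacher k; return_pmf (f(k := y))}"
    unfolding rademacher_def lessThan_Suc by (subst Pi_pmf_insert') auto
  also have "\<dots> = do {f \<leftarrow> rademacher k; y \<leftarrow> pmf_of_set {-1, 1}; return_pmf (f(k := y))}"
    by (rule bind_commute_pmf)
  finally have R: "rademacher (Suc k) = \<dots>" .
  have I: "measure_pmf.expectation (pmf_of_set {-1, 1} \<bind> (\<lambda>y. return_pmf (f(k := y)))) F
     = (F (f(k := 1)) + F (f(k := -1))) / 2" for f
    by (subst pmf_expectation_bind_pmf_of_set) (auto simp: field_simps)
  show ?thesis
    unfolding R
    by (subst pmf_expectation_bind[where A = "set_pmf (rademacher k)"])
       (auto simp: finite_set_pmf_rademacher I integral_measure_pmf[where A = "set_pmf (rademacher k)"] sum_divide_distrib)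
qed

definition chaos :: "(nat \<Rightarrow> nat \<Rightarrow> real) \<Rightarrow> nat \<Rightarrow> (nat \<Rightarrow> real) \<Rightarrow> real" where
  "chaos b k e = (\<Sum>i<k. \<Sum>j<i. b i j * e i * e j)"

text \<open>Only the entries below the diagonal enter, each pair of indices being counted once.\<close>

definition chaos_norm2 :: "(nat \<Rightarrow> nat \<Rightarrow> real) \<Rightarrow> nat \<Rightarrow> real" where
  "chaos_norm2 b k = (\<Sum>i<k. \<Sum>j<i. (b i j)\<^sup>2)"

lemma chaos_norm2_nonneg: "chaos_norm2 b k \<ge> 0"
  unfolding chaos_norm2_def by (intro sum_nonneg) auto

lemma square_sum_lower_triangle:
  fixes c :: "nat \<Rightarrow> real"
  shows "(\<Sum>j<k. c j)\<^sup>2 = (\<Sum>j<k. (c j)\<^sup>2) + 2 * (\<Sum>i<k. \<Sum>j<i. c i * c j)"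
  by (induction k) (auto simp: power2_eq_square algebra_simps sum_distrib_left)

lemma chaos_cong:
  assumes "\<And>i. i < k \<Longrightarrow> e i = e' i"
  shows "chaos b k e = chaos b k e'"
  unfolding chaos_def using assms by (intro sum.cong) auto

lemma chaos_Suc_upd:
  "chaos b (Suc k) (e(k := y)) = chaos b k e + y * (\<Sum>j<k. b k j * e j)"
proof -
  have "chaos b k (e(k := y)) = chaos b k e" by (rule chaos_cong) auto
  then show ?thesis
    by (simp add: chaos_def sum_distrib_left mult_ac)
qed

lemma chaos_norm2_rank_one_update:
  fixes a :: "nat \<Rightarrow> real"
  fixes k :: nat
  defines "s \<equiv> \<Sum>j<k. (a j)\<^sup>2"
  shows "chaos_norm2 (\<lambda>i j. b i j + a i * a j) k
    \<le> chaos_norm2 b k + 2 * sqrt (chaos_norm2 b k) * s + s\<^sup>2"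
proof -
  define I where "I = Sigma {..<k} (\<lambda>i. {..<i})"
  have S: "(\<Sum>i<k. \<Sum>j<i. h i j) = (\<Sum>p\<in>I. h (fst p) (snd p))" for h :: "nat \<Rightarrow> nat \<Rightarrow> real"
    unfolding I_def by (simp add: sum.Sigma case_prod_unfold)
  define N where "N = chaos_norm2 b k"
  define r2 where "r2 = (\<Sum>p\<in>I. (a (fst p) * a (snd p))\<^sup>2)"
  have N: "N = (\<Sum>p\<in>I. (b (fst p) (snd p))\<^sup>2)"
    unfolding N_def chaos_norm2_def S ..
  have N0: "N \<ge> 0" unfolding N by (intro sum_nonneg) auto
  have r20: "r2 \<ge> 0" unfolding r2_def by (intro sum_nonneg) auto
  have s0: "s \<ge> 0" unfolding s_def by (intro sum_nonneg) auto
  have "s\<^sup>2 = (\<Sum>j<k. ((a j)\<^sup>2)\<^sup>2) + 2 * r2"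
    unfolding s_def square_sum_lower_triangle r2_def S by (simp add: power_mult_distrib)
  moreover have "0 \<le> (\<Sum>j<k. ((a j)\<^sup>2)\<^sup>2)" by (intro sum_nonneg) auto
  ultimately have r2s: "r2 \<le> s\<^sup>2" using r20 by linarith
  define x where "x = (\<Sum>p\<in>I. b (fst p) (snd p) * (a (fst p) * a (snd p)))"
  have "x\<^sup>2 \<le> N * r2" unfolding x_def N r2_def by (rule Cauchy_Schwarz_ineq_sum)
  also have "\<dots> \<le> N * s\<^sup>2" using r2s N0 by (intro mult_left_mono)
  also have "\<dots> = (sqrt N * s)\<^sup>2" using N0 by (simp add: power_mult_distrib)
  finally have x: "x \<le> sqrt N * s"
    using N0 s0 by (meson abs_ge_self mult_nonneg_nonneg order_trans power2_le_imp_le real_sqrt_ge_zero abs_le_square_iff power2_le_iff_abs_le)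
  have "chaos_norm2 (\<lambda>i j. b i j + a i * a j) k = N + 2 * x + r2"
    unfolding chaos_norm2_def S N x_def r2_def
    by (simp add: power2_sum sum.distrib sum_distrib_left mult_ac)
  also have "\<dots> \<le> N + 2 * (sqrt N * s) + s\<^sup>2" using x r2s by linarith
  finally show ?thesis by (simp add: N_def mult_ac)
qed

text \<open>Induction on the number of signs. Averaging over the last sign replaces the linear form \<open>L\<close> which
multiplies it by \<open>cosh L \<le> exp (L\<^sup>2 / 2)\<close>. Since the squared signs are 1, \<open>L\<^sup>2\<close> is a constant plus a
chaos in the remaining signs, so a chaos with one sign less remains, whose matrix has received a
rank one update. For norms at most 1/4 the update costs less than what the removed row frees.\<close>

lemma exp_chaos_bound:
  assumes "chaos_norm2 b k \<le> 1 / 16"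
  shows "measure_pmf.expectation (rademacher k) (\<lambda>e. exp (chaos b k e)) \<le> exp (2 * chaos_norm2 b k)"
  using assms
proof (induction k arbitrary: b)
  case 0
  then show ?case by (simp add: chaos_def chaos_norm2_def)
next
  case (Suc k)
  define a where "a = b k"
  define s where "s = (\<Sum>j<k. (a j)\<^sup>2)"
  define N where "N = chaos_norm2 b k"
  have tot: "chaos_norm2 b (Suc k) = N + s"
    by (simp add: chaos_norm2_def N_def s_def a_def)
  have N0: "N \<ge> 0" unfolding N_def chaos_norm2_def by (intro sum_nonneg) auto
  have s0: "s \<ge> 0" unfolding s_def by (intro sum_nonneg) auto
  have Ns: "N + s \<le> 1 / 16" using Suc.prems tot by simp
  have sN: "sqrt N \<le> 1 / 4"
    using Ns s0 N0 by (intro real_le_lsqrt) (auto simp: power2_eq_square)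
  define b' where "b' = (\<lambda>i j. b i j + a i * a j)"
  have "chaos_norm2 b' k \<le> N + 2 * sqrt N * s + s\<^sup>2"
    unfolding b'_def N_def s_def by (rule chaos_norm2_rank_one_update)
  also have "\<dots> \<le> N + 2 * (1/4) * s + (1/16) * s"
    unfolding power2_eq_square using sN s0 Ns N0 by (intro add_mono mult_right_mono mult_left_mono) auto
  finally have b': "chaos_norm2 b' k \<le> N + 9 / 16 * s" by simp
  have IH: "measure_pmf.expectation (rademacher k) (\<lambda>e. exp (chaos b' k e)) \<le> exp (2 * chaos_norm2 b' k)"
    using b' Ns s0 by (intro Suc.IH) auto
  have step: "(exp (chaos b (Suc k) (e(k := 1))) + exp (chaos b (Suc k) (e(k := -1)))) / 2
     \<le> exp (s / 2) * exp (chaos b' k e)" if e: "e \<in> set_pmf (rademacher k)" for e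
  proof -
    define L where "L = (\<Sum>j<k. a j * e j)"
    have e1: "(e j)\<^sup>2 = 1" if "j < k" for j
    proof -
      have "e \<in> PiE_dflt {..<k} 0 (\<lambda>_. {-1, 1})"
        using e unfolding rademacher_def by (subst (asm) set_Pi_pmf) (auto simp: PiE_dflt_def)
      then have "e j \<in> {-1,1}" using that by (auto simp: PiE_dflt_def)
      then show ?thesis by auto
    qed
    have "(exp (chaos b (Suc k) (e(k := 1))) + exp (chaos b (Suc k) (e(k := -1)))) / 2
      = exp (chaos b k e) * cosh L"
      unfolding chaos_Suc_upd L_def a_def
      by (simp add: exp_add exp_diff cosh_def field_simps exp_minus)
    also have "\<dots> \<le> exp (chaos b k e) * exp (L\<^sup>2 / 2)"
      by (intro mult_left_mono cosh_le_exp_half_square) auto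
    also have "\<dots> = exp (s / 2) * exp (chaos b' k e)"
    proof -
      have "L\<^sup>2 = s + 2 * (\<Sum>i<k. \<Sum>j<i. a i * a j * e i * e j)"
        unfolding L_def square_sum_lower_triangle s_def
        by (intro arg_cong2[where f = "(+)"] sum.cong) (auto simp: power_mult_distrib e1 mult_ac)
      moreover have "chaos b' k e = chaos b k e + (\<Sum>i<k. \<Sum>j<i. a i * a j * e i * e j)"
        by (simp add: chaos_def b'_def sum.distrib algebra_simps)
      ultimately show ?thesis by (simp add: exp_add[symmetric] add_ac)
    qed
    finally show ?thesis .
  qed
  have fin: "finite (set_pmf (rademacher k))" by (rule finite_set_pmf_rademacher)
  have "measure_pmf.expectation (rademacher (Suc k)) (\<lambda>e. exp (chaos b (Suc k) e))
     \<le> measure_pmf.expectation (rademacher k) (\<lambda>e. exp (s / 2) * exp (chaos b' k e))"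
    unfolding expectation_rademacher_Suc
    by (intro integral_mono_AE integrable_measure_pmf_finite fin) (auto simp: AE_measure_pmf_iff intro: step[simplified])
  also have "\<dots> = exp (s / 2) * measure_pmf.expectation (rademacher k) (\<lambda>e. exp (chaos b' k e))" by simp
  also have "\<dots> \<le> exp (s / 2) * exp (2 * chaos_norm2 b' k)"
    using IH by (intro mult_left_mono) auto
  also have "\<dots> \<le> exp (2 * chaos_norm2 b (Suc k))"
    using b' s0 unfolding tot exp_add[symmetric] by simp
  finally show ?case .
qed

text \<open>The exponential Markov inequality, after scaling the matrix to the largest norm 1/4 admitted by the
bound on the exponential moment.\<close>

lemma chaos_tail:
  assumes V: "chaos_norm2 b k \<le> V" and V0: "V \<ge> 0" and u: "0 < u" "u \<le> 1"
  shows "measure_pmf.prob (rademacher k) {e. chaos b k e > 4 * sqrt V * (ln (1 / u) + 1)} \<le> u"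
proof (cases "V = 0")
  case True
  then have "chaos_norm2 b k = 0"
    using V chaos_norm2_nonneg[of b k] by simp
  then have "\<And>i j. i < k \<Longrightarrow> j < i \<Longrightarrow> b i j = 0"
    unfolding chaos_norm2_def by (subst (asm) sum_nonneg_eq_0_iff) (auto simp: sum_nonneg_eq_0_iff sum_nonneg)
  then have "chaos b k e = 0" for e by (auto simp: chaos_def)
  then show ?thesis using True u by simp
next
  case False
  define th where "th = 1 / (4 * sqrt V)"
  have th: "th > 0" using False V0 by (simp add: th_def)
  define c where "c = (\<lambda>i j. th * b i j)"
  have cb: "chaos c k e = th * chaos b k e" for e
    by (simp add: chaos_def c_def sum_distrib_left mult_ac)
  have "chaos_norm2 c k = th\<^sup>2 * chaos_norm2 b k"
    by (simp add: chaos_norm2_def c_def sum_distrib_left mult_ac power_mult_distrib)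
  also have "\<dots> \<le> th\<^sup>2 * V" using V by (intro mult_left_mono) auto
  also have "\<dots> = 1 / 16" using False V0 by (simp add: th_def power_divide power_mult_distrib)
  finally have c: "chaos_norm2 c k \<le> 1 / 16" .
  define t where "t = 4 * sqrt V * (ln (1 / u) + 1)"
  have tht: "th * t = ln (1 / u) + 1" using False V0 by (simp add: th_def t_def)
  have "measure_pmf.prob (rademacher k) {e \<in> space (measure_pmf (rademacher k)). exp (chaos c k e) \<ge> exp (th * t)}
     \<le> measure_pmf.expectation (rademacher k) (\<lambda>e. exp (chaos c k e)) / exp (th * t)"
    by (rule integral_Markov_inequality_measure[where A = "{}"])
       (auto intro!: integrable_measure_pmf_finite finite_set_pmf_rademacher)
  also have "\<dots> \<le> exp (2 * chaos_norm2 c k) / exp (th * t)"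
    by (intro divide_right_mono exp_chaos_bound c) auto
  also have "\<dots> \<le> exp (1 / 8) / exp (th * t)"
    using c by (intro divide_right_mono) auto
  also have "\<dots> = exp (1 / 8) / exp 1 * u"
    unfolding tht using u by (simp add: exp_add)
  also have "\<dots> \<le> 1 * u" using u by (intro mult_right_mono) auto
  finally have "measure_pmf.prob (rademacher k) {e. exp (chaos c k e) \<ge> exp (th * t)} \<le> u" by simp
  moreover have "measure_pmf.prob (rademacher k) {e. chaos b k e > t}
     \<le> measure_pmf.prob (rademacher k) {e. exp (chaos c k e) \<ge> exp (th * t)}"
    using th by (intro measure_pmf.finite_measure_mono) (auto simp: cb)
  ultimately show ?thesis unfolding t_def by linarith
qed

section \<open>Bootstrap quantiles and aggregation\<close>

lemma sum_off_diagonal_nat: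
  fixes f :: "nat \<Rightarrow> nat \<Rightarrow> real"
  shows "(\<Sum>(i, j) \<in> {(i, j). i < n \<and> j < n \<and> i \<noteq> j}. f i j) = (\<Sum>i<n. \<Sum>j<i. f i j + f j i)"
proof (induction n)
  case (Suc n)
  let ?D = "\<lambda>n. {(i, j). i < n \<and> j < n \<and> i \<noteq> j} :: (nat \<times> nat) set"
  have fin: "finite (?D n)" by (rule finite_subset[of _ "{..<n} \<times> {..<n}"]) auto
  have D: "?D (Suc n) = ?D n \<union> (Pair n ` {..<n} \<union> (\<lambda>i. (i, n)) ` {..<n})"
    by (auto simp: less_Suc_eq image_iff)
  have "(\<Sum>(i, j) \<in> ?D (Suc n). f i j) =
      (\<Sum>(i, j) \<in> ?D n. f i j) + ((\<Sum>(i, j) \<in> Pair n ` {..<n}. f i j) + (\<Sum>(i, j) \<in> (\<lambda>i. (i, n)) ` {..<n}. f i j))"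
    unfolding D using fin by (subst sum.union_disjoint; (subst sum.union_disjoint)?) auto
  also have "(\<Sum>(i, j) \<in> Pair n ` {..<n}. f i j) = (\<Sum>j<n. f n j)"
    by (subst sum.reindex) (auto simp: inj_on_def)
  also have "(\<Sum>(i, j) \<in> (\<lambda>i. (i, n)) ` {..<n}. f i j) = (\<Sum>j<n. f j n)"
    by (subst sum.reindex) (auto simp: inj_on_def)
  finally show ?case by (simp add: Suc.IH sum.distrib)
qed simp

definition symmetric_kernel :: "kernel \<Rightarrow> bool" where
  "symmetric_kernel K \<longleftrightarrow> (\<forall>x y. K x y = K y x)"

text \<open>For a symmetric kernel, half the conditional variance of the bootstrapped statistic.\<close>

definition energy :: "kernel \<Rightarrow> real set \<Rightarrow> real" where
  "energy K N = (\<Sum>(x, x') \<in> {(x, x'). x \<in> N \<and> x' \<in> N \<and> x \<noteq> x'}. (K x x')\<^sup>2)"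

lemma energy_nonneg: "energy K N \<ge> 0"
  unfolding energy_def by (intro sum_nonneg) auto

lemma bij_betw_point: "finite N \<Longrightarrow> bij_betw (point N) {..<card N} N"
  unfolding point_def by (rule bij_betw_nth) auto

lemma T_boot_eq_chaos:
  assumes "symmetric_kernel K"
  shows "T_boot K N e = chaos (\<lambda>i j. 2 * K (point N i) (point N j)) (card N) e"
proof -
  have "K (point N i) (point N j) * e i * e j + K (point N j) (point N i) * e j * e i
     = 2 * K (point N i) (point N j) * e i * e j" for i j
    using assms by (simp add: symmetric_kernel_def)
  then show ?thesis unfolding T_boot_def chaos_def sum_off_diagonal_nat by (intro sum.cong refl)
qed

lemma chaos_norm2_eq_energy:
  assumes "symmetric_kernel K" "finite N"
  shows "chaos_norm2 (\<lambda>i j. 2 * K (point N i) (point N j)) (card N) = 2 * energy K N"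
proof -
  have inj: "inj_on (point N) {..<card N}" and im: "point N ` {..<card N} = N"
    using bij_betw_point[OF assms(2)] by (auto simp: bij_betw_def)
  have "bij_betw (\<lambda>(i, j). (point N i, point N j))
     {(i, j). i < card N \<and> j < card N \<and> i \<noteq> j} {(x, x'). x \<in> N \<and> x' \<in> N \<and> x \<noteq> x'}"
  proof (rule bij_betw_imageI)
    show "inj_on (\<lambda>(i, j). (point N i, point N j)) {(i, j). i < card N \<and> j < card N \<and> i \<noteq> j}"
      by (rule inj_onI) (use inj in \<open>auto dest: inj_onD\<close>)
    have "(x, x') \<in> (\<lambda>(i, j). (point N i, point N j)) ` {(i, j). i < card N \<and> j < card N \<and> i \<noteq> j}"
      if "x \<in> N" "x' \<in> N" "x \<noteq> x'" for x x'
    proof -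
      have "x \<in> point N ` {..<card N}" "x' \<in> point N ` {..<card N}" using that im by simp_all
      then obtain i j where "i < card N" "j < card N" "x = point N i" "x' = point N j" by blast
      then show ?thesis using that by (intro image_eqI[of _ _ "(i, j)"]) auto
    qed
    moreover have "point N i \<in> N \<and> point N j \<in> N \<and> point N i \<noteq> point N j"
      if ij: "i < card N" "j < card N" "i \<noteq> j" for i j
    proof -
      have "point N i \<in> N" "point N j \<in> N"
        using bij_betwE[OF bij_betw_point[OF assms(2)]] ij by simp_all
      moreover have "point N i \<noteq> point N j"
        using inj_on_eq_iff[OF inj, of i j] ij by simp
      ultimately show ?thesis by simp
    qed
    ultimately show "(\<lambda>(i, j). (point N i, point N j)) ` {(i, j). i < card N \<and> j < card N \<and> i \<noteq> j}
       = {(x, x'). x \<in> N \<and> x' \<in> N \<and> x \<noteq> x'}" by (intro equalityI subsetI) auto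
  qed
  from sum.reindex_bij_betw[OF this, of "\<lambda>(x, x'). (K x x')\<^sup>2"]
  have "energy K N = (\<Sum>(i, j) \<in> {(i, j). i < card N \<and> j < card N \<and> i \<noteq> j}. (K (point N i) (point N j))\<^sup>2)"
    unfolding energy_def by (simp add: case_prod_unfold)
  also have "\<dots> = (\<Sum>i<card N. \<Sum>j<i. 2 * (K (point N i) (point N j))\<^sup>2)"
    unfolding sum_off_diagonal_nat using assms(1) by (simp add: symmetric_kernel_def)
  finally show ?thesis
    by (simp add: chaos_norm2_def sum_distrib_left power_mult_distrib)
qed

lemma cond_prob_mono: "E \<subseteq> F \<Longrightarrow> cond_prob N E \<le> cond_prob N F"
  unfolding cond_prob_def by (intro measure_pmf.finite_measure_mono) auto

lemma cond_prob_compl: "cond_prob N {e. \<not> P e} = 1 - cond_prob N {e. P e}"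
proof -
  have "{e. \<not> P e} = UNIV - {e. P e}" by auto
  then show ?thesis unfolding cond_prob_def using measure_pmf.prob_compl[of "{e. P e}" "rademacher (card N)"] by simp
qed

lemma cond_prob_cong:
  assumes "\<And>e. e \<in> set_pmf (rademacher (card N)) \<Longrightarrow> e \<in> E \<longleftrightarrow> e \<in> F"
  shows "cond_prob N E = cond_prob N F"
  unfolding cond_prob_def using assms
  by (intro measure_pmf.finite_measure_eq_AE) (auto simp: AE_measure_pmf_iff)

definition admissible :: "kernel \<Rightarrow> real set \<Rightarrow> real \<Rightarrow> real set" where
  "admissible K N u = {t. cond_prob N {e. T_boot K N e \<le> t} \<ge> 1 - u \<and> cond_prob N {e. T_boot K N e \<le> t} > 0}"

lemma quantile_eq: "quantile K N u = Inf (admissible K N u)"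
  by (simp add: quantile_def admissible_def)

lemma bdd_below_admissible: "bdd_below (admissible K N u)"
proof -
  let ?V = "T_boot K N ` set_pmf (rademacher (card N))"
  have fin: "finite ?V" by (simp add: finite_set_pmf_rademacher)
  have "Min ?V \<le> t" if "t \<in> admissible K N u" for t
  proof (rule ccontr)
    assume t: "\<not> Min ?V \<le> t"
    have "T_boot K N e > t" if "e \<in> set_pmf (rademacher (card N))" for e
      using Min_le[OF fin, of "T_boot K N e"] that t by force
    then have "cond_prob N {e. T_boot K N e \<le> t} = cond_prob N {}"
      by (intro cond_prob_cong) force
    then show False using that by (simp add: admissible_def cond_prob_def)
  qed
  then show ?thesis by (auto simp: bdd_below_def)
qed

lemma admissible_nonempty:
  assumes "u \<ge> 0" shows "admissible K N u \<noteq> {}"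
proof -
  let ?V = "T_boot K N ` set_pmf (rademacher (card N))"
  have fin: "finite ?V" by (simp add: finite_set_pmf_rademacher)
  have "cond_prob N {e. T_boot K N e \<le> Max ?V} = cond_prob N UNIV"
    using Max_ge[OF fin] by (intro cond_prob_cong) auto
  then have "Max ?V \<in> admissible K N u"
    using assms by (simp add: admissible_def cond_prob_def)
  then show ?thesis by auto
qed

lemma quantile_le:
  assumes "cond_prob N {e. T_boot K N e > t} \<le> u" "u < 1"
  shows "quantile K N u \<le> t"
  unfolding quantile_eq
proof (rule cInf_lower[OF _ bdd_below_admissible])
  have "cond_prob N {e. T_boot K N e > t} = 1 - cond_prob N {e. T_boot K N e \<le> t}"
    using cond_prob_compl[of N "\<lambda>e. T_boot K N e \<le> t"] by (simp add: not_le)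
  then show "t \<in> admissible K N u" using assms by (simp add: admissible_def)
qed

lemma quantile_antimono:
  assumes "0 \<le> u" "u \<le> u'"
  shows "quantile K N u' \<le> quantile K N u"
  unfolding quantile_eq
  using assms by (intro cInf_superset_mono admissible_nonempty bdd_below_admissible) (auto simp: admissible_def)

text \<open>The statistic takes finitely many values under the sign distribution, so its distribution function
is constant just to the right of the quantile; the infimum is therefore attained.\<close>

lemma quantile_tail:
  assumes "0 \<le> u"
  shows "cond_prob N {e. T_boot K N e > quantile K N u} \<le> u"
proof -
  let ?V = "T_boot K N ` set_pmf (rademacher (card N))"
  define q where "q = quantile K N u"
  have fin: "finite {v \<in> ?V. v > q}" by (simp add: finite_set_pmf_rademacher)
  obtain r where r: "r > q" "\<And>v. v \<in> ?V \<Longrightarrow> v > q \<Longrightarrow> v \<ge> r"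
  proof (cases "{v \<in> ?V. v > q} = {}")
    case True
    then show ?thesis using that[of "q + 1"] by auto
  next
    case False
    then show ?thesis using that[of "Min {v \<in> ?V. v > q}"] fin Min_in[OF fin] by auto
  qed
  have "Inf (admissible K N u) < r" using r(1) by (simp add: q_def quantile_eq)
  then obtain t where t: "t \<in> admissible K N u" "t < r"
    using admissible_nonempty[OF assms] bdd_below_admissible cInf_less_iff by blast
  have "cond_prob N {e. T_boot K N e > q} \<le> cond_prob N {e. T_boot K N e > t}"
  proof -
    have "cond_prob N {e. T_boot K N e > q} = cond_prob N {e. T_boot K N e \<ge> r}"
      using r by (intro cond_prob_cong) force
    also have "\<dots> \<le> cond_prob N {e. T_boot K N e > t}" using t by (intro cond_prob_mono) auto
    finally show ?thesis .
  qed
  also have "\<dots> = 1 - cond_prob N {e. T_boot K N e \<le> t}"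
    using cond_prob_compl[of N "\<lambda>e. T_boot K N e \<le> t"] by (simp add: not_le)
  also have "\<dots> \<le> u" using t by (simp add: admissible_def)
  finally show ?thesis by (simp add: q_def)
qed

text \<open>Each unordered pair of points occurs twice in the statistic. The triangular matrix of the chaos is thus
\<open>2 K\<close>, its squared norm is twice the energy, and \<open>4 * sqrt 2 \<le> 6\<close>.\<close>

lemma quantile_le_energy:
  assumes "symmetric_kernel K" "finite N" "0 < u" "u < 1"
  shows "quantile K N u \<le> 6 * sqrt (energy K N) * (ln (1 / u) + 1)"
proof -
  have "quantile K N u \<le> 4 * sqrt (2 * energy K N) * (ln (1 / u) + 1)"
  proof (rule quantile_le[OF _ assms(4)])
    show "cond_prob N {e. T_boot K N e > 4 * sqrt (2 * energy K N) * (ln (1 / u) + 1)} \<le> u"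
      unfolding cond_prob_def T_boot_eq_chaos[OF assms(1)]
      by (rule chaos_tail) (use assms chaos_norm2_eq_energy[OF assms(1,2)] energy_nonneg in auto)
  qed
  also have "\<dots> \<le> 6 * sqrt (energy K N) * (ln (1 / u) + 1)"
  proof (rule mult_right_mono)
    have "sqrt 2 \<le> 3 / 2" by (rule real_le_lsqrt) (auto simp: power2_eq_square)
    then have "4 * (sqrt 2 * sqrt (energy K N)) \<le> 4 * (3 / 2 * sqrt (energy K N))"
      by (intro mult_left_mono mult_right_mono) (auto simp: energy_nonneg)
    then show "4 * sqrt (2 * energy K N) \<le> 6 * sqrt (energy K N)" by (simp add: real_sqrt_mult)
    show "0 \<le> ln (1 / u) + 1" using assms by (simp add: add_nonneg_nonneg)
  qed
  finally show ?thesis .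
qed

text \<open>A union bound. As the signs have finite support, the event that some kernel exceeds its quantile is
already the union over finitely many kernels, which reduces an infinite family to a finite one.\<close>

lemma bootstrap_family_level:
  assumes W: "\<And>I'. finite I' \<Longrightarrow> I' \<subseteq> I \<Longrightarrow> (\<Sum>m\<in>I'. exp (- w m)) \<le> 1"
    and u: "0 \<le> u"
  shows "cond_prob N {e. (SUP m\<in>I. ereal (T_boot (K m) N e - quantile (K m) N (u * exp (- w m)))) > 0} \<le> u"
proof -
  define q where "q m = quantile (K m) N (u * exp (- w m))" for m
  let ?S = "set_pmf (rademacher (card N))"
  define E where "E = {e \<in> ?S. \<exists>m\<in>I. T_boot (K m) N e > q m}"
  define g where "g e = (SOME m. m \<in> I \<and> T_boot (K m) N e > q m)" for e
  have g: "g e \<in> I \<and> T_boot (K (g e)) N e > q (g e)" if "e \<in> E" for e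
  proof -
    have "\<exists>m. m \<in> I \<and> T_boot (K m) N e > q m" using that unfolding E_def by blast
    then show ?thesis unfolding g_def by (rule someI_ex)
  qed
  define I' where "I' = g ` E"
  have finE: "finite E" unfolding E_def by (simp add: finite_set_pmf_rademacher)
  have I': "finite I'" "I' \<subseteq> I" using g finE by (auto simp: I'_def)
  have "cond_prob N {e. (SUP m\<in>I. ereal (T_boot (K m) N e - q m)) > 0} = cond_prob N E"
    by (intro cond_prob_cong) (auto simp: E_def less_SUP_iff)
  also have "\<dots> \<le> cond_prob N (\<Union>m\<in>I'. {e. T_boot (K m) N e > q m})"
    using g by (intro cond_prob_mono) (auto simp: I'_def)
  also have "\<dots> \<le> (\<Sum>m\<in>I'. cond_prob N {e. T_boot (K m) N e > q m})"
    unfolding cond_prob_def using I' by (intro measure_pmf.finite_measure_subadditive_finite) auto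
  also have "\<dots> \<le> (\<Sum>m\<in>I'. u * exp (- w m))"
    unfolding q_def using u by (intro sum_mono quantile_tail) auto
  also have "\<dots> = u * (\<Sum>m\<in>I'. exp (- w m))" by (simp add: sum_distrib_left)
  also have "\<dots> \<le> u * 1" using W[OF I'] u by (intro mult_left_mono)
  finally show ?thesis by (simp add: q_def)
qed

text \<open>The nominal level itself is admitted in the supremum that defines the calibrated level.\<close>

lemma u_level_ge:
  assumes W: "\<And>I'. finite I' \<Longrightarrow> I' \<subseteq> I \<Longrightarrow> (\<Sum>m\<in>I'. exp (- w m)) \<le> 1"
    and a: "0 < a" "a < 1" and "I \<noteq> {}"
  shows "a \<le> u_level I K w a N"
  unfolding u_level_def
proof (rule cSup_upper)
  have "a * exp (- w m) < 1" if "m \<in> I" for m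
  proof -
    have "exp (- w m) \<le> 1" using W[of "{m}"] that by simp
    then have "a * exp (- w m) \<le> a * 1" using a by (intro mult_left_mono) auto
    then show ?thesis using a by linarith
  qed
  then show "a \<in> {u. u > 0 \<and> (\<forall>m\<in>I. u * exp (- w m) < 1) \<and>
        cond_prob N {e. (SUP m\<in>I.
           ereal (T_boot (K m) N e - quantile (K m) N (u * exp (- w m)))) > 0} \<le> a}"
    using a bootstrap_family_level[OF W, of I a N K] by auto
  obtain m where "m \<in> I" using assms by auto
  then have "u \<le> exp (w m)" if "\<forall>m\<in>I. u * exp (- w m) < 1" for u
    using that by (auto simp: exp_minus field_simps intro: less_imp_le)
  then show "bdd_above {u. u > 0 \<and> (\<forall>m\<in>I. u * exp (- w m) < 1) \<and>
        cond_prob N {e. (SUP m\<in>I.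
           ereal (T_boot (K m) N e - quantile (K m) N (u * exp (- w m)))) > 0} \<le> a}"
    by (intro bdd_aboveI[of _ "exp (w m)"]) blast
qed

text \<open>Acceptance becomes an explicit inequality between statistic and energy. A calibrated level above
the nominal one lowers the quantiles, so that the quantile bound for the nominal level applies.\<close>

lemma aggregated_test_accepts:
  assumes W: "\<And>I'. finite I' \<Longrightarrow> I' \<subseteq> I \<Longrightarrow> (\<Sum>m\<in>I'. exp (- w m)) \<le> 1"
    and a: "0 < a" "a < 1" and m: "m \<in> I"
    and K: "symmetric_kernel (K m)" and fin: "finite A" "finite B"
    and acc: "aggregated_test I K w a (A, B) = 0"
  shows "T_hat (K m) (A, B) \<le> 6 * sqrt (energy (K m) (A \<union> B)) * (w m + ln (1 / a) + 1)"
proof -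
  define N where "N = A \<union> B"
  define u where "u = u_level I K w a N"
  have au: "a \<le> u" unfolding u_def using m by (intro u_level_ge W a) auto
  have "\<not> (SUP m\<in>I. ereal (T_hat (K m) (A, B) - quantile (K m) N (u * exp (- w m)))) > 0"
    using acc by (auto simp: aggregated_test_def Let_def N_def u_def split: if_splits)
  then have "ereal (T_hat (K m) (A, B) - quantile (K m) N (u * exp (- w m))) \<le> 0"
    using m by (auto simp: less_SUP_iff not_less)
  then have "T_hat (K m) (A, B) \<le> quantile (K m) N (u * exp (- w m))" by simp
  also have "\<dots> \<le> quantile (K m) N (a * exp (- w m))"
    using au a by (intro quantile_antimono) auto
  also have "\<dots> \<le> 6 * sqrt (energy (K m) N) * (ln (1 / (a * exp (- w m))) + 1)"
  proof (rule quantile_le_energy[OF K])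
    have "exp (- w m) \<le> 1" using W[of "{m}"] m by simp
    then have "a * exp (- w m) \<le> a * 1" using a by (intro mult_left_mono) auto
    then show "a * exp (- w m) < 1" using a by linarith
  qed (use fin a in \<open>auto simp: N_def\<close>)
  also have "ln (1 / (a * exp (- w m))) = w m + ln (1 / a)"
    using a by (simp add: ln_div ln_mult)
  finally show ?thesis by (simp add: N_def)
qed

lemma sum_inverse_squares_le:
  assumes "finite I" shows "(\<Sum>j\<in>I. 1 / (real j + 1)\<^sup>2) \<le> pi\<^sup>2 / 6"
  using sum_le_suminf[of "\<lambda>n. 1 / (real n + 1)\<^sup>2" I] inverse_squares_sums assms
  by (auto simp: sums_iff add.commute)

text \<open>The constants in the weights are tuned so that the numbers \<open>exp (- w_level J)\<close> are the terms of Euler's series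
for \<open>pi\<^sup>2 / 6\<close>, normalised to have sum 1.\<close>

lemma exp_w_level: "exp (- w_level J) = 6 / pi\<^sup>2 * (1 / (real J + 1)\<^sup>2)"
proof -
  have "w_level J = ln (((real J + 1) * (pi / sqrt 6))\<^sup>2)"
    using ln_mult[of "real J + 1" "pi / sqrt 6"] unfolding w_level_def
    by (subst ln_realpow) (auto simp del: times_divide_eq_right)
  then have "exp (w_level J) = ((real J + 1) * (pi / sqrt 6))\<^sup>2" by simp
  then show ?thesis unfolding exp_minus by (simp only:) (simp add: power_mult_distrib power_divide inverse_eq_divide mult_ac)
qed

lemma w_level_sum:
  assumes "finite I" shows "(\<Sum>J\<in>I. exp (- w_level J)) \<le> 1"
proof -
  have "(\<Sum>J\<in>I. exp (- w_level J)) = 6 / pi\<^sup>2 * (\<Sum>j\<in>I. 1 / (real j + 1)\<^sup>2)"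
    by (simp add: exp_w_level sum_distrib_left)
  also have "\<dots> \<le> 6 / pi\<^sup>2 * (pi\<^sup>2 / 6)"
    using assms by (intro mult_left_mono sum_inverse_squares_le) auto
  finally show ?thesis by simp
qed

lemma exp_w_single_Node: "exp (- w_single (Node j k)) = 3 / pi\<^sup>2 * (1 / (real j + 1)\<^sup>2) / 2 ^ j"
proof -
  have "w_single (Node j k) = ln (2 ^ j * ((real j + 1) * (pi / sqrt 3))\<^sup>2)"
    using ln_mult[of "real j + 1" "pi / sqrt 3"]
    by (simp add: ln_mult ln_realpow del: times_divide_eq_right)
  then have "exp (w_single (Node j k)) = 2 ^ j * ((real j + 1) * (pi / sqrt 3))\<^sup>2" by (simp del: w_single.simps)
  then show ?thesis unfolding exp_minus by (simp only:) (simp add: power_mult_distrib power_divide inverse_eq_divide mult_ac)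
qed

text \<open>The root contributes 1/2. The \<open>2 ^ j\<close> functions of level \<open>j\<close> have together the \<open>j\<close>-th
term of Euler's series, normalised to have sum 1/2.\<close>

lemma w_single_sum:
  assumes I: "finite I" "I \<subseteq> {Root} \<union> Lam \<infinity>"
  shows "(\<Sum>l\<in>I. exp (- w_single l)) \<le> 1"
proof -
  define lev where "lev = (\<lambda>l. case l of Root \<Rightarrow> 0 | Node j k \<Rightarrow> j)"
  define m where "m = Suc (Max (insert 0 (lev ` I)))"
  have lev: "lev l < m" if "l \<in> I" for l
    unfolding m_def less_Suc_eq_le using I(1) that by (intro Max_ge) auto
  let ?T = "insert Root ((\<lambda>(j, k). Node j k) ` Sigma {..<m} (\<lambda>j. {..<2 ^ j}))"
  have "I \<subseteq> ?T"
    using I(2) lev by (force simp: Lam_def lev_def image_iff split: haar_index.splits)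
  then have "(\<Sum>l\<in>I. exp (- w_single l)) \<le> (\<Sum>l\<in>?T. exp (- w_single l))"
    by (intro sum_mono2) auto
  also have "\<dots> = exp (- w_single Root) + (\<Sum>l\<in>(\<lambda>(j, k). Node j k) ` Sigma {..<m} (\<lambda>j. {..<2 ^ j}). exp (- w_single l))"
    by (subst sum.insert) auto
  also have "(\<Sum>l\<in>(\<lambda>(j, k). Node j k) ` Sigma {..<m} (\<lambda>j. {..<2 ^ j}). exp (- w_single l))
     = (\<Sum>j<m. \<Sum>k<(2::nat) ^ j. exp (- w_single (Node j k)))"
    by (subst sum.reindex) (auto simp: inj_on_def sum.Sigma case_prod_unfold simp del: w_single.simps)
  also have "\<dots> = (\<Sum>j<m. 3 / pi\<^sup>2 * (1 / (real j + 1)\<^sup>2))"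
    unfolding exp_w_single_Node by simp
  also have "\<dots> = 3 / pi\<^sup>2 * (\<Sum>j<m. 1 / (real j + 1)\<^sup>2)" by (simp add: sum_distrib_left)
  also have "\<dots> \<le> 3 / pi\<^sup>2 * (pi\<^sup>2 / 6)"
    by (intro mult_left_mono sum_inverse_squares_le) auto
  finally show ?thesis by (simp add: exp_minus)
qed

section \<open>Moments of Poisson counts\<close>

text \<open>The falling factorial \<open>k (k - 1) \<cdots> (k - r + 1)\<close>, in the reals so that no subtraction truncates.\<close>

definition falling :: "nat \<Rightarrow> nat \<Rightarrow> real" where
  "falling r k = (\<Prod>i<r. real k - real i)"

lemma falling_Suc_Suc: "falling (Suc r) (Suc k) = real (Suc k) * falling r k"
  unfolding falling_def prod.lessThan_Suc_shift by simp

lemma falling_Suc_0 [simp]: "falling (Suc r) 0 = 0"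
  unfolding falling_def prod.lessThan_Suc_shift by simp

lemma falling_0 [simp]: "falling 0 k = 1"
  by (simp add: falling_def)

lemma falling_nonneg: "falling r k \<ge> 0"
proof (induction r arbitrary: k)
  case (Suc r)
  then show ?case by (cases k) (simp_all add: falling_Suc_Suc)
qed simp

lemma falling_expand:
  "falling 1 k = real k" "falling (Suc 0) k = real k" "falling 2 k = real k * (real k - 1)"
  "falling 3 k = real k * (real k - 1) * (real k - 2)"
  "falling 4 k = real k * (real k - 1) * (real k - 2) * (real k - 3)"
  by (simp_all add: falling_def numeral_eq_Suc)

text \<open>Falling factorials are the natural moments of a Poisson law: a factor of \<open>k + 1\<close> cancels against the
factorial of the next term and shifts the exponential series by one.\<close>

lemma falling_poisson_sums:
  "(\<lambda>k. falling r k * (c ^ k / fact k * exp (- c))) sums (c ^ r)"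
proof (induction r)
  case 0
  have "(\<lambda>k. c ^ k /\<^sub>R fact k * exp (- c)) sums (exp c * exp (- c))"
    by (intro sums_mult2 exp_converges)
  then show ?case by (simp add: exp_minus divide_inverse mult_ac)
next
  case (Suc r)
  have "(\<lambda>k. c * (falling r k * (c ^ k / fact k * exp (- c)))) sums (c * c ^ r)"
    by (intro sums_mult Suc.IH)
  also have "(\<lambda>k. c * (falling r k * (c ^ k / fact k * exp (- c))))
     = (\<lambda>k. falling (Suc r) (Suc k) * (c ^ Suc k / fact (Suc k) * exp (- c)))"
    by (auto simp: falling_Suc_Suc fun_eq_iff field_simps simp del: of_nat_Suc)
  finally show ?case
    using sums_Suc_iff[of "\<lambda>k. falling (Suc r) k * (c ^ k / fact k * exp (- c))" "c * c ^ r"] by simp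
qed

lemma (in prob_space) poisson_factorial_moment:
  assumes X[measurable]: "X \<in> measurable M (count_space UNIV)" and c: "0 \<le> c"
    and P: "\<And>k. prob {\<omega> \<in> space M. X \<omega> = k} = c ^ k / fact k * exp (- c)"
  shows "has_bochner_integral M (\<lambda>\<omega>. falling r (X \<omega>)) (c ^ r)"
proof -
  let ?p = "\<lambda>k::nat. c ^ k / fact k * exp (- c)"
  have D: "distr M (count_space UNIV) X = density (count_space UNIV) (\<lambda>k. ennreal (?p k))"
  proof (rule measure_eqI_countable[of _ UNIV])
    fix k :: nat
    have "emeasure (distr M (count_space UNIV) X) {k} = emeasure M {\<omega> \<in> space M. X \<omega> = k}"
      by (subst emeasure_distr) (auto intro!: arg_cong[where f = "emeasure M"])
    also have "\<dots> = ennreal (?p k)" by (simp add: emeasure_eq_measure P)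
    also have "\<dots> = emeasure (density (count_space UNIV) (\<lambda>k. ennreal (?p k))) {k}"
      by (subst emeasure_density) (auto simp: nn_integral_count_space_indicator[symmetric])
    finally show "emeasure (distr M (count_space UNIV) X) {k}
       = emeasure (density (count_space UNIV) (\<lambda>k. ennreal (?p k))) {k}" .
  qed auto
  have "(\<integral>\<^sup>+\<omega>. ennreal (falling r (X \<omega>)) \<partial>M) = (\<integral>\<^sup>+k. ennreal (falling r k) \<partial>distr M (count_space UNIV) X)"
    by (subst nn_integral_distr) auto
  also have "\<dots> = (\<integral>\<^sup>+k. ennreal (?p k) * ennreal (falling r k) \<partial>count_space UNIV)"
    unfolding D by (subst nn_integral_density) auto
  also have "\<dots> = (\<Sum>k. ennreal (falling r k * ?p k))"
    unfolding nn_integral_count_space_nat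
    using c by (intro suminf_cong) (simp add: ennreal_mult'[symmetric] falling_nonneg mult.commute)
  also have "\<dots> = ennreal (c ^ r)"
    using c by (intro suminf_ennreal_eq falling_poisson_sums mult_nonneg_nonneg divide_nonneg_nonneg falling_nonneg) auto
  finally show ?thesis
    using c by (intro has_bochner_integral_nn_integral) (auto simp: falling_nonneg)
qed

lemma space_conf: "space conf = {A. finite A \<and> A \<subseteq> {0..1}}"
  unfolding conf_def by (rule space_measure_of) auto

lemma measurable_count [measurable]:
  assumes "B \<in> sets borel"
  shows "(\<lambda>A. card (A \<inter> B)) \<in> measurable conf (count_space UNIV)"
proof (subst measurable_count_space_eq2_countable, safe)
  fix k :: nat
  have "(\<lambda>A. card (A \<inter> B)) -` {k} \<inter> space conf = {A. finite A \<and> A \<subseteq> {0..1} \<and> card (A \<inter> B) = k}"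
    by (auto simp: space_conf)
  also have "\<dots> \<in> sets conf"
    unfolding conf_def using assms by (subst sets_measure_of) auto
  finally show "(\<lambda>A. card (A \<inter> B)) -` {k} \<inter> space conf \<in> sets conf" .
qed auto

lemma scale_measure_eq_density: "scale_measure r M = density M (\<lambda>_. r)"
  by (rule measure_eqI) (auto simp: emeasure_density_const)

lemma set_integral_mu:
  assumes "n \<ge> 0" "B \<in> sets borel" "integrable nu f" "B \<subseteq> {0..1}"
  shows "(LINT x:B|mu n. f x) = n * (LINT x:B|nu. f x)"
proof -
  have [measurable]: "B \<in> sets nu" using assms(2,4) unfolding nu_def sets_restrict_space by (auto intro!: image_eqI[of _ _ B])
  have [measurable]: "f \<in> borel_measurable nu" using assms by auto
  show ?thesis unfolding mu_def scale_measure_eq_density set_lebesgue_integral_def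
    using assms(1) by (subst integral_density) auto
qed

lemma (in prob_space) square_sum_uncorrelated:
  fixes Y :: "nat \<Rightarrow> 'a \<Rightarrow> real"
  assumes int: "\<And>i j. i < m \<Longrightarrow> j < m \<Longrightarrow> integrable M (\<lambda>\<omega>. Y i \<omega> * Y j \<omega>)"
    and unc: "\<And>i j. i < m \<Longrightarrow> j < m \<Longrightarrow> i \<noteq> j \<Longrightarrow> expectation (\<lambda>\<omega>. Y i \<omega> * Y j \<omega>) = 0"
  shows "has_bochner_integral M (\<lambda>\<omega>. (\<Sum>i<m. Y i \<omega>)\<^sup>2) (\<Sum>i<m. expectation (\<lambda>\<omega>. (Y i \<omega>)\<^sup>2))"
proof -
  have E: "(\<lambda>\<omega>. (\<Sum>i<m. Y i \<omega>)\<^sup>2) = (\<lambda>\<omega>. \<Sum>i<m. \<Sum>j<m. Y i \<omega> * Y j \<omega>)"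
    by (simp add: power2_eq_square sum_product)
  have "expectation (\<lambda>\<omega>. \<Sum>i<m. \<Sum>j<m. Y i \<omega> * Y j \<omega>)
     = (\<Sum>i<m. \<Sum>j<m. expectation (\<lambda>\<omega>. Y i \<omega> * Y j \<omega>))"
    using int by (subst Bochner_Integration.integral_sum)
      (auto intro!: Bochner_Integration.integrable_sum sum.cong Bochner_Integration.integral_sum)
  also have "\<dots> = (\<Sum>i<m. \<Sum>j<m. if i = j then expectation (\<lambda>\<omega>. (Y i \<omega>)\<^sup>2) else 0)"
    using unc by (intro sum.cong) (auto simp: power2_eq_square)
  also have "\<dots> = (\<Sum>i<m. expectation (\<lambda>\<omega>. (Y i \<omega>)\<^sup>2))" by simp
  finally show ?thesis unfolding E
    using int by (auto simp: has_bochner_integral_iff intro!: Bochner_Integration.integrable_sum)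
qed

locale poisson_pair =
  fixes n :: real and f g :: "real \<Rightarrow> real" and P :: "(real set \<times> real set) measure"
  assumes n: "n > 0" and f: "intensity f" and g: "intensity g" and law: "joint_poisson_law n f g P"
begin

sublocale prob_space P using law by (simp add: joint_poisson_law_def)

lemma fst_rv [measurable]: "fst \<in> measurable P conf"
  and snd_rv [measurable]: "snd \<in> measurable P conf"
  using law by (auto simp: joint_poisson_law_def poisson_process_def)

lemma space_P: "space P = space conf \<times> space conf"
  using law sets_eq_imp_space_eq[of P "conf \<Otimes>\<^sub>M conf"] by (simp add: joint_poisson_law_def space_pair_measure)

definition meanA :: "real set \<Rightarrow> real" where "meanA B = (LINT x:B|mu n. f x)"
definition meanB :: "real set \<Rightarrow> real" where "meanB B = (LINT x:B|mu n. g x)"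

definition countA :: "real set \<Rightarrow> real set \<times> real set \<Rightarrow> nat" where "countA B \<omega> = card (fst \<omega> \<inter> B)"
definition countB :: "real set \<Rightarrow> real set \<times> real set \<Rightarrow> nat" where "countB B \<omega> = card (snd \<omega> \<inter> B)"

lemma mean_nonneg: "0 \<le> meanA B" "0 \<le> meanB B"
proof -
  have sp: "space (mu n) = {0..1}" by (simp add: mu_def space_scale_measure nu_def)
  show "0 \<le> meanA B" unfolding meanA_def set_lebesgue_integral_def
    using f by (intro integral_nonneg_AE AE_I2) (auto simp: sp intensity_def indicator_def)
  show "0 \<le> meanB B" unfolding meanB_def set_lebesgue_integral_def
    using g by (intro integral_nonneg_AE AE_I2) (auto simp: sp intensity_def indicator_def)
qed

lemma countA_moment:
  assumes "B \<in> sets borel" "B \<subseteq> {0..1}"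
  shows "has_bochner_integral P (\<lambda>\<omega>. falling r (countA B \<omega>)) (meanA B ^ r)"
  using assms law mean_nonneg
  by (intro poisson_factorial_moment) (auto simp: joint_poisson_law_def poisson_process_def countA_def meanA_def)

lemma countB_moment:
  assumes "B \<in> sets borel" "B \<subseteq> {0..1}"
  shows "has_bochner_integral P (\<lambda>\<omega>. falling r (countB B \<omega>)) (meanB B ^ r)"
  using assms law mean_nonneg
  by (intro poisson_factorial_moment) (auto simp: joint_poisson_law_def poisson_process_def countB_def meanB_def)

definition factorial_product :: "nat \<Rightarrow> nat \<Rightarrow> real set \<Rightarrow> real set \<times> real set \<Rightarrow> real" where
  "factorial_product r s B \<omega> = falling r (countA B \<omega>) * falling s (countB B \<omega>)"

text \<open>Independence of the two processes.\<close>

lemma product_fst_snd: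
  assumes G[measurable]: "G \<in> borel_measurable conf" and H[measurable]: "H \<in> borel_measurable conf"
    and "has_bochner_integral P (\<lambda>\<omega>. G (fst \<omega>)) x" "has_bochner_integral P (\<lambda>\<omega>. H (snd \<omega>)) (y::real)"
  shows "has_bochner_integral P (\<lambda>\<omega>. G (fst \<omega>) * H (snd \<omega>)) (x * y)"
proof -
  have "indep_var borel (G \<circ> fst) borel (H \<circ> snd)"
    using law by (intro indep_var_compose[OF _ G H]) (simp add: joint_poisson_law_def)
  from indep_var_integrable[OF this] indep_var_lebesgue_integral[OF this] show ?thesis
    using assms by (auto simp: has_bochner_integral_iff o_def)
qed

lemma factorial_product_moment:
  assumes B: "B \<in> sets borel" "B \<subseteq> {0..1}"
  shows "has_bochner_integral P (factorial_product r s B) (meanA B ^ r * meanB B ^ s)"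
proof -
  have [measurable]: "B \<in> sets borel" by fact
  have "has_bochner_integral P (\<lambda>\<omega>. (\<lambda>A. falling r (card (A \<inter> B))) (fst \<omega>) * (\<lambda>A. falling s (card (A \<inter> B))) (snd \<omega>)) (meanA B ^ r * meanB B ^ s)"
    using countA_moment[OF B] countB_moment[OF B] by (intro product_fst_snd) (auto simp: countA_def countB_def)
  then show ?thesis by (simp add: factorial_product_def[abs_def] countA_def countB_def)
qed

text \<open>Independence of one process on two disjoint sets. The defining property concerns sequences of disjoint
sets, so the two sets are completed by empty ones.\<close>

lemma process_product_moment:
  assumes pp: "poisson_process P n h N" and B: "B \<in> sets borel" "B \<subseteq> {0..1}"
    and C: "C \<in> sets borel" "C \<subseteq> {0..1}" and disj: "B \<inter> C = {}"
    and m: "has_bochner_integral P (\<lambda>\<omega>. falling r (card (N \<omega> \<inter> B))) x"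
      "has_bochner_integral P (\<lambda>\<omega>. falling s (card (N \<omega> \<inter> C))) y"
  shows "has_bochner_integral P (\<lambda>\<omega>. falling r (card (N \<omega> \<inter> B)) * falling s (card (N \<omega> \<inter> C))) (x * y)"
proof -
  define F where "F = (\<lambda>i::nat. if i = 0 then B else if i = 1 then C else {})"
  have F: "(\<forall>i. F i \<in> sets borel \<and> F i \<subseteq> {0..1}) \<and> disjoint_family F"
    using B C disj by (auto simp: F_def disjoint_family_on_def)
  have "indep_vars (\<lambda>_. count_space UNIV) (\<lambda>i \<omega>. card (N \<omega> \<inter> F i)) UNIV"
    using pp F unfolding poisson_process_def by blast
  then have "indep_vars (\<lambda>_. count_space UNIV) (\<lambda>i \<omega>. card (N \<omega> \<inter> F i)) {0, 1}"
    by (rule indep_vars_subset) auto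
  then have "indep_vars (\<lambda>_. borel) (\<lambda>i \<omega>. (\<lambda>k. falling (if i = 0 then r else s) k) (card (N \<omega> \<inter> F i))) {0, 1}"
    by (rule indep_vars_compose2) auto
  from indep_vars_lebesgue_integral[OF _ this] indep_vars_integrable[OF _ this] m
  show ?thesis by (auto simp: F_def has_bochner_integral_iff)
qed

lemma factorial_product_product_moment:
  assumes B: "B \<in> sets borel" "B \<subseteq> {0..1}" and C: "C \<in> sets borel" "C \<subseteq> {0..1}" and disj: "B \<inter> C = {}"
  shows "has_bochner_integral P (\<lambda>\<omega>. factorial_product r s B \<omega> * factorial_product r' s' C \<omega>) ((meanA B ^ r * meanB B ^ s) * (meanA C ^ r' * meanB C ^ s'))"
proof -
  have [measurable]: "B \<in> sets borel" "C \<in> sets borel" by fact+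
  have pf: "poisson_process P n f fst" and pg: "poisson_process P n g snd"
    using law by (auto simp: joint_poisson_law_def)
  have "has_bochner_integral P (\<lambda>\<omega>. (\<lambda>A. falling r (card (A \<inter> B)) * falling r' (card (A \<inter> C))) (fst \<omega>)
      * (\<lambda>A. falling s (card (A \<inter> B)) * falling s' (card (A \<inter> C))) (snd \<omega>)) ((meanA B ^ r * meanA C ^ r') * (meanB B ^ s * meanB C ^ s'))"
    using countA_moment[OF B] countB_moment[OF B] countA_moment[OF C] countB_moment[OF C]
    by (intro product_fst_snd process_product_moment[OF pf B C disj] process_product_moment[OF pg B C disj])
      (auto simp: countA_def countB_def)
  then show ?thesis by (simp add: factorial_product_def[abs_def] countA_def countB_def mult_ac)
qed

text \<open>The contribution of one dyadic interval of level \<open>J\<close> to the statistic of \<open>K_level J\<close>, up to the factor \<open>2 ^ J\<close>: pairs of distinct points in \<open>B\<close>,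
counted with the product of their marks. Removing the diagonal makes it an unbiased estimator of the
squared difference of the two means.\<close>

definition block_stat :: "real set \<Rightarrow> real set \<times> real set \<Rightarrow> real" where
  "block_stat B \<omega> = (real (countA B \<omega>) - real (countB B \<omega>))\<^sup>2 - (real (countA B \<omega>) + real (countB B \<omega>))"

text \<open>In terms of falling factorials the diagonal disappears; hence the mean is a perfect square.\<close>

lemma block_stat_eq: "block_stat B \<omega> = factorial_product 2 0 B \<omega> + factorial_product 0 2 B \<omega> - 2 * factorial_product 1 1 B \<omega>"
  by (simp add: block_stat_def factorial_product_def falling_expand power2_eq_square algebra_simps)

lemma block_stat_square_eq:
  "(block_stat B \<omega>)\<^sup>2 = factorial_product 4 0 B \<omega> + 4 * factorial_product 3 0 B \<omega> + 2 * factorial_product 2 0 B \<omega> + factorial_product 0 4 B \<omega> + 4 * factorial_product 0 3 B \<omega> + 2 * factorial_product 0 2 B \<omega>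
    + 6 * factorial_product 2 2 B \<omega> - 4 * factorial_product 2 1 B \<omega> - 4 * factorial_product 1 2 B \<omega> + 4 * factorial_product 1 1 B \<omega> - 4 * factorial_product 3 1 B \<omega> - 4 * factorial_product 1 3 B \<omega>"
  unfolding block_stat_def factorial_product_def falling_expand falling_0 by algebra

lemma block_stat_mean:
  assumes B: "B \<in> sets borel" "B \<subseteq> {0..1}"
  shows "has_bochner_integral P (block_stat B) ((meanA B - meanB B)\<^sup>2)"
proof -
  have "has_bochner_integral P (\<lambda>\<omega>. factorial_product 2 0 B \<omega> + factorial_product 0 2 B \<omega> - 2 * factorial_product 1 1 B \<omega>)
     (meanA B ^ 2 * meanB B ^ 0 + meanA B ^ 0 * meanB B ^ 2 - 2 * (meanA B ^ 1 * meanB B ^ 1))"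
    by (intro has_bochner_integral_add has_bochner_integral_diff has_bochner_integral_mult_right factorial_product_moment B)
  then show ?thesis by (simp add: block_stat_eq[abs_def] power2_diff mult.assoc)
qed

lemma block_stat_square_mean:
  assumes B: "B \<in> sets borel" "B \<subseteq> {0..1}"
  shows "has_bochner_integral P (\<lambda>\<omega>. (block_stat B \<omega>)\<^sup>2)
    ((meanA B - meanB B) ^ 4 + 2 * (meanA B + meanB B)\<^sup>2 + 4 * (meanA B + meanB B) * (meanA B - meanB B)\<^sup>2)"
proof -
  have "has_bochner_integral P (\<lambda>\<omega>. (block_stat B \<omega>)\<^sup>2) (meanA B ^ 4 * meanB B ^ 0 + 4 * (meanA B ^ 3 * meanB B ^ 0) + 2 * (meanA B ^ 2 * meanB B ^ 0)
    + meanA B ^ 0 * meanB B ^ 4 + 4 * (meanA B ^ 0 * meanB B ^ 3) + 2 * (meanA B ^ 0 * meanB B ^ 2)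
    + 6 * (meanA B ^ 2 * meanB B ^ 2) - 4 * (meanA B ^ 2 * meanB B ^ 1) - 4 * (meanA B ^ 1 * meanB B ^ 2) + 4 * (meanA B ^ 1 * meanB B ^ 1)
    - 4 * (meanA B ^ 3 * meanB B ^ 1) - 4 * (meanA B ^ 1 * meanB B ^ 3))"
    unfolding block_stat_square_eq
    by (intro has_bochner_integral_add has_bochner_integral_diff has_bochner_integral_mult_right factorial_product_moment B)
  moreover have "(meanA B ^ 4 * meanB B ^ 0 + 4 * (meanA B ^ 3 * meanB B ^ 0) + 2 * (meanA B ^ 2 * meanB B ^ 0)
    + meanA B ^ 0 * meanB B ^ 4 + 4 * (meanA B ^ 0 * meanB B ^ 3) + 2 * (meanA B ^ 0 * meanB B ^ 2)
    + 6 * (meanA B ^ 2 * meanB B ^ 2) - 4 * (meanA B ^ 2 * meanB B ^ 1) - 4 * (meanA B ^ 1 * meanB B ^ 2) + 4 * (meanA B ^ 1 * meanB B ^ 1)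
    - 4 * (meanA B ^ 3 * meanB B ^ 1) - 4 * (meanA B ^ 1 * meanB B ^ 3))
     = ((meanA B - meanB B) ^ 4 + 2 * (meanA B + meanB B)\<^sup>2 + 4 * (meanA B + meanB B) * (meanA B - meanB B)\<^sup>2)"
    unfolding power_0 power_one_right by algebra
  ultimately show ?thesis by simp
qed

lemma block_stat_product_mean:
  assumes B: "B \<in> sets borel" "B \<subseteq> {0..1}" and C: "C \<in> sets borel" "C \<subseteq> {0..1}" and disj: "B \<inter> C = {}"
  shows "has_bochner_integral P (\<lambda>\<omega>. block_stat B \<omega> * block_stat C \<omega>) ((meanA B - meanB B)\<^sup>2 * (meanA C - meanB C)\<^sup>2)"
proof -
  let ?m = "\<lambda>r s r' s'. (meanA B ^ r * meanB B ^ s) * (meanA C ^ r' * meanB C ^ s')"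
  have E: "block_stat B \<omega> * block_stat C \<omega> =
     factorial_product 2 0 B \<omega> * factorial_product 2 0 C \<omega> + factorial_product 2 0 B \<omega> * factorial_product 0 2 C \<omega> - 2 * (factorial_product 2 0 B \<omega> * factorial_product 1 1 C \<omega>)
     + factorial_product 0 2 B \<omega> * factorial_product 2 0 C \<omega> + factorial_product 0 2 B \<omega> * factorial_product 0 2 C \<omega> - 2 * (factorial_product 0 2 B \<omega> * factorial_product 1 1 C \<omega>)
     - 2 * (factorial_product 1 1 B \<omega> * factorial_product 2 0 C \<omega>) - 2 * (factorial_product 1 1 B \<omega> * factorial_product 0 2 C \<omega>) + 4 * (factorial_product 1 1 B \<omega> * factorial_product 1 1 C \<omega>)" for \<omega>
    unfolding block_stat_eq by algebra
  have "has_bochner_integral P (\<lambda>\<omega>. block_stat B \<omega> * block_stat C \<omega>)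
     (?m 2 0 2 0 + ?m 2 0 0 2 - 2 * ?m 2 0 1 1 + ?m 0 2 2 0 + ?m 0 2 0 2 - 2 * ?m 0 2 1 1
      - 2 * ?m 1 1 2 0 - 2 * ?m 1 1 0 2 + 4 * ?m 1 1 1 1)"
    unfolding E
    by (intro has_bochner_integral_add has_bochner_integral_diff has_bochner_integral_mult_right
        factorial_product_product_moment B C disj)
  moreover have "?m 2 0 2 0 + ?m 2 0 0 2 - 2 * ?m 2 0 1 1 + ?m 0 2 2 0 + ?m 0 2 0 2 - 2 * ?m 0 2 1 1
      - 2 * ?m 1 1 2 0 - 2 * ?m 1 1 0 2 + 4 * ?m 1 1 1 1 = (meanA B - meanB B)\<^sup>2 * (meanA C - meanB C)\<^sup>2"
    unfolding power_0 power_one_right by algebra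
  ultimately show ?thesis by simp
qed

text \<open>Intervals of one level are disjoint, so their contributions are uncorrelated and variances add up.\<close>

lemma block_stat_sum_variance:
  fixes m :: nat
  assumes F: "\<And>i. i < m \<Longrightarrow> F i \<in> sets borel \<and> F i \<subseteq> {0..1}"
    and disj: "\<And>i j. i < m \<Longrightarrow> j < m \<Longrightarrow> i \<noteq> j \<Longrightarrow> F i \<inter> F j = {}"
  shows "has_bochner_integral P (\<lambda>\<omega>. ((\<Sum>i<m. block_stat (F i) \<omega>) - (\<Sum>i<m. (meanA (F i) - meanB (F i))\<^sup>2))\<^sup>2)
    (\<Sum>i<m. 2 * (meanA (F i) + meanB (F i))\<^sup>2 + 4 * (meanA (F i) + meanB (F i)) * (meanA (F i) - meanB (F i))\<^sup>2)"
proof -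
  define \<mu> where "\<mu> i = (meanA (F i) - meanB (F i))\<^sup>2" for i
  define Y where "Y i \<omega> = block_stat (F i) \<omega> - \<mu> i" for i \<omega>
  have block_stat: "has_bochner_integral P (block_stat (F i)) (\<mu> i)" if "i < m" for i
    unfolding \<mu>_def using block_stat_mean F that by blast
  have YY: "Y i \<omega> * Y j \<omega> = block_stat (F i) \<omega> * block_stat (F j) \<omega> - \<mu> j * block_stat (F i) \<omega> - \<mu> i * block_stat (F j) \<omega> + \<mu> i * \<mu> j" for i j \<omega>
    by (simp add: Y_def algebra_simps)
  have const: "has_bochner_integral P (\<lambda>_. c) c" for c :: real
    by (simp add: has_bochner_integral_iff prob_space)
  have Yij: "has_bochner_integral P (\<lambda>\<omega>. Y i \<omega> * Y j \<omega>) 0" if "i < m" "j < m" "i \<noteq> j" for i j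
  proof -
    have "has_bochner_integral P (\<lambda>\<omega>. Y i \<omega> * Y j \<omega>) (\<mu> i * \<mu> j - \<mu> j * \<mu> i - \<mu> i * \<mu> j + \<mu> i * \<mu> j)"
      unfolding YY using block_stat_product_mean[of "F i" "F j"] F[OF that(1)] F[OF that(2)] disj[OF that] 
      by (intro has_bochner_integral_add has_bochner_integral_diff has_bochner_integral_mult_right const block_stat that)
        (auto simp: \<mu>_def)
    then show ?thesis by simp
  qed
  have Yii: "has_bochner_integral P (\<lambda>\<omega>. Y i \<omega> * Y i \<omega>)
      (2 * (meanA (F i) + meanB (F i))\<^sup>2 + 4 * (meanA (F i) + meanB (F i)) * (meanA (F i) - meanB (F i))\<^sup>2)" if "i < m" for i
  proof -
    have "has_bochner_integral P (\<lambda>\<omega>. Y i \<omega> * Y i \<omega>) (((meanA (F i) - meanB (F i)) ^ 4 + 2 * (meanA (F i) + meanB (F i))\<^sup>2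
        + 4 * (meanA (F i) + meanB (F i)) * (meanA (F i) - meanB (F i))\<^sup>2) - \<mu> i * \<mu> i - \<mu> i * \<mu> i + \<mu> i * \<mu> i)"
      unfolding YY using block_stat_square_mean[of "F i"] F[OF that]
      by (intro has_bochner_integral_add has_bochner_integral_diff has_bochner_integral_mult_right const block_stat that)
        (auto simp: power2_eq_square)
    moreover have "\<mu> i * \<mu> i = (meanA (F i) - meanB (F i)) ^ 4" by (simp add: \<mu>_def power_mult[symmetric] flip: power_add)
    ultimately show ?thesis by simp
  qed
  have "has_bochner_integral P (\<lambda>\<omega>. (\<Sum>i<m. Y i \<omega>)\<^sup>2) (\<Sum>i<m. expectation (\<lambda>\<omega>. (Y i \<omega>)\<^sup>2))"
  proof (rule square_sum_uncorrelated)
    show "integrable P (\<lambda>\<omega>. Y i \<omega> * Y j \<omega>)" if "i < m" "j < m" for i j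
      using Yij[OF that] Yii[OF that(1)] by (cases "i = j") (auto simp: has_bochner_integral_iff)
    show "expectation (\<lambda>\<omega>. Y i \<omega> * Y j \<omega>) = 0" if "i < m" "j < m" "i \<noteq> j" for i j
      using Yij[OF that] by (auto simp: has_bochner_integral_iff)
  qed
  moreover have "(\<Sum>i<m. expectation (\<lambda>\<omega>. (Y i \<omega>)\<^sup>2)) =
     (\<Sum>i<m. 2 * (meanA (F i) + meanB (F i))\<^sup>2 + 4 * (meanA (F i) + meanB (F i)) * (meanA (F i) - meanB (F i))\<^sup>2)"
    using Yii by (intro sum.cong) (auto simp: has_bochner_integral_iff power2_eq_square)
  moreover have "(\<Sum>i<m. Y i \<omega>) = (\<Sum>i<m. block_stat (F i) \<omega>) - (\<Sum>i<m. (meanA (F i) - meanB (F i))\<^sup>2)" for \<omega>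
    by (simp add: Y_def \<mu>_def sum_subtractf)
  ultimately show ?thesis by simp
qed

lemma countA_variance:
  assumes B: "B \<in> sets borel" "B \<subseteq> {0..1}"
  shows "has_bochner_integral P (\<lambda>\<omega>. (real (countA B \<omega>) - meanA B)\<^sup>2) (meanA B)"
proof -
  have E: "(real (countA B \<omega>) - meanA B)\<^sup>2 = falling 2 (countA B \<omega>) + (1 - 2 * meanA B) * falling 1 (countA B \<omega>) + meanA B ^ 2 * falling 0 (countA B \<omega>)" for \<omega>
    by (simp add: falling_expand power2_eq_square algebra_simps)
  have "has_bochner_integral P (\<lambda>\<omega>. (real (countA B \<omega>) - meanA B)\<^sup>2) (meanA B ^ 2 + (1 - 2 * meanA B) * (meanA B ^ 1) + meanA B ^ 2 * (meanA B ^ 0))"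
    unfolding E by (intro has_bochner_integral_add has_bochner_integral_mult_right countA_moment B)
  then show ?thesis by (simp add: power2_eq_square algebra_simps)
qed

lemma countB_variance:
  assumes B: "B \<in> sets borel" "B \<subseteq> {0..1}"
  shows "has_bochner_integral P (\<lambda>\<omega>. (real (countB B \<omega>) - meanB B)\<^sup>2) (meanB B)"
proof -
  have E: "(real (countB B \<omega>) - meanB B)\<^sup>2 = falling 2 (countB B \<omega>) + (1 - 2 * meanB B) * falling 1 (countB B \<omega>) + meanB B ^ 2 * falling 0 (countB B \<omega>)" for \<omega>
    by (simp add: falling_expand power2_eq_square algebra_simps)
  have "has_bochner_integral P (\<lambda>\<omega>. (real (countB B \<omega>) - meanB B)\<^sup>2) (meanB B ^ 2 + (1 - 2 * meanB B) * (meanB B ^ 1) + meanB B ^ 2 * (meanB B ^ 0))"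
    unfolding E by (intro has_bochner_integral_add has_bochner_integral_mult_right countB_moment B)
  then show ?thesis by (simp add: power2_eq_square algebra_simps)
qed

end

section \<open>Haar expansions and dyadic intervals\<close>

lemma space_nu [simp]: "space nu = {0..1}"
  by (simp add: nu_def)

lemma prob_space_nu: "prob_space nu"
  by (rule prob_spaceI) (simp add: nu_def emeasure_restrict_space)

interpretation nu: prob_space nu by (rule prob_space_nu)

definition square_integrable :: "(real \<Rightarrow> real) \<Rightarrow> bool" where
  "square_integrable u \<longleftrightarrow> u \<in> borel_measurable nu \<and> integrable nu (\<lambda>x. (u x)\<^sup>2)"

definition inner_nu :: "(real \<Rightarrow> real) \<Rightarrow> (real \<Rightarrow> real) \<Rightarrow> real" where
  "inner_nu u v = (LINT x|nu. u x * v x)"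

lemma integrable_mult_square_integrable:
  assumes "square_integrable u" "square_integrable v"
  shows "integrable nu (\<lambda>x. u x * v x)"
proof (rule Bochner_Integration.integrable_bound)
  show "integrable nu (\<lambda>x. (u x)\<^sup>2 + (v x)\<^sup>2)" using assms by (auto simp: square_integrable_def)
  show "(\<lambda>x. u x * v x) \<in> borel_measurable nu" using assms by (auto simp: square_integrable_def)
  have "\<bar>y * z\<bar> \<le> y\<^sup>2 + z\<^sup>2" for y z :: real
  proof -
    have "0 \<le> (\<bar>y\<bar> - \<bar>z\<bar>)\<^sup>2" by simp
    then have "2 * (\<bar>y\<bar> * \<bar>z\<bar>) \<le> y\<^sup>2 + z\<^sup>2" by (simp add: power2_diff)
    moreover have "0 \<le> \<bar>y\<bar> * \<bar>z\<bar>" by simp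
    ultimately show ?thesis unfolding abs_mult by linarith
  qed
  then show "AE x in nu. norm (u x * v x) \<le> norm ((u x)\<^sup>2 + (v x)\<^sup>2)" by simp
qed

lemma square_integrable_add: "square_integrable u \<Longrightarrow> square_integrable v \<Longrightarrow> square_integrable (\<lambda>x. u x + v x)"
  using integrable_mult_square_integrable[of u v]
  by (auto simp: square_integrable_def power2_sum mult.assoc)

lemma square_integrable_cmult: "square_integrable u \<Longrightarrow> square_integrable (\<lambda>x. c * u x)"
  by (auto simp: square_integrable_def power_mult_distrib)

lemma square_integrable_diff: "square_integrable u \<Longrightarrow> square_integrable v \<Longrightarrow> square_integrable (\<lambda>x. u x - v x)"
  using square_integrable_add[of u "\<lambda>x. -1 * v x"] square_integrable_cmult[of v "-1"] by simp

lemma square_integrable_sum: "finite I \<Longrightarrow> (\<And>i. i \<in> I \<Longrightarrow> square_integrable (u i)) \<Longrightarrow> square_integrable (\<lambda>x. \<Sum>i\<in>I. u i x)"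
proof (induction I rule: finite_induct)
  case empty
  then show ?case by (simp add: square_integrable_def)
next
  case (insert x F)
  then show ?case by (simp add: square_integrable_add)
qed

lemma square_integrable_bounded:
  assumes "u \<in> borel_measurable nu" "\<And>x. x \<in> {0..1} \<Longrightarrow> \<bar>u x\<bar> \<le> C"
  shows "square_integrable u"
proof -
  have "(u x)\<^sup>2 \<le> C\<^sup>2" if "x \<in> {0..1}" for x
    using assms(2)[OF that] by (metis abs_ge_zero power2_abs power_mono)
  then have "integrable nu (\<lambda>x. (u x)\<^sup>2)"
    using assms(1) by (intro nu.integrable_const_bound[where B = "C\<^sup>2"]) auto
  then show ?thesis using assms by (simp add: square_integrable_def)
qed

lemma L2norm_eq: "L2norm u = sqrt (inner_nu u u)"
  by (simp add: L2norm_def inner_nu_def power2_eq_square)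

lemma inner_nu_self_nonneg: "inner_nu u u \<ge> 0"
  unfolding inner_nu_def by (intro integral_nonneg_AE AE_I2) auto

lemma inner_nu_commute: "inner_nu u v = inner_nu v u" by (simp add: inner_nu_def mult.commute)

lemma inner_nu_add_left: "square_integrable u \<Longrightarrow> square_integrable v \<Longrightarrow> square_integrable w \<Longrightarrow> inner_nu (\<lambda>x. u x + v x) w = inner_nu u w + inner_nu v w"
  unfolding inner_nu_def distrib_right
  by (intro Bochner_Integration.integral_add integrable_mult_square_integrable)

lemma inner_nu_add_right: "square_integrable u \<Longrightarrow> square_integrable v \<Longrightarrow> square_integrable w \<Longrightarrow> inner_nu w (\<lambda>x. u x + v x) = inner_nu w u + inner_nu w v"
  using inner_nu_add_left[of u v w] unfolding inner_nu_commute[of w] .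

lemma inner_nu_cmult_left: "inner_nu (\<lambda>x. c * u x) w = c * inner_nu u w"
  unfolding inner_nu_def mult.assoc by simp

lemma inner_nu_cmult_right: "inner_nu w (\<lambda>x. c * u x) = c * inner_nu w u"
  using inner_nu_cmult_left[of c u w] unfolding inner_nu_commute[of w] .

lemma inner_nu_diff_left: "square_integrable u \<Longrightarrow> square_integrable v \<Longrightarrow> square_integrable w \<Longrightarrow> inner_nu (\<lambda>x. u x - v x) w = inner_nu u w - inner_nu v w"
  unfolding inner_nu_def left_diff_distrib
  by (intro Bochner_Integration.integral_diff integrable_mult_square_integrable)

lemma inner_nu_sum_left:
  assumes "finite I" "\<And>i. i \<in> I \<Longrightarrow> square_integrable (u i)" "square_integrable w"
  shows "inner_nu (\<lambda>x. \<Sum>i\<in>I. c i * u i x) w = (\<Sum>i\<in>I. c i * inner_nu (u i) w)"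
  unfolding inner_nu_def sum_distrib_right mult.assoc
  using assms by (subst Bochner_Integration.integral_sum) (auto intro!: integrable_mult_right integrable_mult_square_integrable)

text \<open>The discriminant of the nonnegative polynomial \<open>t \<mapsto> \<parallel>u + t v\<parallel>\<^sup>2\<close>.\<close>

lemma inner_nu_cauchy_schwarz:
  assumes u: "square_integrable u" and v: "square_integrable v"
  shows "\<bar>inner_nu u v\<bar> \<le> L2norm u * L2norm v"
proof -
  have quad: "0 \<le> inner_nu u u + 2 * t * inner_nu u v + t\<^sup>2 * inner_nu v v" for t
  proof -
    have tv: "square_integrable (\<lambda>x. t * v x)" by (rule square_integrable_cmult[OF v])
    have "inner_nu (\<lambda>x. u x + t * v x) (\<lambda>x. u x + t * v x) = inner_nu u u + 2 * t * inner_nu u v + t\<^sup>2 * inner_nu v v"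
      using u v tv square_integrable_add[OF u tv]
      by (simp add: inner_nu_add_left inner_nu_add_right inner_nu_cmult_left inner_nu_cmult_right
          inner_nu_commute[of v u] power2_eq_square algebra_simps)
    then show ?thesis using inner_nu_self_nonneg[of "\<lambda>x. u x + t * v x"] by simp
  qed
  have "(inner_nu u v)\<^sup>2 \<le> inner_nu u u * inner_nu v v"
  proof (cases "inner_nu v v = 0")
    case True
    have "inner_nu u v = 0"
    proof (rule ccontr)
      assume "inner_nu u v \<noteq> 0"
      then have "2 * (- (inner_nu u u + 1) / (2 * inner_nu u v)) * inner_nu u v = - (inner_nu u u + 1)" by (simp add: field_simps)
      then show False using quad[of "- (inner_nu u u + 1) / (2 * inner_nu u v)"] unfolding True by linarith
    qed
    then show ?thesis using True by simp
  next
    case False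
    then have pos: "inner_nu v v > 0" using inner_nu_self_nonneg[of v] by simp
    have "0 \<le> inner_nu u u - (inner_nu u v)\<^sup>2 / inner_nu v v"
      using quad[of "- inner_nu u v / inner_nu v v"] pos by (simp add: power2_eq_square field_simps)
    then show ?thesis using pos by (simp add: field_simps)
  qed
  then have "sqrt ((inner_nu u v)\<^sup>2) \<le> sqrt (inner_nu u u * inner_nu v v)" by (rule real_sqrt_le_mono)
  then show ?thesis by (simp add: L2norm_eq real_sqrt_mult)
qed

lemma L2norm_nonneg: "L2norm u \<ge> 0" by (simp add: L2norm_eq inner_nu_self_nonneg)

lemma L2norm_triangle:
  assumes u: "square_integrable u" and v: "square_integrable v"
  shows "L2norm (\<lambda>x. u x + v x) \<le> L2norm u + L2norm v"
proof -
  have "(L2norm (\<lambda>x. u x + v x))\<^sup>2 = inner_nu u u + 2 * inner_nu u v + inner_nu v v"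
    using u v square_integrable_add[OF u v] inner_nu_self_nonneg[of "\<lambda>x. u x + v x"]
    by (simp add: L2norm_eq inner_nu_add_left inner_nu_add_right inner_nu_commute[of v u])
  also have "\<dots> \<le> (L2norm u)\<^sup>2 + 2 * (L2norm u * L2norm v) + (L2norm v)\<^sup>2"
    using inner_nu_cauchy_schwarz[OF u v] by (simp add: L2norm_eq inner_nu_self_nonneg)
  also have "\<dots> = (L2norm u + L2norm v)\<^sup>2" by (simp add: power2_sum)
  finally show ?thesis by (rule power2_le_imp_le) (auto intro!: add_nonneg_nonneg L2norm_nonneg)
qed

text \<open>For \<open>k < 2 ^ J\<close> the half-open intervals of level \<open>J\<close> partition [0,1) and leave out the point 1, at which all Haar functions
except the constant vanish.\<close>

definition dyadic :: "nat \<Rightarrow> nat \<Rightarrow> real set" where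
  "dyadic J k = {x. real k \<le> 2 ^ J * x \<and> 2 ^ J * x < real k + 1}"

lemma dyadic_eq: "dyadic J k = {real k / 2 ^ J ..< (real k + 1) / 2 ^ J}"
  by (auto simp: dyadic_def field_simps)

lemma dyadic_borel [measurable]: "dyadic J k \<in> sets borel"
  by (simp add: dyadic_eq)

lemma dyadic_subset:
  assumes "k < 2 ^ J" shows "dyadic J k \<subseteq> {0..<1}"
proof
  fix x assume "x \<in> dyadic J k"
  then have x: "real k \<le> 2 ^ J * x" "2 ^ J * x < real k + 1" by (auto simp: dyadic_def)
  have "real k + 1 \<le> 2 ^ J" using assms by (metis Suc_leI of_nat_Suc of_nat_le_iff of_nat_numeral of_nat_power add.commute)
  then have "2 ^ J * x < 2 ^ J * 1" using x by linarith
  moreover have "2 ^ J * 0 \<le> 2 ^ J * x" using x(1) by linarith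
  ultimately have "x < 1" "0 \<le> x"
    using mult_less_cancel_left_pos[of "2 ^ J" x 1] mult_le_cancel_left_pos[of "2 ^ J" 0 x] by simp_all
  then show "x \<in> {0..<1}" by simp
qed

lemma dyadic_disjoint: "k \<noteq> l \<Longrightarrow> dyadic J k \<inter> dyadic J l = {}"
proof -
  assume "k \<noteq> l"
  then have "real k + 1 \<le> real l \<or> real l + 1 \<le> real k" by linarith
  then show ?thesis by (auto simp: dyadic_def)
qed

lemma dyadic_split: "dyadic J k = dyadic (Suc J) (2 * k) \<union> dyadic (Suc J) (2 * k + 1)"
  by (auto simp: dyadic_def)

lemma dyadic_split_disjoint: "dyadic (Suc J) (2 * k) \<inter> dyadic (Suc J) (2 * k + 1) = {}"
  by (rule dyadic_disjoint) simp

lemma dyadic_cover: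
  assumes "0 \<le> x" "x < 1" shows "\<exists>k<2 ^ J. x \<in> dyadic J k"
proof (intro exI conjI)
  let ?k = "nat \<lfloor>2 ^ J * x\<rfloor>"
  have nn: "0 \<le> 2 ^ J * x" using assms by simp
  have fl: "real ?k = of_int \<lfloor>2 ^ J * x\<rfloor>" using nn by simp
  show "x \<in> dyadic J ?k" unfolding dyadic_def mem_Collect_eq fl by linarith
  have "real ?k \<le> 2 ^ J * x" unfolding fl by linarith
  also have "\<dots> < 2 ^ J" using assms by simp
  finally show "?k < 2 ^ J" by (metis of_nat_less_iff of_nat_numeral of_nat_power)
qed

lemma haar_Node: "haar (Node j k) x =
  2 powr (real j / 2) * (indicator (dyadic (Suc j) (2 * k)) x - indicator (dyadic (Suc j) (2 * k + 1)) x)"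
  by (auto simp: psi_def dyadic_def indicator_def)

lemma haar_Root: "0 \<le> x \<Longrightarrow> x < 1 \<Longrightarrow> haar Root x = indicator (dyadic 0 0) x"
  by (auto simp: dyadic_def)

declare haar.simps [simp del]

definition levels :: "nat \<Rightarrow> haar_index set" where
  "levels J = insert Root (Lam (enat J))"

lemma levels_0: "levels 0 = {Root}"
  by (auto simp: levels_def Lam_def zero_enat_def[symmetric])

lemma levels_Suc: "levels (Suc J) = levels J \<union> Node J ` {..<2 ^ J}"
  by (auto simp: levels_def Lam_def less_Suc_eq)

lemma levels_disjoint: "levels J \<inter> Node J ` {..<2 ^ J} = {}"
  by (auto simp: levels_def Lam_def)

lemma finite_levels: "finite (levels J)"
  by (induction J) (auto simp: levels_0 levels_Suc)

lemma sum_levels_Suc: "(\<Sum>l\<in>levels (Suc J). F l) = (\<Sum>l\<in>levels J. F l) + (\<Sum>k<2 ^ J. F (Node J k))"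
  for F :: "haar_index \<Rightarrow> 'a::comm_monoid_add"
  unfolding levels_Suc using finite_levels levels_disjoint
  by (subst sum.union_disjoint) (auto simp: sum.reindex inj_on_def)

lemma sum_levels: "(\<Sum>l\<in>levels J. F l) = F Root + (\<Sum>j<J. \<Sum>k<2 ^ j. F (Node j k))"
  for F :: "haar_index \<Rightarrow> 'a::comm_monoid_add"
  by (induction J) (auto simp: levels_0 sum_levels_Suc add.assoc)

lemma Node_in_levels: "Node j k \<in> levels J \<longleftrightarrow> j < J \<and> k < 2 ^ j"
  by (auto simp: levels_def Lam_def)

lemma Root_in_levels [simp]: "Root \<in> levels J"
  by (simp add: levels_def)

lemma sum_even_odd: "(\<Sum>k<2 * m. F k) = (\<Sum>k<m. F (2 * k) + F (2 * k + 1))" for F :: "nat \<Rightarrow> real"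
  by (induction m) (auto simp: algebra_simps)

text \<open>A Haar coefficient only depends on the masses of dyadic intervals. With \<open>s\<close> the indicators at a point this
is the value of a Haar function there; with \<open>s\<close> the integrals of a function it is its Haar coefficient; with
\<open>s\<close> the counts of a process it is an empirical coefficient.\<close>

definition haar_coeff :: "(real set \<Rightarrow> real) \<Rightarrow> haar_index \<Rightarrow> real" where
  "haar_coeff s l = (case l of Root \<Rightarrow> s (dyadic 0 0)
     | Node j k \<Rightarrow> 2 powr (real j / 2) * (s (dyadic (Suc j) (2 * k)) - s (dyadic (Suc j) (2 * k + 1))))"

text \<open>Passing from level \<open>J\<close> to \<open>J + 1\<close>, the identity \<open>(p + q) (p' + q') + (p - q) (p' - q') = 2 (p p' + q q')\<close>
for the masses of the two halves turns a sum over coarse intervals plus new coefficients into a sum over fine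
intervals. Applied to indicators this computes the kernel, applied to integrals it is Parseval's identity.\<close>

lemma haar_parseval:
  assumes s: "\<And>J k. k < 2 ^ J \<Longrightarrow> s (dyadic J k) = s (dyadic (Suc J) (2 * k)) + s (dyadic (Suc J) (2 * k + 1))"
    and t: "\<And>J k. k < 2 ^ J \<Longrightarrow> t (dyadic J k) = t (dyadic (Suc J) (2 * k)) + t (dyadic (Suc J) (2 * k + 1))"
  shows "(\<Sum>l\<in>levels J. haar_coeff s l * haar_coeff t l) = 2 ^ J * (\<Sum>k<2 ^ J. s (dyadic J k) * t (dyadic J k))"
proof (induction J)
  case 0
  then show ?case by (simp add: levels_0 haar_coeff_def)
next
  case (Suc J)
  have p: "2 powr (real J / 2) * 2 powr (real J / 2) = (2::real) ^ J"
    by (simp add: powr_add[symmetric] powr_realpow)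
  have node: "haar_coeff s (Node J k) * haar_coeff t (Node J k) = 2 ^ J *
     ((s (dyadic (Suc J) (2 * k)) - s (dyadic (Suc J) (2 * k + 1))) * (t (dyadic (Suc J) (2 * k)) - t (dyadic (Suc J) (2 * k + 1))))" for k
    unfolding p[symmetric] by (simp add: haar_coeff_def mult_ac)
  have "(\<Sum>l\<in>levels (Suc J). haar_coeff s l * haar_coeff t l) =
     2 ^ J * (\<Sum>k<2 ^ J. s (dyadic J k) * t (dyadic J k)) + (\<Sum>k<2 ^ J. haar_coeff s (Node J k) * haar_coeff t (Node J k))"
    unfolding sum_levels_Suc Suc.IH ..
  also have "\<dots> = 2 ^ J * (\<Sum>k<2 ^ J. s (dyadic J k) * t (dyadic J k) +
     (s (dyadic (Suc J) (2 * k)) - s (dyadic (Suc J) (2 * k + 1))) * (t (dyadic (Suc J) (2 * k)) - t (dyadic (Suc J) (2 * k + 1))))"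
    unfolding node sum_distrib_left[symmetric] by (simp add: sum.distrib distrib_left)
  also have "(\<Sum>k<2 ^ J. s (dyadic J k) * t (dyadic J k) +
     (s (dyadic (Suc J) (2 * k)) - s (dyadic (Suc J) (2 * k + 1))) * (t (dyadic (Suc J) (2 * k)) - t (dyadic (Suc J) (2 * k + 1))))
     = (\<Sum>k<2 ^ J. 2 * (s (dyadic (Suc J) (2 * k)) * t (dyadic (Suc J) (2 * k)) + s (dyadic (Suc J) (2 * k + 1)) * t (dyadic (Suc J) (2 * k + 1))))"
    by (intro sum.cong refl) (simp only: s t lessThan_iff, simp add: algebra_simps)
  also have "2 ^ J * \<dots> = 2 ^ Suc J * (\<Sum>k<2 ^ J. (s (dyadic (Suc J) (2 * k)) * t (dyadic (Suc J) (2 * k)) + s (dyadic (Suc J) (2 * k + 1)) * t (dyadic (Suc J) (2 * k + 1))))"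
    by (simp only: sum_distrib_left[symmetric]) simp
  also have "\<dots> = 2 ^ Suc J * (\<Sum>k<2 ^ Suc J. s (dyadic (Suc J) k) * t (dyadic (Suc J) k))"
    using sum_even_odd[of "\<lambda>k. s (dyadic (Suc J) k) * t (dyadic (Suc J) k)" "2 ^ J"] by simp
  finally show ?case .
qed

lemma indicator_dyadic_split: "indicator (dyadic J k) x = (indicator (dyadic (Suc J) (2 * k)) x + indicator (dyadic (Suc J) (2 * k + 1)) x :: real)"
  unfolding dyadic_split[of J k] using dyadic_split_disjoint[of J k] by (auto simp: indicator_def)

lemma haar_eq_haar_coeff:
  assumes "0 \<le> x" "x < 1" shows "haar l x = haar_coeff (\<lambda>B. indicator B x) l"
  using assms by (cases l) (auto simp: haar_coeff_def haar_Node haar_Root)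

lemma K_level_eq:
  assumes "0 \<le> x" "x < 1" "0 \<le> y" "y < 1"
  shows "K_level J x y = 2 ^ J * (\<Sum>k<2 ^ J. indicator (dyadic J k) x * indicator (dyadic J k) y)"
proof -
  have "K_level J x y = (\<Sum>l\<in>levels J. haar_coeff (\<lambda>B. indicator B x) l * haar_coeff (\<lambda>B. indicator B y) l)"
    using assms by (simp add: K_level_def levels_def haar_eq_haar_coeff)
  also have "\<dots> = 2 ^ J * (\<Sum>k<2 ^ J. indicator (dyadic J k) x * indicator (dyadic J k) y)"
    by (rule haar_parseval) (rule indicator_dyadic_split)+
  finally show ?thesis .
qed

lemma dyadic_sets_nu: "k < 2 ^ J \<Longrightarrow> dyadic J k \<in> sets nu"
  using dyadic_subset[of k J] unfolding nu_def sets_restrict_space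
  by (auto intro!: image_eqI[of _ _ "dyadic J k"])

lemma measure_dyadic: 
  assumes "k < 2 ^ J" shows "measure nu (dyadic J k) = 1 / 2 ^ J"
proof -
  have "measure nu (dyadic J k) = measure lborel (dyadic J k)"
    unfolding nu_def using dyadic_subset[OF assms] by (intro measure_restrict_space) auto
  also have "\<dots> = 1 / 2 ^ J" unfolding dyadic_eq by (simp add: divide_right_mono diff_divide_distrib[symmetric])
  finally show ?thesis .
qed

definition cell_integral :: "(real \<Rightarrow> real) \<Rightarrow> real set \<Rightarrow> real" where
  "cell_integral h B = (LINT x:B|nu. h x)"

lemma square_integrable_integrable: "square_integrable h \<Longrightarrow> integrable nu h"
  using integrable_mult_square_integrable[of h "\<lambda>_. 1"] by (simp add: square_integrable_def)

lemma set_integrable_dyadic: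
  fixes h :: "real \<Rightarrow> real"
  assumes "integrable nu h" "k < 2 ^ J" shows "set_integrable nu (dyadic J k) h"
  unfolding set_integrable_def by (rule integrable_mult_indicator[OF dyadic_sets_nu[OF assms(2)] assms(1)])

lemma Suc_index_lt: "k < 2 ^ J \<Longrightarrow> 2 * k < 2 ^ Suc J" "k < 2 ^ J \<Longrightarrow> 2 * k + 1 < (2::nat) ^ Suc J"
  by auto

lemma cell_integral_split:
  assumes "integrable nu h" "k < 2 ^ J"
  shows "cell_integral h (dyadic J k) = cell_integral h (dyadic (Suc J) (2 * k)) + cell_integral h (dyadic (Suc J) (2 * k + 1))"
  unfolding cell_integral_def dyadic_split[of J k]
  by (rule set_integral_Un[OF dyadic_split_disjoint]) (intro set_integrable_dyadic assms Suc_index_lt)+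

lemma haar_measurable:
  assumes "l \<in> levels J" shows "haar l \<in> borel_measurable nu"
proof (cases l)
  case Root
  have "haar Root \<in> borel_measurable borel" by (simp add: haar.simps(1)[abs_def])
  then show ?thesis unfolding Root nu_def by (intro measurable_restrict_space1) simp
next
  case (Node j k)
  have "haar (Node j k) \<in> borel_measurable borel" unfolding haar_Node[abs_def] by measurable
  then show ?thesis unfolding Node nu_def by (intro measurable_restrict_space1) simp
qed

lemma square_integrable_haar: "l \<in> levels J \<Longrightarrow> square_integrable (haar l)"
proof (rule square_integrable_bounded[where C = "max 1 (case l of Root \<Rightarrow> 1 | Node j k \<Rightarrow> 2 powr (real j / 2))"])
  show "\<bar>haar l x\<bar> \<le> max 1 (case l of Root \<Rightarrow> 1 | Node j k \<Rightarrow> 2 powr (real j / 2))" for x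
    by (cases l) (auto simp: haar.simps(1) haar_Node indicator_def)
qed (rule haar_measurable)

lemma inner_nu_haar:
  assumes h: "square_integrable h" and l: "l \<in> levels J"
  shows "inner_nu h (haar l) = haar_coeff (cell_integral h) l"
proof (cases l)
  case Root
  have "{1} \<in> null_sets nu"
    by (rule null_setsI) (auto simp: nu_def emeasure_restrict_space sets_restrict_space intro!: image_eqI[of _ _ "{1}"])
  then have "AE x in nu. x \<notin> {1}" by (rule AE_not_in)
  then have "AE x in nu. h x * haar Root x = indicator (dyadic 0 0) x *\<^sub>R h x"
    by eventually_elim (auto simp: haar.simps dyadic_def indicator_def)
  then show ?thesis
    unfolding Root inner_nu_def haar_coeff_def cell_integral_def set_lebesgue_integral_def
    using h haar_measurable[OF l] dyadic_sets_nu[of 0 0] unfolding Root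
    by (auto simp: square_integrable_def intro!: integral_cong_AE)
next
  case (Node j k)
  then have k: "k < 2 ^ j" using l by (simp add: Node_in_levels)
  have hi: "integrable nu h" by (rule square_integrable_integrable[OF h])
  have "inner_nu h (haar l) = (LINT x|nu. 2 powr (real j / 2) *
     (indicator (dyadic (Suc j) (2 * k)) x *\<^sub>R h x - indicator (dyadic (Suc j) (2 * k + 1)) x *\<^sub>R h x))"
    unfolding inner_nu_def Node haar_Node by (intro Bochner_Integration.integral_cong) (auto simp: algebra_simps)
  also have "\<dots> = haar_coeff (cell_integral h) l"
    unfolding Node haar_coeff_def cell_integral_def set_lebesgue_integral_def
    using set_integrable_dyadic[OF hi Suc_index_lt(1)[OF k]] set_integrable_dyadic[OF hi Suc_index_lt(2)[OF k]]
    by (simp add: set_integrable_def)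
  finally show ?thesis .
qed

lemma cell_integral_haar_fine:
  assumes p: "p < 2 ^ Suc j"
  shows "cell_integral (haar (Node j k)) (dyadic (Suc j) p) =
    2 powr (real j / 2) * (of_bool (p = 2 * k) - of_bool (p = 2 * k + 1)) / 2 ^ Suc j"
proof -
  have ind: "indicator (dyadic (Suc j) p) x * indicator (dyadic (Suc j) q) x = (of_bool (p = q) * indicator (dyadic (Suc j) p) x :: real)" for q x
    using dyadic_disjoint[of p q "Suc j"] by (auto simp: indicator_def)
  have "cell_integral (haar (Node j k)) (dyadic (Suc j) p) = (LINT x|nu. 2 powr (real j / 2) *
     (of_bool (p = 2 * k) - of_bool (p = 2 * k + 1)) * indicator (dyadic (Suc j) p) x)"
    unfolding cell_integral_def set_lebesgue_integral_def haar_Node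
  proof (intro Bochner_Integration.integral_cong refl)
    fix x :: real
    let ?i = "\<lambda>q. indicator (dyadic (Suc j) q) x :: real"
    have "?i p *\<^sub>R (2 powr (real j / 2) * (?i (2 * k) - ?i (2 * k + 1)))
       = 2 powr (real j / 2) * (?i p * ?i (2 * k) - ?i p * ?i (2 * k + 1))" by (simp add: algebra_simps)
    also have "\<dots> = 2 powr (real j / 2) * (of_bool (p = 2 * k) - of_bool (p = 2 * k + 1)) * ?i p"
      unfolding ind by (simp add: algebra_simps)
    finally show "?i p *\<^sub>R (2 powr (real j / 2) * (?i (2 * k) - ?i (2 * k + 1))) =
      2 powr (real j / 2) * (of_bool (p = 2 * k) - of_bool (p = 2 * k + 1)) * ?i p" .
  qed
  also have "\<dots> = 2 powr (real j / 2) * (of_bool (p = 2 * k) - of_bool (p = 2 * k + 1)) / 2 ^ Suc j"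
  proof -
    have "dyadic (Suc j) p \<inter> {0..1} = dyadic (Suc j) p" using dyadic_subset[OF p] by auto
    then have "(LINT x|nu. indicator (dyadic (Suc j) p) x) = 1 / (2::real) ^ Suc j"
      using dyadic_sets_nu[OF p] measure_dyadic[OF p] by simp
    then show ?thesis by (subst integral_mult_right_zero) simp
  qed
  finally show ?thesis .
qed

text \<open>A Haar function has integral zero over its own support, hence over every dyadic interval that is at least
as long; the shorter levels are reached by splitting the interval in two.\<close>

lemma cell_integral_haar_coarse:
  assumes "J \<le> j" "m < 2 ^ J" "k < 2 ^ j"
  shows "cell_integral (haar (Node j k)) (dyadic J m) = 0"
  using assms(1,2)
proof (induction J arbitrary: m rule: inc_induct)
  have int: "integrable nu (haar (Node j k))"
    using assms(3) by (intro square_integrable_integrable square_integrable_haar[of _ "Suc j"]) (simp add: Node_in_levels)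
  {
    case (base m)
    show ?case
      using cell_integral_split[OF int base] cell_integral_haar_fine[OF Suc_index_lt(1)[OF base], of k]
        cell_integral_haar_fine[OF Suc_index_lt(2)[OF base], of k] by (auto simp: of_bool_def split: if_splits)
  next
    case (step J m)
    show ?case
      using cell_integral_split[OF int step.prems] step.IH[OF Suc_index_lt(1)[OF step.prems]]
        step.IH[OF Suc_index_lt(2)[OF step.prems]] by simp
  }
qed

text \<open>Functions of distinct levels are orthogonal since the coarser one is constant on the support of the finer
one. Both this and the normalisation are read off from masses of dyadic intervals.\<close>

lemma inner_nu_haar_haar:
  assumes "l \<in> levels J" "l' \<in> levels J"
  shows "inner_nu (haar l) (haar l') = of_bool (l = l')"
proof -
  have root: "inner_nu (haar Root) (haar Root) = 1"
  proof -
    have "inner_nu (haar Root) (haar Root) = (LINT x|nu. 1)"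
      unfolding inner_nu_def by (intro Bochner_Integration.integral_cong) (auto simp: haar.simps)
    then show ?thesis using nu.prob_space[unfolded space_nu] by simp
  qed
  have node_root: "inner_nu (haar (Node j k)) (haar Root) = 0" if "k < 2 ^ j" for j k
    using that cell_integral_haar_coarse[of 0 j 0 k]
    by (subst inner_nu_haar[of _ _ "Suc j"]) (auto simp: haar_coeff_def Node_in_levels intro!: square_integrable_haar[of _ "Suc j"])
  have node_lt: "inner_nu (haar (Node j k)) (haar (Node i p)) = 0" if "k < 2 ^ j" "p < 2 ^ i" "i < j" for i j k p
    using that cell_integral_haar_coarse[of "Suc i" j _ k] Suc_index_lt[OF that(2)]
    by (subst inner_nu_haar[of _ _ "Suc j"]) (auto simp: haar_coeff_def Node_in_levels intro!: square_integrable_haar[of _ "Suc j"])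
  have node_eq: "inner_nu (haar (Node j k)) (haar (Node j p)) = of_bool (k = p)" if "k < 2 ^ j" "p < 2 ^ j" for j k p
  proof -
    have pw: "2 powr (real j / 2) * 2 powr (real j / 2) = (2::real) ^ j"
      by (simp add: powr_add[symmetric] powr_realpow)
    have "inner_nu (haar (Node j k)) (haar (Node j p)) = haar_coeff (cell_integral (haar (Node j k))) (Node j p)"
      using that by (intro inner_nu_haar[of _ _ "Suc j"] square_integrable_haar[of _ "Suc j"]) (auto simp: Node_in_levels)
    also have "\<dots> = (2 powr (real j / 2) * 2 powr (real j / 2)) * (2 * of_bool (k = p)) / 2 ^ Suc j"
      using cell_integral_haar_fine[OF Suc_index_lt(1)[OF that(2)], of k] cell_integral_haar_fine[OF Suc_index_lt(2)[OF that(2)], of k]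
      by (auto simp: haar_coeff_def of_bool_def)
    finally show ?thesis unfolding pw by simp
  qed
  have root_node: "inner_nu (haar Root) (haar (Node j k)) = 0" if "k < 2 ^ j" for j k
    using node_root[OF that] by (subst inner_nu_commute)
  have node_gt: "inner_nu (haar (Node j k)) (haar (Node i p)) = 0" if "k < 2 ^ j" "p < 2 ^ i" "j < i" for i j k p
    using node_lt[OF that(2,1,3)] by (subst inner_nu_commute)
  show ?thesis
  proof (cases l)
    case Root
    then show ?thesis using assms root root_node by (cases l') (simp_all add: Node_in_levels)
  next
    case l: (Node j k)
    show ?thesis
    proof (cases l')
      case Root
      then show ?thesis using assms l node_root by (simp add: Node_in_levels)
    next
      case (Node i p)
      then show ?thesis using assms l node_eq[of k j p] node_lt[of k j p i] node_gt[of k j p i]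
        by (cases i j rule: linorder_cases) (simp_all add: Node_in_levels)
    qed
  qed
qed

definition haar_sum :: "(haar_index \<Rightarrow> real) \<Rightarrow> nat \<Rightarrow> real \<Rightarrow> real" where
  "haar_sum c J x = (\<Sum>l\<in>levels J. c l * haar l x)"

lemma square_integrable_haar_sum: "square_integrable (haar_sum c J)"
  unfolding haar_sum_def[abs_def] by (intro square_integrable_sum finite_levels square_integrable_cmult square_integrable_haar)

lemma inner_nu_haar_sum: "l \<in> levels J \<Longrightarrow> inner_nu (haar_sum c J) (haar l) = c l"
  unfolding haar_sum_def[abs_def]
  by (subst inner_nu_sum_left) (auto simp: finite_levels square_integrable_haar inner_nu_haar_haar of_bool_def if_distrib cong: if_cong)

lemma inner_nu_haar_sum_self: "inner_nu (haar_sum c J) (haar_sum c J) = (\<Sum>l\<in>levels J. (c l)\<^sup>2)"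
proof -
  have "inner_nu (haar_sum c J) (haar_sum c J) = (\<Sum>l\<in>levels J. c l * inner_nu (haar l) (haar_sum c J))"
    unfolding haar_sum_def[of c J, abs_def]
    by (subst inner_nu_sum_left) (auto simp: finite_levels square_integrable_haar intro!: square_integrable_sum square_integrable_cmult)
  also have "\<dots> = (\<Sum>l\<in>levels J. (c l)\<^sup>2)"
    by (intro sum.cong) (auto simp: inner_nu_commute[of "haar _"] inner_nu_haar_sum power2_eq_square)
  finally show ?thesis .
qed

lemma haar_expansion_iff:
  "has_haar_expansion h c \<longleftrightarrow> square_integrable h \<and> (\<lambda>J. L2norm (\<lambda>x. h x - haar_sum c J x)) \<longlonglongrightarrow> 0"
  by (simp add: has_haar_expansion_def square_integrable_def haar_sum_def sum_levels conj_assoc)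

text \<open>Coefficients of an expansion are unique; this reconciles the expansions that occur in the strong and
in the weak Besov condition.\<close>

lemma haar_expansion_coeff:
  assumes ex: "has_haar_expansion h c" and l: "l \<in> levels J0"
  shows "c l = inner_nu h (haar l)"
proof -
  have h: "square_integrable h" and lim: "(\<lambda>J. L2norm (\<lambda>x. h x - haar_sum c J x)) \<longlonglongrightarrow> 0"
    using ex by (auto simp: haar_expansion_iff)
  have "\<bar>inner_nu h (haar l) - c l\<bar> \<le> L2norm (\<lambda>x. h x - haar_sum c J x)" if "J \<ge> J0" for J
  proof -
    have lJ: "l \<in> levels J" using l that by (cases l) (auto simp: Node_in_levels)
    have "inner_nu h (haar l) - c l = inner_nu (\<lambda>x. h x - haar_sum c J x) (haar l)"
      using h square_integrable_haar_sum square_integrable_haar[OF lJ] by (simp add: inner_nu_diff_left inner_nu_haar_sum[OF lJ])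
    also have "\<bar>\<dots>\<bar> \<le> L2norm (\<lambda>x. h x - haar_sum c J x) * L2norm (haar l)"
      by (intro inner_nu_cauchy_schwarz square_integrable_diff h square_integrable_haar_sum square_integrable_haar[OF lJ])
    also have "L2norm (haar l) = 1" using inner_nu_haar_haar[OF lJ lJ] by (simp add: L2norm_eq)
    finally show ?thesis by simp
  qed
  then have "\<bar>inner_nu h (haar l) - c l\<bar> \<le> 0"
    by (intro LIMSEQ_le_const[OF lim]) blast
  then show ?thesis by simp
qed

lemma haar_expansion_norm:
  assumes ex: "has_haar_expansion h c" and B: "\<And>J. (\<Sum>l\<in>levels J. (c l)\<^sup>2) \<le> B"
  shows "(L2norm h)\<^sup>2 \<le> B"
proof -
  have h: "square_integrable h" and lim: "(\<lambda>J. L2norm (\<lambda>x. h x - haar_sum c J x)) \<longlonglongrightarrow> 0"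
    using ex by (auto simp: haar_expansion_iff)
  have "L2norm h - sqrt B \<le> L2norm (\<lambda>x. h x - haar_sum c J x)" for J
  proof -
    have "L2norm h \<le> L2norm (\<lambda>x. h x - haar_sum c J x) + L2norm (haar_sum c J)"
      using L2norm_triangle[OF square_integrable_diff[OF h square_integrable_haar_sum] square_integrable_haar_sum, of c J c J] by simp
    also have "L2norm (haar_sum c J) \<le> sqrt B"
      unfolding L2norm_eq inner_nu_haar_sum_self by (intro real_sqrt_le_mono B)
    finally show ?thesis by simp
  qed
  then have "L2norm h - sqrt B \<le> 0" by (intro LIMSEQ_le_const[OF lim]) blast
  then have "(L2norm h)\<^sup>2 \<le> (sqrt B)\<^sup>2" by (intro power_mono L2norm_nonneg) simp
  moreover have "0 \<le> B" using B[of 0] sum_nonneg[of "levels 0" "\<lambda>l. (c l)\<^sup>2"] by simp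
  ultimately show ?thesis by simp
qed

text \<open>Beyond level \<open>J\<close> the squared coefficients are dominated by a geometric series.\<close>

lemma besov_tail:
  assumes ex: "has_haar_expansion h c" and d: "\<delta> > 0"
    and bes: "\<And>j. (\<Sum>k<2 ^ j. (c (Node j k))\<^sup>2) \<le> R\<^sup>2 * 2 powr (- 2 * real j * \<delta>)"
  shows "(L2norm h)\<^sup>2 \<le> (\<Sum>l\<in>levels J. (c l)\<^sup>2) + R\<^sup>2 * 2 powr (- 2 * real J * \<delta>) / (1 - 2 powr (- 2 * \<delta>))"
proof (rule haar_expansion_norm[OF ex])
  define q where "q = (2::real) powr (- 2 * \<delta>)"
  have q: "0 < q" "q < 1" using d by (auto simp: q_def powr_less_one)
  have qj: "2 powr (- 2 * real j * \<delta>) = q ^ j" for j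
    by (simp add: q_def powr_realpow[symmetric] powr_powr mult_ac)
  define E where "E J = (\<Sum>l\<in>levels J. (c l)\<^sup>2)" for J
  have step: "E (J + d) \<le> E J + R\<^sup>2 * q ^ J * (1 - q ^ d) / (1 - q)" for d
  proof (induction d)
    case (Suc d)
    have "E (J + Suc d) = E (J + d) + (\<Sum>k<2 ^ (J + d). (c (Node (J + d) k))\<^sup>2)"
      unfolding E_def by (simp add: sum_levels_Suc)
    also have "\<dots> \<le> E J + R\<^sup>2 * q ^ J * (1 - q ^ d) / (1 - q) + R\<^sup>2 * q ^ (J + d)"
      using Suc.IH bes[of "J + d"] unfolding qj by (intro add_mono) auto
    also have "\<dots> = E J + R\<^sup>2 * q ^ J * (1 - q ^ Suc d) / (1 - q)"
      using q by (simp add: field_simps power_add)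
    finally show ?case .
  qed simp
  have bnd: "E (J + d) \<le> E J + R\<^sup>2 * q ^ J / (1 - q)" for d
  proof -
    have "R\<^sup>2 * q ^ J * (1 - q ^ d) / (1 - q) \<le> R\<^sup>2 * q ^ J * 1 / (1 - q)"
      using q by (intro divide_right_mono mult_left_mono) auto
    then show ?thesis using step[of d] by simp
  qed
  have "E M \<le> E (J + M)" for M
  proof (induction J)
    case (Suc J)
    have "E (J + M) \<le> E (Suc J + M)" unfolding E_def by (simp add: sum_levels_Suc sum_nonneg)
    then show ?case using Suc by simp
  qed simp
  then show "(\<Sum>l\<in>levels M. (c l)\<^sup>2) \<le> (\<Sum>l\<in>levels J. (c l)\<^sup>2) +
      R\<^sup>2 * 2 powr (- 2 * real J * \<delta>) / (1 - 2 powr (- 2 * \<delta>))" for M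
    using bnd[of M] unfolding E_def qj q_def[symmetric] by (rule order_trans)
qed

lemma haar_energy:
  assumes "square_integrable h"
  shows "(\<Sum>l\<in>levels J. (inner_nu h (haar l))\<^sup>2) = 2 ^ J * (\<Sum>k<2 ^ J. (cell_integral h (dyadic J k))\<^sup>2)"
proof -
  have "(\<Sum>l\<in>levels J. (inner_nu h (haar l))\<^sup>2) = (\<Sum>l\<in>levels J. haar_coeff (cell_integral h) l * haar_coeff (cell_integral h) l)"
    using assms by (intro sum.cong) (auto simp: inner_nu_haar power2_eq_square)
  also have "\<dots> = 2 ^ J * (\<Sum>k<2 ^ J. cell_integral h (dyadic J k) * cell_integral h (dyadic J k))"
    by (rule haar_parseval) (intro cell_integral_split square_integrable_integrable assms, assumption)+
  finally show ?thesis by (simp add: power2_eq_square)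
qed

section \<open>The statistics as functions of dyadic counts\<close>

lemma sum_off_diagonal:
  fixes F :: "'a \<Rightarrow> 'a \<Rightarrow> real"
  assumes "finite N"
  shows "(\<Sum>(x, x') \<in> {(x, x'). x \<in> N \<and> x' \<in> N \<and> x \<noteq> x'}. F x x') = (\<Sum>x\<in>N. \<Sum>x'\<in>N. F x x') - (\<Sum>x\<in>N. F x x)"
proof -
  let ?O = "{(x, x'). x \<in> N \<and> x' \<in> N \<and> x \<noteq> x'}" and ?I = "(\<lambda>x. (x, x)) ` N"
  have fin: "finite ?O" by (rule finite_subset[of _ "N \<times> N"]) (use assms in auto)
  have "(\<Sum>x\<in>N. \<Sum>x'\<in>N. F x x') = (\<Sum>(x, x') \<in> N \<times> N. F x x')" by (simp add: sum.cartesian_product)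
  also have "N \<times> N = ?O \<union> ?I" by auto
  also have "(\<Sum>(x, x') \<in> ?O \<union> ?I. F x x') = (\<Sum>(x, x') \<in> ?O. F x x') + (\<Sum>(x, x') \<in> ?I. F x x')"
    using fin assms by (intro sum.union_disjoint) auto
  also have "(\<Sum>(x, x') \<in> ?I. F x x') = (\<Sum>x\<in>N. F x x)"
    by (subst sum.reindex) (auto simp: inj_on_def)
  finally show ?thesis by simp
qed

text \<open>A sum over distinct pairs is the full double sum, which factorises into squares, minus the diagonal, on
which the marks have square 1. Disjointness of the two processes makes the signed sum a difference.\<close>

lemma T_hat_separable:
  assumes fin: "finite A" "finite B" and disj: "A \<inter> B = {}" and I: "finite I"
    and K: "\<And>x y. x \<in> A \<union> B \<Longrightarrow> y \<in> A \<union> B \<Longrightarrow> K x y = c * (\<Sum>k\<in>I. v k x * v k y)"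
  shows "T_hat K (A, B) = c * (\<Sum>k\<in>I. ((\<Sum>x\<in>A. v k x) - (\<Sum>x\<in>B. v k x))\<^sup>2
    - ((\<Sum>x\<in>A. (v k x)\<^sup>2) + (\<Sum>x\<in>B. (v k x)\<^sup>2)))"
proof -
  let ?N = "A \<union> B"
  let ?e = "mark A"
  have e2: "?e x * ?e x = 1" for x by (simp add: mark_def)
  have m: "(\<Sum>x\<in>?N. u x * ?e x) = (\<Sum>x\<in>A. u x) - (\<Sum>x\<in>B. u x)" for u :: "real \<Rightarrow> real"
  proof -
    have "(\<Sum>x\<in>?N. u x * ?e x) = (\<Sum>x\<in>A. u x * ?e x) + (\<Sum>x\<in>B. u x * ?e x)"
      using fin disj by (rule sum.union_disjoint)
    also have "(\<Sum>x\<in>A. u x * ?e x) = (\<Sum>x\<in>A. u x)" by (intro sum.cong) (auto simp: mark_def)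
    also have "(\<Sum>x\<in>B. u x * ?e x) = (\<Sum>x\<in>B. - u x)" using disj by (intro sum.cong) (auto simp: mark_def)
    finally show ?thesis by (simp add: sum_negf)
  qed
  have "T_hat K (A, B) = (\<Sum>x\<in>?N. \<Sum>y\<in>?N. K x y * ?e x * ?e y) - (\<Sum>x\<in>?N. K x x * ?e x * ?e x)"
    unfolding T_hat_def split using fin by (intro sum_off_diagonal) auto
  also have "(\<Sum>x\<in>?N. \<Sum>y\<in>?N. K x y * ?e x * ?e y) = (\<Sum>x\<in>?N. \<Sum>y\<in>?N. \<Sum>k\<in>I. c * ((v k x * ?e x) * (v k y * ?e y)))"
    by (intro sum.cong refl) (simp add: K sum_distrib_left sum_distrib_right mult_ac)
  also have "\<dots> = (\<Sum>k\<in>I. \<Sum>x\<in>?N. \<Sum>y\<in>?N. c * ((v k x * ?e x) * (v k y * ?e y)))"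
    by (subst sum.swap[of _ I], subst sum.swap[of _ I]) (rule refl)
  also have "\<dots> = (\<Sum>k\<in>I. c * ((\<Sum>x\<in>?N. v k x * ?e x) * (\<Sum>y\<in>?N. v k y * ?e y)))"
    by (simp only: sum_product) (simp only: sum_distrib_left)
  also have "\<dots> = c * (\<Sum>k\<in>I. ((\<Sum>x\<in>A. v k x) - (\<Sum>x\<in>B. v k x))\<^sup>2)"
    by (simp add: m power2_eq_square sum_distrib_left)
  also have "(\<Sum>x\<in>?N. K x x * ?e x * ?e x) = (\<Sum>x\<in>?N. \<Sum>k\<in>I. c * (v k x)\<^sup>2)"
    by (intro sum.cong refl) (simp add: K sum_distrib_left mult.assoc e2 power2_eq_square)
  also have "\<dots> = (\<Sum>k\<in>I. \<Sum>x\<in>?N. c * (v k x)\<^sup>2)" by (rule sum.swap)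
  also have "\<dots> = c * (\<Sum>k\<in>I. (\<Sum>x\<in>A. (v k x)\<^sup>2) + (\<Sum>x\<in>B. (v k x)\<^sup>2))"
    using fin disj by (simp add: sum.union_disjoint sum_distrib_left distrib_left)
  finally show ?thesis by (simp add: sum_subtractf right_diff_distrib)
qed

lemma energy_single_le:
  assumes "finite N"
  shows "energy (K_single l) N \<le> (\<Sum>x\<in>N. (haar l x)\<^sup>2)\<^sup>2"
proof -
  have "energy (K_single l) N = (\<Sum>x\<in>N. \<Sum>y\<in>N. (haar l x)\<^sup>2 * (haar l y)\<^sup>2) - (\<Sum>x\<in>N. (haar l x)\<^sup>2 * (haar l x)\<^sup>2)"
    unfolding energy_def sum_off_diagonal[OF assms] by (simp add: K_single_def power_mult_distrib)
  also have "\<dots> \<le> (\<Sum>x\<in>N. \<Sum>y\<in>N. (haar l x)\<^sup>2 * (haar l y)\<^sup>2)"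
    by (simp add: sum_nonneg)
  finally show ?thesis by (simp add: power2_eq_square[of "sum _ _"] sum_product)
qed

lemma sum_indicator_card: "finite A \<Longrightarrow> (\<Sum>x\<in>A. indicator B x) = real (card (A \<inter> B))"
  by (simp add: indicator_def if_distrib sum.If_cases)

lemma sum_indicator_dyadic: "(\<Sum>k<2 ^ J. indicator (dyadic J k) x * indicator (dyadic J k) y)\<^sup>2 =
   (\<Sum>k<2 ^ J. indicator (dyadic J k) x * indicator (dyadic J k) y :: real)"
proof (cases "\<exists>k<2 ^ J. x \<in> dyadic J k")
  case True
  then obtain k where k: "k < 2 ^ J" "x \<in> dyadic J k" by auto
  have z: "indicator (dyadic J l) x = (0::real)" if "l \<noteq> k" for l
    using dyadic_disjoint[OF that, of J] k by (auto simp: indicator_def)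
  have "(\<Sum>l<2 ^ J. indicator (dyadic J l) x * indicator (dyadic J l) y) = (indicator (dyadic J k) x * indicator (dyadic J k) y :: real)"
    using k z by (subst sum.remove[of _ k]) auto
  then show ?thesis by (simp add: indicator_def)
next
  case False
  then have "indicator (dyadic J l) x = (0::real)" if "l < 2 ^ J" for l using that by (auto simp: indicator_def)
  then show ?thesis by simp
qed

lemma energy_level:
  assumes "finite N" "N \<subseteq> {0..<1}"
  shows "energy (K_level J) N = (2 ^ J)\<^sup>2 * (\<Sum>k<2 ^ J. (real (card (N \<inter> dyadic J k)))\<^sup>2 - real (card (N \<inter> dyadic J k)))"
proof -
  have K: "(K_level J x y)\<^sup>2 = (2 ^ J)\<^sup>2 * (\<Sum>k<2 ^ J. indicator (dyadic J k) x * indicator (dyadic J k) y)" if "x \<in> N" "y \<in> N" for x y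
  proof -
    have "0 \<le> x \<and> x < 1" "0 \<le> y \<and> y < 1" using that assms(2) by auto
    then have "K_level J x y = 2 ^ J * (\<Sum>k<2 ^ J. indicator (dyadic J k) x * indicator (dyadic J k) y)" by (simp add: K_level_eq)
    then show ?thesis using sum_indicator_dyadic[of J x y] by (simp add: power_mult_distrib)
  qed
  have "energy (K_level J) N = (\<Sum>x\<in>N. \<Sum>y\<in>N. (K_level J x y)\<^sup>2) - (\<Sum>x\<in>N. (K_level J x x)\<^sup>2)"
    unfolding energy_def by (rule sum_off_diagonal[OF assms(1)])
  also have "(\<Sum>x\<in>N. \<Sum>y\<in>N. (K_level J x y)\<^sup>2) = (\<Sum>x\<in>N. \<Sum>y\<in>N. \<Sum>k<2 ^ J. (2 ^ J)\<^sup>2 * (indicator (dyadic J k) x * indicator (dyadic J k) y))"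
    by (intro sum.cong refl) (simp only: K sum_distrib_left)
  also have "\<dots> = (\<Sum>k<2 ^ J. \<Sum>x\<in>N. \<Sum>y\<in>N. (2 ^ J)\<^sup>2 * (indicator (dyadic J k) x * indicator (dyadic J k) y))"
    by (subst sum.swap[of _ "{..<2 ^ J}"], subst sum.swap[of _ "{..<2 ^ J}"]) (rule refl)
  also have "\<dots> = (\<Sum>k<2 ^ J. (2 ^ J)\<^sup>2 * ((\<Sum>x\<in>N. indicator (dyadic J k) x) * (\<Sum>y\<in>N. indicator (dyadic J k) y)))"
    by (simp only: sum_product) (simp only: sum_distrib_left)
  also have "\<dots> = (\<Sum>k<2 ^ J. (2 ^ J)\<^sup>2 * (real (card (N \<inter> dyadic J k)))\<^sup>2)"
    using assms(1) by (simp only: sum_indicator_card power2_eq_square)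
  also have "(\<Sum>x\<in>N. (K_level J x x)\<^sup>2) = (\<Sum>x\<in>N. \<Sum>k<2 ^ J. (2 ^ J)\<^sup>2 * indicator (dyadic J k) x)"
    by (intro sum.cong refl) (simp only: K sum_distrib_left indicator_inter_arith[symmetric] Int_absorb)
  also have "\<dots> = (\<Sum>k<2 ^ J. (2 ^ J)\<^sup>2 * (\<Sum>x\<in>N. indicator (dyadic J k) x))"
    by (subst sum.swap) (simp only: sum_distrib_left)
  also have "\<dots> = (\<Sum>k<2 ^ J. (2 ^ J)\<^sup>2 * real (card (N \<inter> dyadic J k)))"
    using assms(1) by (simp only: sum_indicator_card)
  finally show ?thesis by (simp only: sum_subtractf[symmetric] sum_distrib_left right_diff_distrib)
qed

lemma haar_square:
  assumes "l \<in> levels J" "0 \<le> x" "x < 1"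
  shows "(haar l x)\<^sup>2 = (case l of Root \<Rightarrow> indicator (dyadic 0 0) x | Node j k \<Rightarrow> 2 ^ j * indicator (dyadic j k) x)"
proof (cases l)
  case Root
  then show ?thesis using assms by (simp add: haar_Root indicator_def)
next
  case (Node j k)
  have p: "(2 powr (real j / 2))\<^sup>2 = (2::real) ^ j"
    by (simp add: powr_add[symmetric] powr_realpow power2_eq_square)
  show ?thesis unfolding Node haar_Node power_mult_distrib p
    using dyadic_split_disjoint[of j k] by (auto simp: dyadic_split[of j k] indicator_def)
qed

lemma sum_haar:
  assumes "finite A" "A \<subseteq> {0..<1}"
  shows "(\<Sum>x\<in>A. haar l x) = haar_coeff (\<lambda>B. real (card (A \<inter> B))) l"
proof -
  have "(\<Sum>x\<in>A. haar l x) = (\<Sum>x\<in>A. haar_coeff (\<lambda>B. indicator B x) l)"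
    using assms by (intro sum.cong refl haar_eq_haar_coeff) auto
  also have "\<dots> = haar_coeff (\<lambda>B. \<Sum>x\<in>A. indicator B x) l"
    by (cases l) (simp_all only: haar_coeff_def haar_index.case sum_distrib_left[symmetric] sum_subtractf)
  finally show ?thesis using assms(1) by (simp add: sum_indicator_card)
qed

lemma haar_coeff_diff: "haar_coeff s l - haar_coeff t l = haar_coeff (\<lambda>B. s B - t B) l"
  by (cases l) (simp_all add: haar_coeff_def algebra_simps)

lemma symmetric_K_level: "symmetric_kernel (K_level J)"
  by (simp add: symmetric_kernel_def K_level_def mult.commute)

lemma symmetric_K_single: "symmetric_kernel (K_single l)"
  by (simp add: symmetric_kernel_def K_single_def mult.commute)

text \<open>The configurations for which pooling loses nothing: no common point, and no point at 1, which is
outside the dyadic intervals of [0,1).\<close>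

definition good :: "real set \<times> real set \<Rightarrow> bool" where
  "good \<omega> \<longleftrightarrow> fst \<omega> \<inter> snd \<omega> = {} \<and> finite (fst \<omega>) \<and> finite (snd \<omega>) \<and> fst \<omega> \<subseteq> {0..<1} \<and> snd \<omega> \<subseteq> {0..<1}"

locale bounded_poisson_pair = poisson_pair +
  fixes C :: real
  assumes C: "C > 0" and fC: "\<And>x. x \<in> {0..1} \<Longrightarrow> f x \<le> C" and gC: "\<And>x. x \<in> {0..1} \<Longrightarrow> g x \<le> C"
begin

lemma meanA_cell: "k < 2 ^ J \<Longrightarrow> meanA (dyadic J k) = n * cell_integral f (dyadic J k)"
  using dyadic_subset[of k J] n f unfolding meanA_def cell_integral_def by (intro set_integral_mu) (auto simp: intensity_def)

lemma meanB_cell: "k < 2 ^ J \<Longrightarrow> meanB (dyadic J k) = n * cell_integral g (dyadic J k)"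
  using dyadic_subset[of k J] n g unfolding meanB_def cell_integral_def by (intro set_integral_mu) (auto simp: intensity_def)

lemma cell_integral_le:
  assumes "integrable nu h" "\<And>x. x \<in> {0..1} \<Longrightarrow> h x \<le> C" "k < 2 ^ J"
  shows "cell_integral h (dyadic J k) \<le> C / 2 ^ J"
proof -
  have "cell_integral h (dyadic J k) \<le> (LINT x|nu. C * indicator (dyadic J k) x)"
    unfolding cell_integral_def set_lebesgue_integral_def
  proof (rule integral_mono)
    show "integrable nu (\<lambda>x. indicator (dyadic J k) x *\<^sub>R h x)"
      using set_integrable_dyadic[OF assms(1,3)] by (simp only: set_integrable_def)
    show "integrable nu (\<lambda>x. C * indicator (dyadic J k) x)"
      using dyadic_sets_nu[OF assms(3)] by (intro integrable_mult_right integrable_real_indicator) (auto simp: less_top[symmetric])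
    show "indicator (dyadic J k) x *\<^sub>R h x \<le> C * indicator (dyadic J k) x" if "x \<in> space nu" for x
      using assms(2)[of x] that by (simp add: indicator_def)
  qed
  also have "\<dots> = C * measure nu (dyadic J k)"
  proof -
    have "dyadic J k \<inter> {0..1} = dyadic J k" using dyadic_subset[OF assms(3)] by auto
    then show ?thesis using dyadic_sets_nu[OF assms(3)] by (subst integral_mult_right_zero) simp
  qed
  also have "\<dots> = C / 2 ^ J" by (simp add: measure_dyadic[OF assms(3)])
  finally show ?thesis .
qed

lemma meanA_le: "k < 2 ^ J \<Longrightarrow> meanA (dyadic J k) \<le> n * C / 2 ^ J"
  using cell_integral_le[of f k J] fC f n mult_left_mono[of "cell_integral f (dyadic J k)" "C / 2 ^ J" n] by (simp add: meanA_cell intensity_def)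

lemma meanB_le: "k < 2 ^ J \<Longrightarrow> meanB (dyadic J k) \<le> n * C / 2 ^ J"
  using cell_integral_le[of g k J] gC g n mult_left_mono[of "cell_integral g (dyadic J k)" "C / 2 ^ J" n] by (simp add: meanB_cell intensity_def)

abbreviation h :: "real \<Rightarrow> real" where "h \<equiv> \<lambda>x. f x - g x"

lemma square_integrable_h: "square_integrable h"
proof (rule square_integrable_bounded[where C = C])
  show "h \<in> borel_measurable nu" using f g by (auto simp: intensity_def)
  show "\<bar>h x\<bar> \<le> C" if "x \<in> {0..1}" for x
  proof -
    have "0 \<le> f x" "0 \<le> g x" using f g that by (simp_all add: intensity_def)
    then show ?thesis using fC[OF that] gC[OF that] by (simp add: abs_le_iff)
  qed
qed

lemma mean_difference: "k < 2 ^ J \<Longrightarrow> meanA (dyadic J k) - meanB (dyadic J k) = n * cell_integral h (dyadic J k)"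
  using f g set_integrable_dyadic[of f k J] set_integrable_dyadic[of g k J]
  by (simp add: meanA_cell meanB_cell cell_integral_def right_diff_distrib set_integral_diff intensity_def)

lemma mean_singleton: "meanA {1} = 0" "meanB {1} = 0"
proof -
  have null: "{1} \<in> null_sets nu"
    by (rule null_setsI) (auto simp: nu_def emeasure_restrict_space sets_restrict_space intro!: image_eqI[of _ _ "{1}"])
  have z: "(LINT x:{1}|nu. u x) = 0" for u :: "real \<Rightarrow> real"
  proof -
    have "AE x in nu. indicator {1} x *\<^sub>R u x = 0"
      using AE_not_in[OF null] by eventually_elim (auto simp: indicator_def)
    then show ?thesis unfolding set_lebesgue_integral_def by (rule integral_eq_zero_AE)
  qed
  show "meanA {1} = 0" "meanB {1} = 0"
    using n f g z unfolding meanA_def meanB_def by (simp_all add: set_integral_mu intensity_def)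
qed

lemma dyadic_in_unit_interval: "k < 2 ^ J \<Longrightarrow> dyadic J k \<in> sets borel \<and> dyadic J k \<subseteq> {0..1}"
  using dyadic_subset[of k J] by (auto simp: dyadic_borel)

lemma markov:
  assumes U: "has_bochner_integral P U u" and pos: "\<And>\<omega>. 0 \<le> U \<omega>" and t: "t > 0" and le: "u \<le> e * t"
  shows "\<exists>E \<in> sets P. prob E \<le> e \<and> (\<forall>\<omega>\<in>space P - E. U \<omega> < (t::real))"
proof (intro bexI conjI)
  have int: "integrable P U" and u: "integral\<^sup>L P U = u" using U by (auto simp: has_bochner_integral_iff)
  have [measurable]: "U \<in> borel_measurable P" using int by auto
  have "prob {\<omega>\<in>space P. U \<omega> \<ge> t} \<le> integral\<^sup>L P U / t"
    using int pos t by (intro integral_Markov_inequality_measure[where A = "{}"]) auto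
  also have "\<dots> \<le> e" using le t u by (simp add: field_simps)
  finally show "prob {\<omega>\<in>space P. U \<omega> \<ge> t} \<le> e" .
  show "{\<omega>\<in>space P. U \<omega> \<ge> t} \<in> sets P" by measurable
qed auto

text \<open>If the two processes share a point other than 1, then for each \<open>M\<close> some dyadic interval of level \<open>M\<close> contains points of
both. The expected number of such coincidences is at most \<open>2 ^ M (n C / 2 ^ M)\<^sup>2\<close>, which tends to 0.
The point 1 is a null set and almost surely carries no point.\<close>

lemma almost_good:
  assumes "e > 0"
  shows "\<exists>E \<in> sets P. prob E \<le> e \<and> (\<forall>\<omega>\<in>space P - E. good \<omega>)"
proof -
  \<comment> \<open>the level is so fine that coincidences have expected number at most \<open>e\<close>\<close>
  obtain M where M: "(n * C)\<^sup>2 / e < 2 ^ M" using real_arch_pow[of 2 "(n * C)\<^sup>2 / e"] by auto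
  define U where "U \<omega> = (\<Sum>k<2 ^ M. factorial_product 1 1 (dyadic M k) \<omega>) + factorial_product 1 0 {1} \<omega> + factorial_product 0 1 {1} \<omega>" for \<omega>
  have "has_bochner_integral P (\<lambda>\<omega>. (\<Sum>k<2 ^ M. factorial_product 1 1 (dyadic M k) \<omega>) + factorial_product 1 0 {1} \<omega> + factorial_product 0 1 {1} \<omega>)
      ((\<Sum>k<2 ^ M. meanA (dyadic M k) ^ 1 * meanB (dyadic M k) ^ 1) + meanA {1} ^ 1 * meanB {1} ^ 0 + meanA {1} ^ 0 * meanB {1} ^ 1)"
    by (intro has_bochner_integral_add has_bochner_integral_sum factorial_product_moment) (auto simp: dyadic_in_unit_interval)
  then have U: "has_bochner_integral P U (\<Sum>k<2 ^ M. meanA (dyadic M k) * meanB (dyadic M k))"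
    by (simp add: mean_singleton U_def[abs_def])
  have "(\<Sum>k<2 ^ M. meanA (dyadic M k) * meanB (dyadic M k)) \<le> (\<Sum>k<(2::nat) ^ M. (n * C / 2 ^ M) * (n * C / 2 ^ M))"
    using meanA_le meanB_le mean_nonneg n C by (intro sum_mono mult_mono) auto
  also have "\<dots> = (n * C)\<^sup>2 / 2 ^ M" by (simp add: power2_eq_square)
  also have "\<dots> \<le> e * 1" using M assms by (simp add: field_simps)
  finally have "\<exists>E \<in> sets P. prob E \<le> e \<and> (\<forall>\<omega>\<in>space P - E. U \<omega> < 1)"
    by (intro markov[OF U]) (auto simp: U_def factorial_product_def intro!: add_nonneg_nonneg sum_nonneg mult_nonneg_nonneg falling_nonneg)
  moreover have "good \<omega>" if \<omega>: "\<omega> \<in> space P" and U1: "U \<omega> < 1" for \<omega>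
  proof -
    have fin: "finite (fst \<omega>)" "finite (snd \<omega>)" "fst \<omega> \<subseteq> {0..1}" "snd \<omega> \<subseteq> {0..1}"
      using \<omega> by (auto simp: space_P space_conf)
    define S where "S = (\<Sum>k<2 ^ M. countA (dyadic M k) \<omega> * countB (dyadic M k) \<omega>) + countA {1} \<omega> + countB {1} \<omega>"
    have "U \<omega> = real S" by (simp add: U_def factorial_product_def falling_expand S_def)
    then have "S = 0" using U1 by simp
    then have S: "\<And>k. k < 2 ^ M \<Longrightarrow> countA (dyadic M k) \<omega> = 0 \<or> countB (dyadic M k) \<omega> = 0" "countA {1} \<omega> = 0" "countB {1} \<omega> = 0"
      by (auto simp: S_def)
    have 1: "1 \<notin> fst \<omega>" "1 \<notin> snd \<omega>" using S(2,3) fin by (auto simp: countA_def countB_def)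
    have sub: "fst \<omega> \<subseteq> {0..<1}" "snd \<omega> \<subseteq> {0..<1}"
      using fin 1 by (auto simp: less_le)
    have "x \<notin> snd \<omega>" if "x \<in> fst \<omega>" for x
    proof
      assume x: "x \<in> snd \<omega>"
      have "0 \<le> x" "x < 1" using sub that by auto
      then obtain k where k: "k < 2 ^ M" "x \<in> dyadic M k" using dyadic_cover[of x M] by blast
      have "x \<in> fst \<omega> \<inter> dyadic M k" "x \<in> snd \<omega> \<inter> dyadic M k" using k that x by simp_all
      then have "countA (dyadic M k) \<omega> \<noteq> 0" "countB (dyadic M k) \<omega> \<noteq> 0"
        using fin unfolding countA_def countB_def by (metis card_0_eq empty_iff finite_Int)+
      then show False using S(1)[OF k(1)] by simp
    qed
    then show ?thesis using fin sub by (auto simp: good_def)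
  qed
  ultimately show ?thesis by blast
qed

end

section \<open>Power of one kernel\<close>

context bounded_poisson_pair
begin

text \<open>For disjoint processes, the number of ordered pairs of distinct points in \<open>B\<close>; a dyadic interval of level
\<open>J\<close> contributes \<open>(2 ^ J)\<^sup>2\<close> times this number to the energy of \<open>K_level J\<close>.\<close>

definition pair_count :: "real set \<Rightarrow> real set \<times> real set \<Rightarrow> real" where
  "pair_count B \<omega> = (real (countA B \<omega>) + real (countB B \<omega>))\<^sup>2 - (real (countA B \<omega>) + real (countB B \<omega>))"

lemma pair_count_eq: "pair_count B \<omega> = factorial_product 2 0 B \<omega> + factorial_product 0 2 B \<omega> + 2 * factorial_product 1 1 B \<omega>"
  by (simp add: pair_count_def factorial_product_def falling_expand power2_eq_square algebra_simps)

lemma pair_count_nonneg: "pair_count B \<omega> \<ge> 0"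
  unfolding pair_count_eq factorial_product_def by (intro add_nonneg_nonneg mult_nonneg_nonneg falling_nonneg) auto

lemma pair_count_mean:
  assumes B: "B \<in> sets borel" "B \<subseteq> {0..1}"
  shows "has_bochner_integral P (pair_count B) ((meanA B + meanB B)\<^sup>2)"
proof -
  have "has_bochner_integral P (\<lambda>\<omega>. factorial_product 2 0 B \<omega> + factorial_product 0 2 B \<omega> + 2 * factorial_product 1 1 B \<omega>)
     (meanA B ^ 2 * meanB B ^ 0 + meanA B ^ 0 * meanB B ^ 2 + 2 * (meanA B ^ 1 * meanB B ^ 1))"
    by (intro has_bochner_integral_add has_bochner_integral_mult_right factorial_product_moment B)
  then show ?thesis by (simp add: pair_count_eq[abs_def] power2_sum mult.assoc)
qed

lemma T_hat_level:
  assumes "good \<omega>"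
  shows "T_hat (K_level J) \<omega> = 2 ^ J * (\<Sum>k<2 ^ J. block_stat (dyadic J k) \<omega>)"
proof -
  have sq: "(indicator (dyadic J k) x)\<^sup>2 = (indicator (dyadic J k) x :: real)" for k x by (simp add: indicator_def)
  have "T_hat (K_level J) (fst \<omega>, snd \<omega>) = 2 ^ J * (\<Sum>k<2 ^ J. ((\<Sum>x\<in>fst \<omega>. indicator (dyadic J k) x) - (\<Sum>x\<in>snd \<omega>. indicator (dyadic J k) x))\<^sup>2
    - ((\<Sum>x\<in>fst \<omega>. (indicator (dyadic J k) x)\<^sup>2) + (\<Sum>x\<in>snd \<omega>. (indicator (dyadic J k) x)\<^sup>2)))"
  proof (rule T_hat_separable)
    fix x y assume "x \<in> fst \<omega> \<union> snd \<omega>" "y \<in> fst \<omega> \<union> snd \<omega>"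
    then have "0 \<le> x" "x < 1" "0 \<le> y" "y < 1" using assms by (auto simp: good_def)
    then show "K_level J x y = 2 ^ J * (\<Sum>k<2 ^ J. indicator (dyadic J k) x * indicator (dyadic J k) y)" by (rule K_level_eq)
  qed (use assms in \<open>auto simp: good_def\<close>)
  also have "\<dots> = 2 ^ J * (\<Sum>k<2 ^ J. block_stat (dyadic J k) \<omega>)"
    unfolding sq block_stat_def countA_def countB_def using assms by (simp only: sum_indicator_card good_def)
  finally show ?thesis by simp
qed

lemma energy_level_good:
  assumes "good \<omega>"
  shows "energy (K_level J) (fst \<omega> \<union> snd \<omega>) = (2 ^ J)\<^sup>2 * (\<Sum>k<2 ^ J. pair_count (dyadic J k) \<omega>)"
proof -
  have c: "real (card ((fst \<omega> \<union> snd \<omega>) \<inter> B)) = real (countA B \<omega>) + real (countB B \<omega>)" for B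
    using assms unfolding countA_def countB_def Int_Un_distrib2 good_def by (subst card_Un_disjoint) auto
  show ?thesis
    using assms by (subst energy_level) (auto simp: good_def pair_count_def c)
qed

text \<open>Up to the factor \<open>2 ^ J\<close> the statistic has mean \<open>ms = n\<^sup>2 H / 2 ^ J\<close>, and the root of the energy is of order
\<open>y = n C / 2 powr (J/2)\<close>. The variance is at most \<open>8 y\<^sup>2 + 8 y ms\<close>, so that the statistic exceeds half of its mean
with high probability once \<open>ms\<close> is a large multiple of \<open>y\<close>. The probability \<open>\<beta>\<close> is shared equally between the
failure of \<open>good\<close>, a large energy and a large deviation of the statistic.\<close>

lemma level_power:
  fixes J :: nat and \<beta> L H :: real
  assumes \<beta>: "0 < \<beta>" "\<beta> < 1" and L: "1 \<le> L"
    and H: "H = 2 ^ J * (\<Sum>k<2 ^ J. (cell_integral h (dyadic J k))\<^sup>2)"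
    and big: "192 / \<beta> * C * 2 powr (real J / 2) * L / n \<le> H"
  shows "\<exists>E \<in> sets P. prob E \<le> \<beta> \<and> (\<forall>\<omega>\<in>space P - E. good \<omega> \<and>
     6 * sqrt (energy (K_level J) (fst \<omega> \<union> snd \<omega>)) * L < T_hat (K_level J) \<omega>)"
proof -
  define s where "s = (2::real) powr (real J / 2)"
  have s2: "s * s = 2 ^ J" unfolding s_def by (simp add: powr_add[symmetric] powr_realpow)
  have s1: "s \<ge> 1" unfolding s_def by (simp add: ge_one_powr_ge_zero)
  define y where "y = n * C / s"
  have y: "y > 0" using n C s1 by (simp add: y_def)
  define ms where "ms = (\<Sum>k<2 ^ J. (meanA (dyadic J k) - meanB (dyadic J k))\<^sup>2)"
  have ms: "ms = n\<^sup>2 * H / 2 ^ J"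
    unfolding ms_def H by (simp add: mean_difference power_mult_distrib flip: sum_distrib_left)
  have msL: "192 / \<beta> * y * L \<le> ms"
  proof -
    have "192 / \<beta> * y * L = n\<^sup>2 * (192 / \<beta> * C * s * L / n) / (s * s)"
      using n s1 by (simp add: y_def power2_eq_square field_simps)
    also have "\<dots> \<le> n\<^sup>2 * H / (s * s)"
      using big s1 unfolding s_def[symmetric] by (intro divide_right_mono mult_left_mono) auto
    finally show ?thesis by (simp add: ms s2)
  qed
  have "192 / \<beta> * y * 1 \<le> 192 / \<beta> * y * L" using L y \<beta> by (intro mult_left_mono) auto
  then have msy: "192 / \<beta> * y \<le> ms" using msL by simp
  have ms_pos: "ms > 0" using msy y \<beta> by (smt (verit) divide_pos_pos mult_pos_pos)
  have ab: "meanA (dyadic J k) + meanB (dyadic J k) \<le> 2 * y / s" if "k < 2 ^ J" for k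
  proof -
    have "y / s = n * C / 2 ^ J" by (simp add: y_def s2[symmetric])
    then show ?thesis using meanA_le[OF that] meanB_le[OF that] by simp
  qed
  have ab0: "0 \<le> meanA (dyadic J k) + meanB (dyadic J k)" for k using mean_nonneg[of "dyadic J k"] by simp
  have ab2: "(meanA (dyadic J k) + meanB (dyadic J k))\<^sup>2 \<le> (2 * y / s)\<^sup>2" if "k < 2 ^ J" for k
    using ab[OF that] ab0 by (intro power_mono)
  have sum_ab2: "(\<Sum>k<2 ^ J. (meanA (dyadic J k) + meanB (dyadic J k))\<^sup>2) \<le> 4 * y\<^sup>2"
  proof -
    have "(\<Sum>k<2 ^ J. (meanA (dyadic J k) + meanB (dyadic J k))\<^sup>2) \<le> (\<Sum>k<(2::nat) ^ J. (2 * y / s)\<^sup>2)"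
      using ab2 by (intro sum_mono) auto
    also have "\<dots> = 2 ^ J * (2 * y / s)\<^sup>2" by simp
    also have "\<dots> = 4 * y\<^sup>2" unfolding s2[symmetric] using s1 by (simp add: power2_eq_square)
    finally show ?thesis .
  qed
  obtain E1 where E1: "E1 \<in> sets P" "prob E1 \<le> \<beta> / 3" "\<And>\<omega>. \<omega> \<in> space P - E1 \<Longrightarrow> good \<omega>"
    using almost_good[of "\<beta> / 3"] \<beta> by auto
  define WW where "WW \<omega> = (\<Sum>k<2 ^ J. pair_count (dyadic J k) \<omega>)" for \<omega>
  have "has_bochner_integral P WW (\<Sum>k<2 ^ J. (meanA (dyadic J k) + meanB (dyadic J k))\<^sup>2)"
    unfolding WW_def[abs_def] using dyadic_in_unit_interval by (intro has_bochner_integral_sum pair_count_mean) auto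
  then have "\<exists>E \<in> sets P. prob E \<le> \<beta> / 3 \<and> (\<forall>\<omega>\<in>space P - E. WW \<omega> < 12 * y\<^sup>2 / \<beta>)"
  proof (rule markov)
    show "(\<Sum>k<2 ^ J. (meanA (dyadic J k) + meanB (dyadic J k))\<^sup>2) \<le> \<beta> / 3 * (12 * y\<^sup>2 / \<beta>)"
      using sum_ab2 \<beta> by simp
  qed (use y \<beta> in \<open>auto simp: WW_def intro!: sum_nonneg pair_count_nonneg\<close>)
  then obtain E2 where E2: "E2 \<in> sets P" "prob E2 \<le> \<beta> / 3" "\<And>\<omega>. \<omega> \<in> space P - E2 \<Longrightarrow> WW \<omega> < 12 * y\<^sup>2 / \<beta>"
    by blast
  define X where "X \<omega> = (\<Sum>k<2 ^ J. block_stat (dyadic J k) \<omega>)" for \<omega>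
  define v where "v = (\<Sum>k<2 ^ J. 2 * (meanA (dyadic J k) + meanB (dyadic J k))\<^sup>2 + 4 * (meanA (dyadic J k) + meanB (dyadic J k)) * (meanA (dyadic J k) - meanB (dyadic J k))\<^sup>2)"
  have v: "v \<le> 8 * y\<^sup>2 + 8 * y * ms"
  proof -
    have "v \<le> (\<Sum>k<2 ^ J. 2 * (meanA (dyadic J k) + meanB (dyadic J k))\<^sup>2 + 4 * (2 * y) * (meanA (dyadic J k) - meanB (dyadic J k))\<^sup>2)"
      unfolding v_def
    proof (intro sum_mono add_mono mult_right_mono mult_left_mono)
      fix k assume "k \<in> {..<(2::nat) ^ J}"
      then have "meanA (dyadic J k) + meanB (dyadic J k) \<le> 2 * y / s" using ab by simp
      also have "\<dots> \<le> 2 * y / 1" using y s1 by (intro divide_left_mono) auto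
      finally show "meanA (dyadic J k) + meanB (dyadic J k) \<le> 2 * y" by simp
    qed auto
    also have "\<dots> = 2 * (\<Sum>k<2 ^ J. (meanA (dyadic J k) + meanB (dyadic J k))\<^sup>2) + 8 * y * ms"
      by (simp add: sum.distrib sum_distrib_left ms_def)
    finally show ?thesis using sum_ab2 by simp
  qed
  have "has_bochner_integral P (\<lambda>\<omega>. (X \<omega> - ms)\<^sup>2) v"
    unfolding X_def ms_def v_def using dyadic_in_unit_interval dyadic_disjoint by (intro block_stat_sum_variance) auto
  then have "\<exists>E \<in> sets P. prob E \<le> \<beta> / 3 \<and> (\<forall>\<omega>\<in>space P - E. (X \<omega> - ms)\<^sup>2 < (ms / 2)\<^sup>2)"
  proof (rule markov)
    have y_le: "y \<le> \<beta> / 192 * ms" using msy \<beta> by (simp add: field_simps)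
    have "8 * y\<^sup>2 + 8 * y * ms = 8 * y * (y + ms)" by (simp add: power2_eq_square algebra_simps)
    also have "\<dots> \<le> 8 * (\<beta> / 192 * ms) * (ms + ms)"
    proof (intro mult_mono add_mono)
      show "y \<le> ms"
      proof -
        have "\<beta> / 192 * ms \<le> 1 * ms" using \<beta> ms_pos by (intro mult_right_mono) auto
        then show ?thesis using y_le by simp
      qed
    qed (use y_le y ms_pos \<beta> in auto)
    also have "\<dots> = \<beta> / 3 * (ms / 2)\<^sup>2" by (simp add: power2_eq_square)
    finally show "v \<le> \<beta> / 3 * (ms / 2)\<^sup>2" using v by simp
  qed (use ms_pos in auto)
  then obtain E3 where E3: "E3 \<in> sets P" "prob E3 \<le> \<beta> / 3" "\<And>\<omega>. \<omega> \<in> space P - E3 \<Longrightarrow> (X \<omega> - ms)\<^sup>2 < (ms / 2)\<^sup>2"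
    by blast
  show ?thesis
  proof (intro bexI conjI ballI)
    show "E1 \<union> E2 \<union> E3 \<in> sets P" using E1 E2 E3 by auto
    have "prob (E1 \<union> E2 \<union> E3) \<le> prob (E1 \<union> E2) + prob E3"
      using E1 E2 E3 by (intro measure_subadditive) (auto simp: emeasure_eq_measure)
    moreover have "prob (E1 \<union> E2) \<le> prob E1 + prob E2"
      using E1 E2 by (intro measure_subadditive) (auto simp: emeasure_eq_measure)
    ultimately show "prob (E1 \<union> E2 \<union> E3) \<le> \<beta>" using E1 E2 E3 by linarith
    fix \<omega> assume \<omega>: "\<omega> \<in> space P - (E1 \<union> E2 \<union> E3)"
    show gd: "good \<omega>" using E1(3) \<omega> by blast
    have "\<bar>X \<omega> - ms\<bar> < ms / 2"
      using E3(3)[of \<omega>] \<omega> ms_pos by (intro power_less_imp_less_base[of "\<bar>X \<omega> - ms\<bar>" 2 "ms / 2"]) auto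
    then have X: "X \<omega> > ms / 2" by linarith
    have WW0: "WW \<omega> \<ge> 0" unfolding WW_def by (intro sum_nonneg pair_count_nonneg)
    have sW: "sqrt (WW \<omega>) \<le> 4 * y / \<beta>"
    proof (rule real_le_lsqrt)
      have "WW \<omega> \<le> 12 * y\<^sup>2 / \<beta>" using E2(3)[of \<omega>] \<omega> by simp
      also have "\<dots> \<le> 16 * y\<^sup>2 / \<beta>\<^sup>2"
      proof -
        have "y\<^sup>2 * \<beta> \<le> y\<^sup>2 * 1" using \<beta> by (intro mult_left_mono) auto
        then have "12 * (y\<^sup>2 * \<beta>) \<le> 16 * y\<^sup>2" using zero_le_power2[of y] by linarith
        then have "12 * (y\<^sup>2 * \<beta>) / \<beta>\<^sup>2 \<le> 16 * y\<^sup>2 / \<beta>\<^sup>2" by (intro divide_right_mono) auto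
        then show ?thesis using \<beta> by (simp add: power2_eq_square)
      qed
      finally show "WW \<omega> \<le> (4 * y / \<beta>)\<^sup>2" by (simp add: power_divide power_mult_distrib)
    qed (use WW0 y \<beta> in auto)
    have "6 * sqrt (WW \<omega>) * L \<le> 6 * (4 * y / \<beta>) * L"
      using sW L by (intro mult_right_mono mult_left_mono) auto
    also have "\<dots> \<le> 96 / \<beta> * y * L"
      using y \<beta> L by (simp add: field_simps)
    also have "\<dots> \<le> ms / 2" using msL by simp
    finally have "6 * sqrt (WW \<omega>) * L < X \<omega>" using X by simp
    then have "2 ^ J * (6 * sqrt (WW \<omega>) * L) < 2 ^ J * X \<omega>" by (intro mult_strict_left_mono) auto
    moreover have "sqrt (energy (K_level J) (fst \<omega> \<union> snd \<omega>)) = 2 ^ J * sqrt (WW \<omega>)"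
      unfolding energy_level_good[OF gd] WW_def by (simp add: real_sqrt_mult)
    ultimately show "6 * sqrt (energy (K_level J) (fst \<omega> \<union> snd \<omega>)) * L < T_hat (K_level J) \<omega>"
      unfolding T_hat_level[OF gd] X_def by (simp add: mult_ac)
  qed
qed

text \<open>For configurations in [0,1), the difference of the sums of \<open>haar l\<close> over the two processes: an unbiased estimator of \<open>n\<close> times the
Haar coefficient of the difference of the intensities.\<close>

definition emp_coeff :: "haar_index \<Rightarrow> real set \<times> real set \<Rightarrow> real" where
  "emp_coeff l \<omega> = haar_coeff (\<lambda>B. real (countA B \<omega>) - real (countB B \<omega>)) l"

text \<open>For configurations in [0,1), the sum of the squares of \<open>haar l\<close> over the points of both processes.\<close>

definition emp_square :: "haar_index \<Rightarrow> real set \<times> real set \<Rightarrow> real" where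
  "emp_square l \<omega> = (case l of Root \<Rightarrow> factorial_product 1 0 (dyadic 0 0) \<omega> + factorial_product 0 1 (dyadic 0 0) \<omega>
     | Node j k \<Rightarrow> 2 ^ j * (factorial_product 1 0 (dyadic j k) \<omega> + factorial_product 0 1 (dyadic j k) \<omega>))"

lemma emp_square_nonneg: "0 \<le> emp_square l \<omega>"
  unfolding emp_square_def factorial_product_def
  by (cases l) (auto intro!: mult_nonneg_nonneg add_nonneg_nonneg falling_nonneg)

lemma sum_haar_squares_good:
  assumes "good \<omega>" "l \<in> levels J"
  shows "(\<Sum>x\<in>fst \<omega>. (haar l x)\<^sup>2) + (\<Sum>x\<in>snd \<omega>. (haar l x)\<^sup>2) = emp_square l \<omega>"
proof -
  have s: "(\<Sum>x\<in>A. (haar l x)\<^sup>2) = (case l of Root \<Rightarrow> real (card (A \<inter> dyadic 0 0)) | Node j k \<Rightarrow> 2 ^ j * real (card (A \<inter> dyadic j k)))"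
    if A: "finite A" "A \<subseteq> {0..<1}" for A
  proof -
    have "(\<Sum>x\<in>A. (haar l x)\<^sup>2) = (\<Sum>x\<in>A. case l of Root \<Rightarrow> indicator (dyadic 0 0) x | Node j k \<Rightarrow> 2 ^ j * indicator (dyadic j k) x)"
      using A by (intro sum.cong refl haar_square[OF assms(2)]) auto
    then show ?thesis using A(1) by (cases l) (simp_all only: haar_index.case sum_distrib_left[symmetric] sum_indicator_card)
  qed
  show ?thesis using assms(1) s[of "fst \<omega>"] s[of "snd \<omega>"]
    by (cases l) (simp_all add: good_def emp_square_def factorial_product_def falling_expand countA_def countB_def distrib_left)
qed

lemma T_hat_single:
  assumes "good \<omega>" "l \<in> levels J"
  shows "T_hat (K_single l) \<omega> = (emp_coeff l \<omega>)\<^sup>2 - emp_square l \<omega>"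
proof -
  have "T_hat (K_single l) (fst \<omega>, snd \<omega>) = 1 * (\<Sum>k\<in>{()}. ((\<Sum>x\<in>fst \<omega>. haar l x) - (\<Sum>x\<in>snd \<omega>. haar l x))\<^sup>2
    - ((\<Sum>x\<in>fst \<omega>. (haar l x)\<^sup>2) + (\<Sum>x\<in>snd \<omega>. (haar l x)\<^sup>2)))"
    using assms(1) by (intro T_hat_separable) (auto simp: good_def K_single_def)
  also have "\<dots> = (emp_coeff l \<omega>)\<^sup>2 - emp_square l \<omega>"
    using assms(1) by (simp add: sum_haar_squares_good[OF assms] sum_haar good_def haar_coeff_diff emp_coeff_def countA_def countB_def)
  finally show ?thesis by simp
qed

lemma energy_single_good:
  assumes "good \<omega>" "l \<in> levels J"
  shows "sqrt (energy (K_single l) (fst \<omega> \<union> snd \<omega>)) \<le> emp_square l \<omega>"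
proof (rule real_le_lsqrt)
  have "(\<Sum>x\<in>fst \<omega> \<union> snd \<omega>. (haar l x)\<^sup>2) = emp_square l \<omega>"
    using sum_haar_squares_good[OF assms] assms(1) by (subst sum.union_disjoint) (auto simp: good_def)
  then show "energy (K_single l) (fst \<omega> \<union> snd \<omega>) \<le> (emp_square l \<omega>)\<^sup>2"
    using energy_single_le[of "fst \<omega> \<union> snd \<omega>" l] assms(1) by (simp add: good_def)
qed (auto simp: emp_square_nonneg energy_nonneg)

lemma emp_square_mean:
  assumes "l \<in> levels J"
  shows "\<exists>u \<le> 2 * n * C. has_bochner_integral P (emp_square l) u"
proof (cases l)
  case Root
  have "has_bochner_integral P (\<lambda>\<omega>. factorial_product 1 0 (dyadic 0 0) \<omega> + factorial_product 0 1 (dyadic 0 0) \<omega>)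
     (meanA (dyadic 0 0) ^ 1 * meanB (dyadic 0 0) ^ 0 + meanA (dyadic 0 0) ^ 0 * meanB (dyadic 0 0) ^ 1)"
    using dyadic_in_unit_interval[of 0 0] by (intro has_bochner_integral_add factorial_product_moment) auto
  then show ?thesis using meanA_le[of 0 0] meanB_le[of 0 0] unfolding Root
    by (intro exI[of _ "meanA (dyadic 0 0) + meanB (dyadic 0 0)"]) (auto simp: emp_square_def[abs_def])
next
  case (Node j k)
  then have k: "k < 2 ^ j" using assms by (simp add: Node_in_levels)
  have "has_bochner_integral P (\<lambda>\<omega>. 2 ^ j * (factorial_product 1 0 (dyadic j k) \<omega> + factorial_product 0 1 (dyadic j k) \<omega>))
     (2 ^ j * (meanA (dyadic j k) ^ 1 * meanB (dyadic j k) ^ 0 + meanA (dyadic j k) ^ 0 * meanB (dyadic j k) ^ 1))"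
    using dyadic_in_unit_interval[OF k] by (intro has_bochner_integral_add has_bochner_integral_mult_right factorial_product_moment) auto
  moreover have "2 ^ j * (meanA (dyadic j k) + meanB (dyadic j k)) \<le> 2 ^ j * (n * C / 2 ^ j + n * C / 2 ^ j)"
    using meanA_le[OF k] meanB_le[OF k] by (intro mult_left_mono add_mono) auto
  ultimately show ?thesis unfolding Node
    by (intro exI[of _ "2 ^ j * (meanA (dyadic j k) + meanB (dyadic j k))"]) (auto simp: emp_square_def[abs_def] mult_ac)
qed

lemma mean_haar_coeff:
  assumes "l \<in> levels J"
  shows "n * inner_nu h (haar l) = haar_coeff (\<lambda>B. meanA B - meanB B) l"
proof (cases l)
  case Root
  then show ?thesis using inner_nu_haar[OF square_integrable_h assms] mean_difference[of 0 0] by (simp add: haar_coeff_def)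
next
  case (Node j k)
  then have k: "k < 2 ^ j" using assms by (simp add: Node_in_levels)
  have "n * inner_nu h (haar l) = 2 powr (real j / 2) *
      (n * cell_integral h (dyadic (Suc j) (2 * k)) - n * cell_integral h (dyadic (Suc j) (2 * k + 1)))"
    unfolding inner_nu_haar[OF square_integrable_h assms] unfolding Node haar_coeff_def haar_index.case by (simp only: algebra_simps)
  then show ?thesis
    unfolding Node haar_coeff_def haar_index.case mean_difference[OF Suc_index_lt(1)[OF k]] mean_difference[OF Suc_index_lt(2)[OF k]] .
qed

text \<open>By convexity of the square, the squared deviation is dominated by a weighted sum \<open>U\<close> of squared deviations of
at most four counts, whose mean is a weighted sum of Poisson variances.\<close>

lemma emp_coeff_deviation:
  assumes "l \<in> levels J"
  shows "\<exists>U. \<exists>u \<le> 8 * n * C. has_bochner_integral P U u \<and> (\<forall>\<omega>. (emp_coeff l \<omega> - n * inner_nu h (haar l))\<^sup>2 \<le> U \<omega>)"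
proof -
  define VV where "VV B \<omega> = (real (countA B \<omega>) - meanA B)\<^sup>2 + (real (countB B \<omega>) - meanB B)\<^sup>2" for B \<omega>
  have VV: "has_bochner_integral P (VV (dyadic i k)) (meanA (dyadic i k) + meanB (dyadic i k))" if "k < 2 ^ i" for i k
    unfolding VV_def[abs_def] using dyadic_in_unit_interval[OF that] by (intro has_bochner_integral_add countA_variance countB_variance) auto
  define s where "s \<omega> B = (real (countA B \<omega>) - real (countB B \<omega>)) - (meanA B - meanB B)" for B \<omega>
  have sq: "(x - y)\<^sup>2 \<le> 2 * x\<^sup>2 + 2 * y\<^sup>2" for x y :: real
    using zero_le_power2[of "x + y"] by (simp add: power2_sum power2_diff)
  have s: "(s \<omega> B)\<^sup>2 \<le> 2 * VV B \<omega>" for \<omega> B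
    using sq[of "real (countA B \<omega>) - meanA B" "real (countB B \<omega>) - meanB B"] by (simp add: s_def VV_def algebra_simps)
  have dev: "emp_coeff l \<omega> - n * inner_nu h (haar l) = haar_coeff (s \<omega>) l" for \<omega>
    unfolding mean_haar_coeff[OF assms] emp_coeff_def haar_coeff_diff s_def ..
  show ?thesis
  proof (cases l)
    case Root
    have "has_bochner_integral P (\<lambda>\<omega>. 2 * VV (dyadic 0 0) \<omega>) (2 * (meanA (dyadic 0 0) + meanB (dyadic 0 0)))"
      by (intro has_bochner_integral_mult_right VV) auto
    moreover have "2 * (meanA (dyadic 0 0) + meanB (dyadic 0 0)) \<le> 8 * n * C"
      using meanA_le[of 0 0] meanB_le[of 0 0] mult_pos_pos[OF n C] by simp
    moreover have "(emp_coeff l \<omega> - n * inner_nu h (haar l))\<^sup>2 \<le> 2 * VV (dyadic 0 0) \<omega>" for \<omega>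
      unfolding dev unfolding Root haar_coeff_def by (simp add: s)
    ultimately show ?thesis by blast
  next
    case (Node j k)
    then have k: "k < 2 ^ j" using assms by (simp add: Node_in_levels)
    note k12 = Suc_index_lt[OF k]
    let ?D1 = "dyadic (Suc j) (2 * k)" and ?D2 = "dyadic (Suc j) (2 * k + 1)"
    have p: "(2 powr (real j / 2))\<^sup>2 = (2::real) ^ j"
      by (simp add: powr_add[symmetric] powr_realpow power2_eq_square)
    have "has_bochner_integral P (\<lambda>\<omega>. 2 ^ j * (4 * (VV ?D1 \<omega> + VV ?D2 \<omega>)))
       (2 ^ j * (4 * ((meanA ?D1 + meanB ?D1) + (meanA ?D2 + meanB ?D2))))"
      by (intro has_bochner_integral_mult_right has_bochner_integral_add VV k12)
    moreover have "2 ^ j * (4 * ((meanA ?D1 + meanB ?D1) + (meanA ?D2 + meanB ?D2))) \<le> 8 * n * C"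
    proof -
      have "2 ^ j * (4 * ((meanA ?D1 + meanB ?D1) + (meanA ?D2 + meanB ?D2))) \<le> 2 ^ j * (4 * (4 * (n * C / 2 ^ Suc j)))"
      proof (intro mult_left_mono)
        have "(meanA ?D1 + meanB ?D1) + (meanA ?D2 + meanB ?D2)
          \<le> (n * C / 2 ^ Suc j + n * C / 2 ^ Suc j) + (n * C / 2 ^ Suc j + n * C / 2 ^ Suc j)"
          by (intro add_mono meanA_le meanB_le k12)
        then show "(meanA ?D1 + meanB ?D1) + (meanA ?D2 + meanB ?D2) \<le> 4 * (n * C / 2 ^ Suc j)" by simp
      qed auto
      also have "\<dots> = 8 * n * C" by simp
      finally show ?thesis .
    qed
    moreover have "(emp_coeff l \<omega> - n * inner_nu h (haar l))\<^sup>2 \<le> 2 ^ j * (4 * (VV ?D1 \<omega> + VV ?D2 \<omega>))" for \<omega>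
    proof -
      have "(emp_coeff l \<omega> - n * inner_nu h (haar l))\<^sup>2 = 2 ^ j * (s \<omega> ?D1 - s \<omega> ?D2)\<^sup>2"
        unfolding dev unfolding Node haar_coeff_def by (simp add: power_mult_distrib p)
      also have "\<dots> \<le> 2 ^ j * (2 * (s \<omega> ?D1)\<^sup>2 + 2 * (s \<omega> ?D2)\<^sup>2)"
        by (intro mult_left_mono sq) simp
      also have "\<dots> \<le> 2 ^ j * (2 * (2 * VV ?D1 \<omega>) + 2 * (2 * VV ?D2 \<omega>))"
        by (intro mult_left_mono add_mono s) simp_all
      also have "\<dots> = 2 ^ j * (4 * (VV ?D1 \<omega> + VV ?D2 \<omega>))" by (simp add: algebra_simps)
      finally show ?thesis .
    qed
    ultimately show ?thesis by blast
  qed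
qed

text \<open>Acceptance implies that the squared empirical coefficient is at most \<open>7 L\<close> times \<open>emp_square\<close>. Markov's
inequality for \<open>emp_square\<close> and Chebyshev's for the coefficient are enough even for intervals so short that they
are expected to contain less than one point.\<close>

lemma coefficient_power:
  assumes \<beta>: "0 < \<beta>" "\<beta> < 1" and L: "1 \<le> L" and l: "l \<in> levels J"
    and big: "144 * C * L / \<beta> \<le> n * (inner_nu h (haar l))\<^sup>2"
  shows "\<exists>E \<in> sets P. prob E \<le> \<beta> \<and> (\<forall>\<omega>\<in>space P - E. good \<omega> \<and>
     6 * sqrt (energy (K_single l) (fst \<omega> \<union> snd \<omega>)) * L < T_hat (K_single l) \<omega>)"
proof -
  have nC: "0 < n * C" using n C by simp
  obtain E1 where E1: "E1 \<in> sets P" "prob E1 \<le> \<beta> / 3" "\<And>\<omega>. \<omega> \<in> space P - E1 \<Longrightarrow> good \<omega>"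
    using almost_good[of "\<beta> / 3"] \<beta> by auto
  obtain u where u: "u \<le> 2 * n * C" "has_bochner_integral P (emp_square l) u" using emp_square_mean[OF l] by blast
  have "\<exists>E \<in> sets P. prob E \<le> \<beta> / 3 \<and> (\<forall>\<omega>\<in>space P - E. emp_square l \<omega> < 6 * n * C / \<beta>)"
    using u(1) \<beta> nC by (intro markov[OF u(2)]) (auto simp: emp_square_nonneg mult_ac)
  then obtain E2 where E2: "E2 \<in> sets P" "prob E2 \<le> \<beta> / 3" "\<And>\<omega>. \<omega> \<in> space P - E2 \<Longrightarrow> emp_square l \<omega> < 6 * n * C / \<beta>"
    by blast
  obtain U u' where U: "u' \<le> 8 * n * C" "has_bochner_integral P U u'"
    "\<And>\<omega>. (emp_coeff l \<omega> - n * inner_nu h (haar l))\<^sup>2 \<le> U \<omega>" using emp_coeff_deviation[OF l] by blast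
  have "0 \<le> U \<omega>" for \<omega> using U(3)[of \<omega>] by (meson order_trans zero_le_power2)
  then have "\<exists>E \<in> sets P. prob E \<le> \<beta> / 3 \<and> (\<forall>\<omega>\<in>space P - E. U \<omega> < 24 * n * C / \<beta>)"
    using U(1) \<beta> nC by (intro markov[OF U(2)]) (auto simp: mult_ac)
  then obtain E3 where E3: "E3 \<in> sets P" "prob E3 \<le> \<beta> / 3" "\<And>\<omega>. \<omega> \<in> space P - E3 \<Longrightarrow> U \<omega> < 24 * n * C / \<beta>"
    by blast
  define q where "q = n * C * L / \<beta>"
  have q: "n * C / \<beta> \<le> q" "q > 0"
  proof -
    have "n * C * 1 / \<beta> \<le> n * C * L / \<beta>" using L nC \<beta> by (intro divide_right_mono mult_left_mono) auto
    then show "n * C / \<beta> \<le> q" by (simp add: q_def)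
    show "q > 0" unfolding q_def using L n C \<beta> by simp
  qed
  define r where "r = sqrt q"
  have r: "r\<^sup>2 = q" "r > 0" using q by (auto simp: r_def)
  show ?thesis
  proof (intro bexI conjI ballI)
    show "E1 \<union> E2 \<union> E3 \<in> sets P" using E1 E2 E3 by auto
    have "prob (E1 \<union> E2 \<union> E3) \<le> prob (E1 \<union> E2) + prob E3"
      using E1 E2 E3 by (intro measure_subadditive) (auto simp: emeasure_eq_measure)
    moreover have "prob (E1 \<union> E2) \<le> prob E1 + prob E2"
      using E1 E2 by (intro measure_subadditive) (auto simp: emeasure_eq_measure)
    ultimately show "prob (E1 \<union> E2 \<union> E3) \<le> \<beta>" using E1 E2 E3 by linarith
    fix \<omega> assume \<omega>: "\<omega> \<in> space P - (E1 \<union> E2 \<union> E3)"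
    show gd: "good \<omega>" using E1(3) \<omega> by blast
    have "emp_square l \<omega> < 6 * (n * C / \<beta>)" using E2(3)[of \<omega>] \<omega> by (simp add: mult.assoc)
    then have Vq: "emp_square l \<omega> * L \<le> 6 * q"
    proof -
      assume "emp_square l \<omega> < 6 * (n * C / \<beta>)"
      then have "emp_square l \<omega> * L \<le> 6 * (n * C / \<beta>) * L" using L by (intro mult_right_mono) auto
      then show ?thesis by (simp add: q_def)
    qed
    have "(emp_coeff l \<omega> - n * inner_nu h (haar l))\<^sup>2 < 24 * (n * C / \<beta>)"
      using U(3)[of \<omega>] E3(3)[of \<omega>] \<omega> by (simp add: mult.assoc)
    also have "\<dots> \<le> (5 * r)\<^sup>2" using q r by (simp add: power_mult_distrib)
    finally have dev: "\<bar>emp_coeff l \<omega> - n * inner_nu h (haar l)\<bar> < 5 * r"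
      using r by (intro power_less_imp_less_base[of "\<bar>emp_coeff l \<omega> - n * inner_nu h (haar l)\<bar>" 2 "5 * r"]) auto
    have "(12 * r)\<^sup>2 \<le> (n * inner_nu h (haar l))\<^sup>2"
    proof -
      have "n * (144 * C * L / \<beta>) \<le> n * (n * (inner_nu h (haar l))\<^sup>2)" using big n by (intro mult_left_mono) auto
      then show ?thesis using r by (simp add: power_mult_distrib q_def power2_eq_square[of n] mult_ac)
    qed
    then have "\<bar>12 * r\<bar> \<le> \<bar>n * inner_nu h (haar l)\<bar>" by (simp only: abs_le_square_iff)
    then have "7 * r \<le> \<bar>emp_coeff l \<omega>\<bar>" using dev by linarith
    then have "(7 * r)\<^sup>2 \<le> \<bar>emp_coeff l \<omega>\<bar>\<^sup>2" using r(2) by (intro power_mono) auto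
    then have "(7 * r)\<^sup>2 \<le> (emp_coeff l \<omega>)\<^sup>2" by (simp only: power2_abs)
    then have S2: "49 * q \<le> (emp_coeff l \<omega>)\<^sup>2" using r by (simp add: power_mult_distrib)
    have "6 * sqrt (energy (K_single l) (fst \<omega> \<union> snd \<omega>)) * L \<le> 6 * emp_square l \<omega> * L"
      using energy_single_good[OF gd l] L by (intro mult_right_mono mult_left_mono) auto
    moreover have "emp_square l \<omega> * 1 \<le> emp_square l \<omega> * L" using emp_square_nonneg L by (intro mult_left_mono)
    ultimately show "6 * sqrt (energy (K_single l) (fst \<omega> \<union> snd \<omega>)) * L < T_hat (K_single l) \<omega>"
      unfolding T_hat_single[OF gd l] using S2 Vq q by linarith
  qed
qed

text \<open>The acceptance region is enclosed in a measurable event of small probability; monotonicity of \<open>emeasure\<close> asks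
measurability of the larger set alone.\<close>

lemma Phi1_power:
  assumes \<beta>: "0 < \<beta>" "\<beta> < 1" and t: "0 < t" "t < 1" and J: "J \<le> Jbar"
    and big: "192 / \<beta> * C * 2 powr (real J / 2) * (w_level J + ln (1 / t) + 1) / n
      \<le> 2 ^ J * (\<Sum>k<2 ^ J. (cell_integral h (dyadic J k))\<^sup>2)"
    and \<Phi>: "\<And>\<omega>. \<Phi> \<omega> = 0 \<Longrightarrow> Phi1 Jbar t \<omega> = 0"
  shows "emeasure P {\<omega> \<in> space P. \<Phi> \<omega> = (0::nat)} \<le> ennreal \<beta>"
proof -
  define L where "L = w_level J + ln (1 / t) + 1"
  have "exp (- w_level J) \<le> 1" using w_level_sum[of "{J}"] by simp
  then have L: "1 \<le> L" using t by (simp add: L_def)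
  obtain E where E: "E \<in> sets P" "prob E \<le> \<beta>" "\<And>\<omega>. \<omega> \<in> space P - E \<Longrightarrow> good \<omega> \<and>
     6 * sqrt (energy (K_level J) (fst \<omega> \<union> snd \<omega>)) * L < T_hat (K_level J) \<omega>"
    using level_power[OF \<beta> L refl big[folded L_def]] by blast
  have "{\<omega> \<in> space P. \<Phi> \<omega> = 0} \<subseteq> E"
  proof safe
    fix A B assume AB: "(A, B) \<in> space P" "\<Phi> (A, B) = 0"
    show "(A, B) \<in> E"
    proof (rule ccontr)
      assume "(A, B) \<notin> E"
      then have gd: "good (A, B)" and gt: "6 * sqrt (energy (K_level J) (A \<union> B)) * L < T_hat (K_level J) (A, B)"
        using E(3)[of "(A, B)"] AB by auto
      have "aggregated_test {0..Jbar} K_level w_level t (A, B) = 0" using \<Phi>[OF AB(2)] by (simp add: Phi1_def)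
      then have "T_hat (K_level J) (A, B) \<le> 6 * sqrt (energy (K_level J) (A \<union> B)) * (w_level J + ln (1 / t) + 1)"
        using gd t J by (intro aggregated_test_accepts[OF w_level_sum]) (auto simp: good_def symmetric_K_level)
      then show False using gt by (simp add: L_def)
    qed
  qed
  then have "emeasure P {\<omega> \<in> space P. \<Phi> \<omega> = 0} \<le> emeasure P E" using E(1) by (rule emeasure_mono)
  also have "\<dots> \<le> ennreal \<beta>" using E(2) by (simp add: emeasure_eq_measure ennreal_leI)
  finally show ?thesis .
qed

lemma Phi2_power:
  assumes \<beta>: "0 < \<beta>" "\<beta> < 1" and t: "0 < t" "t < 1" and l: "l \<in> levels J"
    and big: "144 * C * (w_single l + ln (1 / t) + 1) / \<beta> \<le> n * (inner_nu h (haar l))\<^sup>2"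
    and \<Phi>: "\<And>\<omega>. \<Phi> \<omega> = 0 \<Longrightarrow> Phi2 \<infinity> t \<omega> = 0"
  shows "emeasure P {\<omega> \<in> space P. \<Phi> \<omega> = (0::nat)} \<le> ennreal \<beta>"
proof -
  define L where "L = w_single l + ln (1 / t) + 1"
  have lI: "l \<in> {Root} \<union> Lam \<infinity>" using l by (auto simp: levels_def Lam_def)
  have "exp (- w_single l) \<le> 1" using w_single_sum[of "{l}"] lI by simp
  then have L: "1 \<le> L" using t by (simp add: L_def)
  obtain E where E: "E \<in> sets P" "prob E \<le> \<beta>" "\<And>\<omega>. \<omega> \<in> space P - E \<Longrightarrow> good \<omega> \<and>
     6 * sqrt (energy (K_single l) (fst \<omega> \<union> snd \<omega>)) * L < T_hat (K_single l) \<omega>"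
    using coefficient_power[OF \<beta> L l big[folded L_def]] by blast
  have "{\<omega> \<in> space P. \<Phi> \<omega> = 0} \<subseteq> E"
  proof safe
    fix A B assume AB: "(A, B) \<in> space P" "\<Phi> (A, B) = 0"
    show "(A, B) \<in> E"
    proof (rule ccontr)
      assume "(A, B) \<notin> E"
      then have gd: "good (A, B)" and gt: "6 * sqrt (energy (K_single l) (A \<union> B)) * L < T_hat (K_single l) (A, B)"
        using E(3)[of "(A, B)"] AB by auto
      have "aggregated_test ({Root} \<union> Lam \<infinity>) K_single w_single t (A, B) = 0" using \<Phi>[OF AB(2)] by (simp add: Phi2_def)
      then have "T_hat (K_single l) (A, B) \<le> 6 * sqrt (energy (K_single l) (A \<union> B)) * (w_single l + ln (1 / t) + 1)"
        using gd t lI by (intro aggregated_test_accepts[OF w_single_sum]) (auto simp: good_def symmetric_K_single)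
      then show False using gt by (simp add: L_def)
    qed
  qed
  then have "emeasure P {\<omega> \<in> space P. \<Phi> \<omega> = 0} \<le> emeasure P E" using E(1) by (rule emeasure_mono)
  also have "\<dots> \<le> ennreal \<beta>" using E(2) by (simp add: emeasure_eq_measure ennreal_leI)
  finally show ?thesis .
qed

end

section \<open>Separation rates\<close>

lemma separation_rate_le:
  assumes "\<rho> > 0"
    and "\<And>f g. (f, g) \<in> S \<Longrightarrow> L2norm (\<lambda>x. f x - g x) > \<rho> \<Longrightarrow>
      emeasure (P f g) {\<omega> \<in> space (P f g). \<Phi> \<omega> = 0} \<le> ennreal \<beta>"
  shows "separation_rate P \<Phi> S \<beta> \<le> ennreal \<rho>"
  unfolding separation_rate_def
  by (rule INF_lower) (use assms in \<open>auto intro!: SUP_least\<close>)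

lemma le_supnorm:
  assumes "intensity f" "supnorm f \<le> R" "x \<in> {0..1}"
  shows "f x \<le> R"
proof -
  have "bdd_above ((\<lambda>x. \<bar>f x\<bar>) ` {0..1})"
  proof -
    obtain c where "\<forall>y\<in>f ` {0..1}. norm y \<le> c" using assms(1) by (auto simp: intensity_def bounded_iff)
    then show ?thesis by (intro bdd_aboveI2[of _ _ c]) simp
  qed
  then have "\<bar>f x\<bar> \<le> supnorm f" unfolding supnorm_def using assms(3) by (intro cSUP_upper)
  then show ?thesis using assms(2) by simp
qed

lemma bounded_poisson_pair_besov_class:
  assumes "(f, g) \<in> besov_class \<delta> \<gamma> R R' R''" "n > 0" "R'' > 0" "joint_poisson_law n f g P"
  shows "bounded_poisson_pair n f g P R''"
  using assms le_supnorm[of f R''] le_supnorm[of g R'']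
  by unfold_locales (auto simp: besov_class_def)

lemma Psi_test_zero:
  assumes "Psi_test Jbar Jt \<alpha> \<omega> = 0"
  shows "Phi1 Jbar (\<alpha> / 2) \<omega> = 0" "Phi2 Jt (\<alpha> / 2) \<omega> = 0"
  using assms by (auto simp: Psi_test_def)

lemma large_sample:
  fixes n :: real
  assumes "n > 1" "ln (ln n) \<ge> 1"
  shows "1 \<le> ln n" "ln (ln n) \<le> ln n" "ln n \<le> n"
proof -
  have "ln n > 0" using assms(1) by simp
  then have "exp 1 \<le> ln n" using assms(2) by (simp add: ln_ge_iff)
  moreover have "(1::real) \<le> exp 1" by simp
  ultimately show 1: "1 \<le> ln n" by linarith
  show "ln (ln n) \<le> ln n" using ln_le_minus_one[of "ln n"] 1 by linarith
  show "ln n \<le> n" using ln_le_minus_one[of n] assms by linarith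
qed

text \<open>The coefficients in the class are inner products, which allows combining this with the weak condition.\<close>

lemma besov_class_haar:
  assumes "(f, g) \<in> besov_class \<delta> \<gamma> R R' R''" "\<delta> > 0"
  shows "(L2norm (\<lambda>x. f x - g x))\<^sup>2 \<le> (\<Sum>l\<in>levels J. (inner_nu (\<lambda>x. f x - g x) (haar l))\<^sup>2)
     + R\<^sup>2 * 2 powr (- 2 * real J * \<delta>) / (1 - 2 powr (- 2 * \<delta>))"
proof -
  obtain c where c: "has_haar_expansion (\<lambda>x. f x - g x) c"
    "\<And>j. (\<Sum>k<2 ^ j. (c (Node j k))\<^sup>2) \<le> R\<^sup>2 * 2 powr (- 2 * real j * \<delta>)"
    using assms(1) by (auto simp: besov_class_def besov_def)
  have "(\<Sum>l\<in>levels J. (c l)\<^sup>2) = (\<Sum>l\<in>levels J. (inner_nu (\<lambda>x. f x - g x) (haar l))\<^sup>2)"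
    using haar_expansion_coeff[OF c(1)] by (intro sum.cong) auto
  then show ?thesis using besov_tail[OF c(1) assms(2) c(2), of J] by simp
qed

lemma weak_besov_class_haar:
  assumes "(f, g) \<in> besov_class \<delta> \<gamma> R R' R''" and t: "t > 0"
    and small: "\<And>l. l \<in> levels J \<Longrightarrow> (inner_nu (\<lambda>x. f x - g x) (haar l))\<^sup>2 \<le> t"
  shows "(\<Sum>l\<in>levels J. (inner_nu (\<lambda>x. f x - g x) (haar l))\<^sup>2) \<le> R'\<^sup>2 * t powr (2 * \<gamma> / (1 + 2 * \<gamma>))"
proof -
  obtain c where c: "has_haar_expansion (\<lambda>x. f x - g x) c"
    "ennreal ((c Root)\<^sup>2 * of_bool ((c Root)\<^sup>2 \<le> t)) +
        (\<Sum>j. \<Sum>k<2 ^ j. ennreal ((c (Node j k))\<^sup>2 * of_bool ((c (Node j k))\<^sup>2 \<le> t)))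
      \<le> ennreal (R'\<^sup>2 * t powr (2 * \<gamma> / (1 + 2 * \<gamma>)))"
    using assms(1) t by (auto simp: besov_class_def weak_besov_def)
  define F where "F l = ennreal ((c l)\<^sup>2 * of_bool ((c l)\<^sup>2 \<le> t))" for l
  have coeff: "inner_nu (\<lambda>x. f x - g x) (haar l) = c l" if "l \<in> levels J" for l
    using haar_expansion_coeff[OF c(1) that] by simp
  have "ennreal (\<Sum>l\<in>levels J. (inner_nu (\<lambda>x. f x - g x) (haar l))\<^sup>2) = (\<Sum>l\<in>levels J. F l)"
    unfolding F_def using small by (subst sum_ennreal[symmetric]) (auto simp: coeff intro!: sum.cong)
  also have "\<dots> = F Root + (\<Sum>j<J. \<Sum>k<2 ^ j. F (Node j k))" by (rule sum_levels)
  also have "\<dots> \<le> F Root + (\<Sum>j. \<Sum>k<2 ^ j. F (Node j k))"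
    by (intro add_left_mono sum_le_suminf) auto
  also have "\<dots> \<le> ennreal (R'\<^sup>2 * t powr (2 * \<gamma> / (1 + 2 * \<gamma>)))" using c(2) by (simp add: F_def)
  finally show ?thesis by (subst (asm) ennreal_le_iff) auto
qed

text \<open>For \<open>2 ^ J \<le> n\<^sup>2\<close> the level \<open>J\<close> is of order \<open>ln n\<close> and its weight of order \<open>ln (ln n)\<close>.\<close>

lemma w_level_bound:
  fixes n :: real
  assumes n: "n > 1" "ln (ln n) \<ge> 1" and J: "2 ^ J \<le> n\<^sup>2" and t: "0 < t" "t < 1"
  shows "w_level J + ln (1 / t) + 1 \<le> (2 * ln 4 + 2 * ln (pi / sqrt 6) + ln (1 / t) + 3) * ln (ln n)"
proof -
  note ls = large_sample[OF n]
  have "real J * ln 2 = ln (2 ^ J)" by (simp add: ln_realpow)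
  also have "\<dots> \<le> ln (n\<^sup>2)" using J n by (subst ln_le_cancel_iff) auto
  also have "\<dots> = 2 * ln n" using n by (simp add: ln_realpow)
  finally have "real J * ln 2 \<le> 2 * ln n" .
  moreover have "2 / 3 \<le> ln (2::real)" using ln2_ge_two_thirds by simp
  then have "real J * (2 / 3) \<le> real J * ln 2" by (intro mult_left_mono) auto
  ultimately have "real J + 1 \<le> 4 * ln n" using ls by linarith
  then have "ln (real J + 1) \<le> ln (4 * ln n)" using ls(1) by (intro iffD2[OF ln_le_cancel_iff]) linarith+
  also have "\<dots> = ln 4 + ln (ln n)" using ls n(1) by (simp add: ln_mult)
  finally have J1: "ln (real J + 1) \<le> ln 4 + ln (ln n)" .
  define A where "A = 2 * ln 4 + 2 * ln (pi / sqrt 6) + ln (1 / t) + 1"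
  have "sqrt 6 \<le> 3" by (rule real_le_lsqrt) (auto simp: power2_eq_square)
  then have "1 \<le> pi / sqrt 6" using pi_gt3 by simp
  then have "A \<ge> 0" using t unfolding A_def by (intro add_nonneg_nonneg mult_nonneg_nonneg) auto
  then have "A * 1 \<le> A * ln (ln n)" using n by (intro mult_left_mono) auto
  then have "w_level J + ln (1 / t) + 1 \<le> (A + 2) * ln (ln n)"
    using J1 unfolding w_level_def by (simp add: A_def algebra_simps)
  then show ?thesis by (simp add: A_def add_ac)
qed

lemma w_single_bound:
  assumes l: "l \<in> levels J"
  shows "w_single l \<le> 3 * real J + 2 * ln (pi / sqrt 3) + ln 2"
proof -
  have "sqrt 3 \<le> 3" by (rule real_le_lsqrt) (auto simp: power2_eq_square)
  then have "1 \<le> pi / sqrt 3" using pi_gt3 by simp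
  then have c: "0 \<le> ln (pi / sqrt 3)" by simp
  show ?thesis
  proof (cases l)
    case Root
    then show ?thesis using c by simp
  next
    case (Node j k)
    then have j: "real j \<le> real J" using l by (simp add: Node_in_levels)
    have "real j * ln 2 \<le> real j * 1" using ln_2_less_1 by (intro mult_left_mono) auto
    moreover have "ln (real j + 1) \<le> real j" using ln_add_one_self_le_self[of "real j"] by (simp add: add.commute)
    moreover have "0 \<le> ln (2::real)" by simp
    moreover have "ln ((2::real) ^ j) = real j * ln 2" by (simp add: ln_realpow)
    ultimately show ?thesis unfolding Node w_single.simps distrib_left using j c by linarith
  qed
qed

lemma dyadic_level:
  fixes z :: real
  assumes "z \<ge> 1"
  shows "\<exists>J. 2 ^ J \<le> z \<and> z < 2 * 2 ^ J"
proof (intro exI conjI)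
  let ?J = "nat \<lfloor>log 2 z\<rfloor>"
  have nn: "0 \<le> log 2 z" using assms by simp
  have J: "real ?J \<le> log 2 z" "log 2 z < real ?J + 1" using nn by linarith+
  have "(2::real) ^ ?J = 2 powr real ?J" by (simp add: powr_realpow)
  also have "\<dots> \<le> 2 powr (log 2 z)" using J by simp
  also have "\<dots> = z" using assms by simp
  finally show "2 ^ ?J \<le> z" .
  have "z = 2 powr (log 2 z)" using assms by simp
  also have "\<dots> < 2 powr (real ?J + 1)" using J by simp
  also have "\<dots> = 2 * 2 ^ ?J" by (simp add: powr_add powr_realpow)
  finally show "z < 2 * 2 ^ ?J" .
qed

text \<open>With \<open>x = n / ln (ln n)\<close>, the level satisfies \<open>2 ^ J \<approx> x powr (2 / (4 \<delta> + 1))\<close>. This is the solution of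
\<open>2 powr (J/2) / x = 2 powr (- 2 J \<delta>)\<close>, where detection threshold and squared bias are equal. The exponent is less
than 2, so that the condition \<open>2 ^ Jbar \<ge> n\<^sup>2\<close> makes this level available for each \<open>\<delta>\<close>.\<close>

lemma separation_rate_levels:
  fixes \<alpha> \<beta> \<delta> \<gamma> R R' R'' :: real
  assumes \<alpha>: "0 < \<alpha>" "\<alpha> < 1" and \<beta>: "0 < \<beta>" "\<beta> < 1" and \<delta>: "\<delta> > 0" and R: "R > 0" "R'' > 0"
  shows "\<exists>C::real. C > 0 \<and>
    (\<forall>(n::real) (Jbar::nat) (Jt::enat)
       (P :: (real \<Rightarrow> real) \<Rightarrow> (real \<Rightarrow> real) \<Rightarrow> (real set \<times> real set) measure).
       n > 1 \<and> ln (ln n) \<ge> 1 \<and> 2 ^ Jbar \<ge> n\<^sup>2 \<and>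
       (\<forall>f g. intensity f \<and> intensity g \<longrightarrow> joint_poisson_law n f g (P f g)) \<longrightarrow>
       separation_rate P (Psi_test Jbar Jt \<alpha>) (besov_class \<delta> \<gamma> R R' R'') \<beta>
            \<le> ennreal (C * (ln (ln n) / n) powr (2 * \<delta> / (4 * \<delta> + 1))))"
proof -
  define t where "t = \<alpha> / 2"
  have t: "0 < t" "t < 1" using \<alpha> by (auto simp: t_def)
  define A where "A = 2 * ln 4 + 2 * ln (pi / sqrt 6) + ln (1 / t) + 3"
  define \<kappa> where "\<kappa> = 192 / \<beta> * R'' * A"
  define G where "G = R\<^sup>2 * 2 powr (2 * \<delta>) / (1 - 2 powr (- 2 * \<delta>))"
  have q: "2 powr (- 2 * \<delta>) < (1::real)" using \<delta> by (simp add: powr_less_one)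
  have "sqrt 6 \<le> 3" by (rule real_le_lsqrt) (auto simp: power2_eq_square)
  then have "1 \<le> pi / sqrt 6" using pi_gt3 by simp
  then have A: "A > 0" using t unfolding A_def by (intro add_nonneg_pos add_nonneg_nonneg mult_nonneg_nonneg) auto
  have \<kappa>: "\<kappa> > 0" using \<beta> R A by (simp add: \<kappa>_def)
  have G: "G > 0" using R q by (simp add: G_def)
  define C where "C = sqrt (\<kappa> + G)"
  have Cp: "C > 0" "C\<^sup>2 = \<kappa> + G" using \<kappa> G by (auto simp: C_def)
  show ?thesis
  proof (intro exI[of _ C] conjI allI impI Cp(1), elim conjE)
    fix n :: real and Jbar :: nat and Jt :: enat
      and P :: "(real \<Rightarrow> real) \<Rightarrow> (real \<Rightarrow> real) \<Rightarrow> (real set \<times> real set) measure"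
    assume n: "n > 1" "ln (ln n) \<ge> 1" and Jbar: "2 ^ Jbar \<ge> n\<^sup>2"
      and P: "\<forall>f g. intensity f \<and> intensity g \<longrightarrow> joint_poisson_law n f g (P f g)"
    note ls = large_sample[OF n] and n_large = n
    define ell where "ell = ln (ln n)"
    have ell: "1 \<le> ell" "ell \<le> n" unfolding ell_def using n ls by linarith+
    define x where "x = n / ell"
    have x: "1 \<le> x" "x \<le> n" "x > 0"
    proof -
      show "1 \<le> x" using ell by (simp add: x_def)
      then show "x > 0" by simp
      have "n * 1 \<le> n * ell" using ell n by (intro mult_left_mono) auto
      then show "x \<le> n" using ell by (simp add: x_def field_simps)
    qed
    have inv: "(ell / n) powr e = x powr (- e)" for e
      using ell n by (simp add: x_def powr_minus powr_divide)
    define r where "r = (ell / n) powr (2 * \<delta> / (4 * \<delta> + 1))"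
    have r: "r > 0" using ell n by (simp add: r_def)
    have r2: "r\<^sup>2 = x powr (- (4 * \<delta> / (4 * \<delta> + 1)))"
      unfolding r_def inv power2_eq_square powr_add[symmetric] by (simp add: field_simps)
    define z where "z = x powr (2 / (4 * \<delta> + 1))"
    have z: "z \<ge> 1" "z > 0" using x \<delta> by (auto simp: z_def ge_one_powr_ge_zero)
    obtain J where J: "2 ^ J \<le> z" "z < 2 * 2 ^ J" using dyadic_level[OF z(1)] by blast
    have "z \<le> x powr 2" unfolding z_def using x \<delta> by (intro powr_mono) (auto simp: field_simps)
    also have "\<dots> \<le> n powr 2" using x \<delta> by (intro powr_mono2) auto
    also have "\<dots> = n\<^sup>2" using n by simp
    finally have zn: "z \<le> n\<^sup>2" .
    have Jn: "2 ^ J \<le> n\<^sup>2" using J zn by linarith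
    have "(2::real) ^ J \<le> 2 ^ Jbar" using Jn Jbar by linarith
    then have JJ: "J \<le> Jbar" by simp
    have s1: "2 powr (real J / 2) * ell / n \<le> r\<^sup>2"
    proof -
      have "2 powr (real J / 2) = (2 ^ J) powr (1 / 2)" by (simp add: powr_realpow[symmetric] powr_powr mult_ac)
      also have "\<dots> \<le> z powr (1 / 2)" using J by (intro powr_mono2) auto
      also have "\<dots> = x powr (1 / (4 * \<delta> + 1))"
      proof -
        have "2 / (4 * \<delta> + 1) * (1 / 2) = 1 / (4 * \<delta> + 1)" using \<delta> by (simp add: divide_simps)
        then show ?thesis by (simp only: z_def powr_powr)
      qed
      finally have "2 powr (real J / 2) * x powr (- 1) \<le> x powr (1 / (4 * \<delta> + 1)) * x powr (- 1)"
        by (intro mult_right_mono) auto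
      also have "\<dots> = r\<^sup>2" unfolding r2 powr_add[symmetric] using \<delta> by (simp add: field_simps)
      also have "x powr (- 1) = ell / n" using inv[of 1] ell n by simp
      finally show ?thesis by simp
    qed
    have s2: "2 powr (- 2 * real J * \<delta>) \<le> 2 powr (2 * \<delta>) * r\<^sup>2"
    proof -
      have "2 powr (- 2 * real J * \<delta>) = (2 ^ J) powr (- 2 * \<delta>)" by (simp add: powr_realpow[symmetric] powr_powr mult_ac)
      also have "\<dots> \<le> (z / 2) powr (- 2 * \<delta>)" using J z \<delta> by (intro powr_mono2') auto
      also have "\<dots> = 2 powr (2 * \<delta>) * z powr (- 2 * \<delta>)"
        using z by (simp add: powr_divide powr_minus field_simps)
      also have "z powr (- 2 * \<delta>) = r\<^sup>2" unfolding r2 z_def powr_powr by (simp add: field_simps)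
      finally show ?thesis .
    qed
    show "separation_rate P (Psi_test Jbar Jt \<alpha>) (besov_class \<delta> \<gamma> R R' R'') \<beta>
            \<le> ennreal (C * (ln (ln n) / n) powr (2 * \<delta> / (4 * \<delta> + 1)))"
      unfolding ell_def[symmetric] r_def[symmetric]
    proof (rule separation_rate_le)
      show "C * r > 0" using Cp r by simp
      fix f g assume fg: "(f, g) \<in> besov_class \<delta> \<gamma> R R' R''" and far: "L2norm (\<lambda>x. f x - g x) > C * r"
      have "intensity f" "intensity g" using fg by (auto simp: besov_class_def)
      then interpret bounded_poisson_pair n f g "P f g" R''
        using fg n R P by (intro bounded_poisson_pair_besov_class) auto
      define H where "H = 2 ^ J * (\<Sum>k<2 ^ J. (cell_integral h (dyadic J k))\<^sup>2)"
      have "(C * r)\<^sup>2 < (L2norm h)\<^sup>2" using far Cp r by (intro power_strict_mono) auto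
      also have "\<dots> \<le> H + R\<^sup>2 * 2 powr (- 2 * real J * \<delta>) / (1 - 2 powr (- 2 * \<delta>))"
        using besov_class_haar[OF fg \<delta>, of J] unfolding haar_energy[OF square_integrable_h] H_def .
      also have "\<dots> \<le> H + R\<^sup>2 * (2 powr (2 * \<delta>) * r\<^sup>2) / (1 - 2 powr (- 2 * \<delta>))"
        using s2 q by (intro add_left_mono divide_right_mono mult_left_mono) auto
      also have "\<dots> = H + G * r\<^sup>2" by (simp add: G_def)
      finally have H: "\<kappa> * r\<^sup>2 < H" using Cp(2) by (simp add: power_mult_distrib algebra_simps)
      have "192 / \<beta> * R'' * 2 powr (real J / 2) * (w_level J + ln (1 / t) + 1) / n
         \<le> 192 / \<beta> * R'' * 2 powr (real J / 2) * (A * ell) / n"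
        unfolding A_def ell_def using \<beta> R n
        by (intro divide_right_mono mult_left_mono w_level_bound n_large Jn t mult_nonneg_nonneg) auto
      also have "\<dots> = \<kappa> * (2 powr (real J / 2) * ell / n)" by (simp add: \<kappa>_def)
      also have "\<dots> \<le> \<kappa> * r\<^sup>2" using s1 \<kappa> by (intro mult_left_mono) auto
      also have "\<dots> \<le> H" using H by simp
      finally show "emeasure (P f g) {\<omega> \<in> space (P f g). Psi_test Jbar Jt \<alpha> \<omega> = 0} \<le> ennreal \<beta>"
        unfolding H_def by (intro Phi1_power[OF \<beta> t JJ]) (auto simp: t_def dest: Psi_test_zero)
    qed
  qed
qed

text \<open>The bound \<open>J\<close> on the levels satisfies \<open>2 powr (- 2 J \<delta>) \<le> 1 / n\<close>, so that the squared norm of the finer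
part of the difference is at most of order \<open>1 / n\<close>. Weights up to that level are of order \<open>ln n\<close>, and coefficients
whose squares exceed \<open>\<kappa> ln n / n\<close> are detected.\<close>

lemma separation_rate_coefficients:
  fixes \<alpha> \<beta> \<delta> \<gamma> R R' R'' :: real
  assumes \<alpha>: "0 < \<alpha>" "\<alpha> < 1" and \<beta>: "0 < \<beta>" "\<beta> < 1" and \<delta>: "\<delta> > 0" and \<gamma>: "\<gamma> > 0"
    and R: "R > 0" "R'' > 0"
  shows "\<exists>C::real. C > 0 \<and>
    (\<forall>(n::real) (Jbar::nat)
       (P :: (real \<Rightarrow> real) \<Rightarrow> (real \<Rightarrow> real) \<Rightarrow> (real set \<times> real set) measure).
       n > 1 \<and> ln (ln n) \<ge> 1 \<and>
       (\<forall>f g. intensity f \<and> intensity g \<longrightarrow> joint_poisson_law n f g (P f g)) \<longrightarrow>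
       separation_rate P (Psi_test Jbar \<infinity> \<alpha>) (besov_class \<delta> \<gamma> R R' R'') \<beta>
            \<le> ennreal (C * (ln n / n) powr (\<gamma> / (2 * \<gamma> + 1))))"
proof -
  define t where "t = \<alpha> / 2"
  have t: "0 < t" "t < 1" using \<alpha> by (auto simp: t_def)
  define c0 where "c0 = 2 * ln (pi / sqrt 3) + ln 2 + ln (1 / t) + 1"
  have "sqrt 3 \<le> 3" by (rule real_le_lsqrt) (auto simp: power2_eq_square)
  then have "1 \<le> pi / sqrt 3" using pi_gt3 by simp
  then have c0: "c0 > 0" using t unfolding c0_def by (intro add_nonneg_pos add_nonneg_nonneg mult_nonneg_nonneg) auto
  define A where "A = 3 / (2 * \<delta> * ln 2) + 3 + c0"
  have A: "A > 0" using c0 \<delta> by (auto simp: A_def intro!: add_nonneg_pos)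
  define \<theta> where "\<theta> = 2 * \<gamma> / (1 + 2 * \<gamma>)"
  have \<theta>: "0 < \<theta>" "\<theta> \<le> 1" using \<gamma> by (auto simp: \<theta>_def)
  define \<kappa> where "\<kappa> = 144 * R'' * A / \<beta>"
  have \<kappa>: "\<kappa> > 0" using R A \<beta> by (simp add: \<kappa>_def)
  define G where "G = R\<^sup>2 / (1 - 2 powr (- 2 * \<delta>))"
  have q: "2 powr (- 2 * \<delta>) < (1::real)" using \<delta> by (simp add: powr_less_one)
  have G: "G > 0" using R q by (simp add: G_def)
  define C where "C = sqrt (R'\<^sup>2 * \<kappa> powr \<theta> + G)"
  have Cp: "C > 0" "C\<^sup>2 = R'\<^sup>2 * \<kappa> powr \<theta> + G" using G by (auto simp: C_def add_nonneg_pos add_nonneg_nonneg)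
  show ?thesis
  proof (intro exI[of _ C] conjI allI impI Cp(1), elim conjE)
    fix n :: real and Jbar :: nat
      and P :: "(real \<Rightarrow> real) \<Rightarrow> (real \<Rightarrow> real) \<Rightarrow> (real set \<times> real set) measure"
    assume n: "n > 1" "ln (ln n) \<ge> 1"
      and P: "\<forall>f g. intensity f \<and> intensity g \<longrightarrow> joint_poisson_law n f g (P f g)"
    note ls = large_sample[OF n]
    define x where "x = ln n / n"
    have x: "0 < x" "x \<le> 1" using n ls by (auto simp: x_def)
    define r where "r = x powr (\<gamma> / (2 * \<gamma> + 1))"
    have r: "r > 0" using x by (simp add: r_def)
    have r2: "r\<^sup>2 = x powr \<theta>" unfolding r_def \<theta>_def power2_eq_square powr_add[symmetric] by (simp add: field_simps)
    define y where "y = ln n / (2 * \<delta> * ln 2)"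
    have y: "y \<ge> 0" using ls \<delta> by (simp add: y_def)
    define J where "J = nat \<lceil>y\<rceil>"
    have J: "y \<le> real J" "real J \<le> y + 1" unfolding J_def using y by linarith+
    have "2 powr (- 2 * real J * \<delta>) \<le> 2 powr (- (2 * \<delta> * y))"
      using J \<delta> by (intro powr_mono) auto
    also have "2 powr (- (2 * \<delta> * y)) = 1 / n"
    proof -
      have "2 * \<delta> * y * ln 2 = ln n" using \<delta> by (simp add: y_def)
      then show ?thesis using n by (simp add: powr_def exp_minus field_simps)
    qed
    also have "\<dots> \<le> x" unfolding x_def using n(1) ls(1) by (intro divide_right_mono) linarith+
    also have "\<dots> = x powr 1" using x by simp
    also have "\<dots> \<le> x powr \<theta>" using x \<theta> by (intro powr_mono') auto
    finally have tail: "2 powr (- 2 * real J * \<delta>) \<le> r\<^sup>2" by (simp add: r2)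
    have weight: "w_single l + ln (1 / t) + 1 \<le> A * ln n" if "l \<in> levels J" for l
    proof -
      have "w_single l + ln (1 / t) + 1 \<le> 3 * (y + 1) + c0"
        using w_single_bound[OF that] J by (simp add: c0_def)
      also have "\<dots> = 3 / (2 * \<delta> * ln 2) * ln n + (3 + c0) * 1" by (simp add: y_def)
      also have "\<dots> \<le> 3 / (2 * \<delta> * ln 2) * ln n + (3 + c0) * ln n"
        using c0 ls by (intro add_left_mono mult_left_mono) auto
      also have "\<dots> = A * ln n" by (simp add: A_def algebra_simps)
      finally show ?thesis .
    qed
    show "separation_rate P (Psi_test Jbar \<infinity> \<alpha>) (besov_class \<delta> \<gamma> R R' R'') \<beta>
            \<le> ennreal (C * (ln n / n) powr (\<gamma> / (2 * \<gamma> + 1)))"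
      unfolding x_def[symmetric] r_def[symmetric]
    proof (rule separation_rate_le)
      show "C * r > 0" using Cp r by simp
      fix f g assume fg: "(f, g) \<in> besov_class \<delta> \<gamma> R R' R''" and far: "L2norm (\<lambda>x. f x - g x) > C * r"
      have "intensity f" "intensity g" using fg by (auto simp: besov_class_def)
      then interpret bounded_poisson_pair n f g "P f g" R''
        using fg n R P by (intro bounded_poisson_pair_besov_class) auto
      have "\<exists>l\<in>levels J. \<kappa> * x < (inner_nu h (haar l))\<^sup>2"
      proof (rule ccontr)
        assume "\<not> (\<exists>l\<in>levels J. \<kappa> * x < (inner_nu h (haar l))\<^sup>2)"
        then have small: "(inner_nu h (haar l))\<^sup>2 \<le> \<kappa> * x" if "l \<in> levels J" for l using that by force
        have "(L2norm h)\<^sup>2 \<le> (\<Sum>l\<in>levels J. (inner_nu h (haar l))\<^sup>2) + R\<^sup>2 * 2 powr (- 2 * real J * \<delta>) / (1 - 2 powr (- 2 * \<delta>))"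
          by (rule besov_class_haar[OF fg \<delta>])
        also have "\<dots> \<le> R'\<^sup>2 * (\<kappa> * x) powr \<theta> + R\<^sup>2 * r\<^sup>2 / (1 - 2 powr (- 2 * \<delta>))"
          unfolding \<theta>_def using \<kappa> x q tail
          by (intro add_mono weak_besov_class_haar[OF fg] small divide_right_mono mult_left_mono) auto
        also have "\<dots> = (C * r)\<^sup>2"
          using \<kappa> x by (simp add: power_mult_distrib Cp(2) r2 powr_mult G_def algebra_simps)
        finally have "L2norm h \<le> C * r" using Cp r by (intro power2_le_imp_le[of "L2norm h"]) auto
        then show False using far by simp
      qed
      then obtain l where l: "l \<in> levels J" "\<kappa> * x < (inner_nu h (haar l))\<^sup>2" by blast
      have "144 * R'' * (w_single l + ln (1 / t) + 1) / \<beta> \<le> 144 * R'' * (A * ln n) / \<beta>"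
        using weight[OF l(1)] \<beta> R by (intro divide_right_mono mult_left_mono) auto
      also have "\<dots> = n * (\<kappa> * x)" using n by (simp add: \<kappa>_def x_def)
      also have "\<dots> \<le> n * (inner_nu h (haar l))\<^sup>2" using l(2) n by (intro mult_left_mono) auto
      finally show "emeasure (P f g) {\<omega> \<in> space (P f g). Psi_test Jbar \<infinity> \<alpha> \<omega> = 0} \<le> ennreal \<beta>"
        by (intro Phi2_power[OF \<beta> t l(1)]) (auto simp: t_def dest: Psi_test_zero)
    qed
  qed
qed

theorem corollary1:
  fixes \<alpha> \<beta> \<delta> \<gamma> R R' R'' :: real
  assumes "0 < \<alpha>" "\<alpha> < 1" "0 < \<beta>" "\<beta> < 1"
    and "\<delta> > 0" "\<gamma> > 0" "R > 0" "R' > 0" "R'' > 0"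
  shows "\<exists>C::real. C > 0 \<and>
    (\<forall>(n::real) (Jbar::nat) (Jt::enat)
       (P :: (real \<Rightarrow> real) \<Rightarrow> (real \<Rightarrow> real) \<Rightarrow> (real set \<times> real set) measure).
       n > 1 \<and> ln (ln n) \<ge> 1 \<and> Jbar \<ge> 1 \<and> 2 ^ Jbar \<ge> n\<^sup>2 \<and> Jt = \<infinity> \<and>
       (\<forall>f g. intensity f \<and> intensity g \<longrightarrow> joint_poisson_law n f g (P f g)) \<longrightarrow>
       (\<delta> \<ge> \<gamma> / 2 \<longrightarrow>
          separation_rate P (Psi_test Jbar Jt \<alpha>) (besov_class \<delta> \<gamma> R R' R'') \<beta>
            \<le> ennreal (C * (ln (ln n) / n) powr (2 * \<delta> / (4 * \<delta> + 1)))) \<and>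
       (\<delta> < \<gamma> / 2 \<longrightarrow>
          separation_rate P (Psi_test Jbar Jt \<alpha>) (besov_class \<delta> \<gamma> R R' R'') \<beta>
            \<le> ennreal (C * (ln n / n) powr (\<gamma> / (2 * \<gamma> + 1)))))"
proof -
  obtain C1 where C1: "C1 > 0" and level: "\<And>n Jbar Jt P. n > 1 \<and> ln (ln n) \<ge> 1 \<and> 2 ^ Jbar \<ge> n\<^sup>2 \<and>
       (\<forall>f g. intensity f \<and> intensity g \<longrightarrow> joint_poisson_law n f g (P f g)) \<Longrightarrow>
       separation_rate P (Psi_test Jbar Jt \<alpha>) (besov_class \<delta> \<gamma> R R' R'') \<beta>
            \<le> ennreal (C1 * (ln (ln n) / n) powr (2 * \<delta> / (4 * \<delta> + 1)))"
    using separation_rate_levels[OF assms(1-5,7,9), of \<gamma> R'] by blast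
  obtain C2 where C2: "C2 > 0" and coefficient: "\<And>n Jbar P. n > 1 \<and> ln (ln n) \<ge> 1 \<and>
       (\<forall>f g. intensity f \<and> intensity g \<longrightarrow> joint_poisson_law n f g (P f g)) \<Longrightarrow>
       separation_rate P (Psi_test Jbar \<infinity> \<alpha>) (besov_class \<delta> \<gamma> R R' R'') \<beta>
            \<le> ennreal (C2 * (ln n / n) powr (\<gamma> / (2 * \<gamma> + 1)))"
    using separation_rate_coefficients[OF assms(1-7,9), of R'] by blast
  have mono: "ennreal (c * x powr e) \<le> ennreal (max C1 C2 * x powr e)" if "c = C1 \<or> c = C2" for c x e :: real
    using that by (intro ennreal_leI mult_right_mono) auto
  show ?thesis
  proof (intro exI[of _ "max C1 C2"] conjI allI impI)
    show "max C1 C2 > 0" using C1 by simp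
  next
    fix n :: real and Jbar :: nat and Jt :: enat
      and P :: "(real \<Rightarrow> real) \<Rightarrow> (real \<Rightarrow> real) \<Rightarrow> (real set \<times> real set) measure"
    assume *: "n > 1 \<and> ln (ln n) \<ge> 1 \<and> Jbar \<ge> 1 \<and> 2 ^ Jbar \<ge> n\<^sup>2 \<and> Jt = \<infinity> \<and>
       (\<forall>f g. intensity f \<and> intensity g \<longrightarrow> joint_poisson_law n f g (P f g))"
    show "separation_rate P (Psi_test Jbar Jt \<alpha>) (besov_class \<delta> \<gamma> R R' R'') \<beta>
            \<le> ennreal (max C1 C2 * (ln (ln n) / n) powr (2 * \<delta> / (4 * \<delta> + 1)))"
      by (rule order_trans[OF level mono]) (use * in simp_all)
    have "Jt = \<infinity>" using * by simp
    show "separation_rate P (Psi_test Jbar Jt \<alpha>) (besov_class \<delta> \<gamma> R R' R'') \<beta>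
            \<le> ennreal (max C1 C2 * (ln n / n) powr (\<gamma> / (2 * \<gamma> + 1)))"
      unfolding \<open>Jt = \<infinity>\<close> by (rule order_trans[OF coefficient mono]) (use * in simp_all)
  qed
qed

end
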